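(* Let $K$ be any pointed simplicial set. There is a natural (in $K$, with respect to basepoint-preserving simplicial maps) isomorphism of chain Hopf algebras $$\widehat\alpha:(T\widetilde{C}(K),\hat d,\widehat\Delta_K)\longrightarrow(\Omega C(EK),\psi_{EK}),$$ namely the morphism of algebras induced by $\alpha$; that is, $\widehat\alpha$ is an isomorphism of algebras that commutes with the differentials, the augmentations, and the diagonals: $(\widehat\alpha\otimes\widehat\alpha)\circ\widehat\Delta_K=\psi_{EK}\circ\widehat\alpha$. Here $\hat d$ is the derivation determined by the differential $d$ of $C(K)$, and $\widehat\Delta_K$ is the algebra morphism determined by $\Delta_K$.
   Context: All chain complexes are over $\mathbb Z$ and the Koszul sign convention is used. A pointed simplicial set $K$ has basepoint $k_0\in K_0$; put $k_n=s_0^nk_0$. $C(K)$ denotes normalized chains, with differential $\sum_i(-1)^i\partial_i$ and coproduct $\Delta_K(x)=\sum_{i=0}^n\tilde\partial^{n-i}x\otimes\partial_0^ix$ for $x\in K_n$, where $\tilde\partial^{n-i}=\partial_{i+1}\cdots\partial_n$. $\widetilde C(K)=\ker(C(K)\to C( * )\cong\mathbb Z)$; thus $C(K)=\mathbb Z\{k_0\}\oplus\widetilde C(K)$, $\widetilde C_{>0}(K)=C_{>0}(K)$, and $\widetilde C_0(K)$ has basis $\{y-k_0: y\in K_0\setminus\{k_0\}\}$. Tensor algebra side: $T\widetilde C(K)$ is the free associative algebra on $\widetilde C(K)$, augmented by sending $\widetilde C(K)$ to $0$. $\hat d$ is the derivation extending the differential of $\widetilde C(K)$. $\widehat\Delta_K$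 is the algebra map $T\widetilde C(K)\to T\widetilde C(K)\otimes T\widetilde C(K)$ whose restriction to $\widetilde C(K)$ is $\widetilde C(K)\subset C(K)\xrightarrow{\Delta_K}C(K)\otimes C(K)\to T\widetilde C(K)\otimes T\widetilde C(K)$, the last map being the tensor square of the map $C(K)\to T\widetilde C(K)$ that is the inclusion on $\widetilde C(K)$ and sends $k_0$ to $1$. Simplicial suspension $EK$: $E_0K=\{b_0\}$; $E_nK$ is the set of pairs $(i,x)$, $i\ge1$, $x\in K_{n-i}$, modulo $(i,k_n)=s_0^{n+i}b_0=:b_{n+i}$. Faces and degeneracies are generated by $\partial_0(1,x)=b_n$ for $x\in K_n$; $\partial_1(1,x)=b_0$ for $x\in K_0$; $\partial_{i+1}(1,x)=(1,\partial_ix)$ for $x\in K_n$, $n>0$; $s_0(i,x)=(i+1,x)$; $s_{i+1}(1,x)=(1,s_ix)$. Cobar construction: for a coaugmented chain coalgebra $C$ with counit $\varepsilon$, $\overline C=\ker\varepsilon$ and $\overline\Delta(c)=\Delta(c)-(c\otimes1+1\otimes c)$, $\Omega C=(T(s^{-1}\overline C),d_\Omega)$ with $d_\Omega=-s^{-1}ds+\mu(s^{-1}\otimes s^{-1})\overline\Delta s$ on generators; words are written $[x_1|\cdots|x_n]=s^{-1}x_1\otimes\cdots\otimes s^{-1}x_n$, and the unit is $[\,]$. In $C(EK)$ the coaugmentation is given by $b_0$. Map $\alpha:C(K)\to\Omega C(EK)$: $\alpha(k_0)=[\,]$, $\alpha(y-k_0)=[(1,y)]$ for $y\in K_0\setminus\{k_0\}$,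 $\alpha(x)=[(1,x)]$ for $x\in K_{\ge1}$. Milgram map: $q:\Omega(C\otimes C')\to\Omega C\otimes\Omega C'$ is the algebra map with $q[x\otimes1]=[x]\otimes[\,]$, $q[1\otimes y]=[\,]\otimes[y]$, $q[x\otimes y]=0$ for $x\in\overline C$, $y\in\overline{C'}$. Eilenberg–Zilber data: for simplicial sets $X,Y$, $f:C(X\times Y)\to C(X)\otimes C(Y)$ is $f(x\times y)=\sum_{i=0}^n\tilde\partial^{n-i}x\otimes\partial_0^iy$, and $\nabla:C(X)\otimes C(Y)\to C(X\times Y)$ is $\nabla(x\otimes y)=\sum_{(\mu,\nu)}(-1)^{\epsilon(\mu)}s_{\nu_q}\cdots s_{\nu_1}x\times s_{\mu_p}\cdots s_{\mu_1}y$ ($x\in X_p$, $y\in Y_q$), the sum being over $(p,q)$-shuffles $(\mu,\nu)$ (partitions of $\{0,\dots,p+q-1\}$ into $\mu_1<\cdots<\mu_p$ and $\nu_1<\cdots<\nu_q$), with $\epsilon(\mu)=\sum_i(\mu_i-(i-1))$. The derived operator of $s_{i_1}\cdots s_{i_k}\partial_{j_1}\cdots\partial_{j_l}$ is $s_{i_1+1}\cdots s_{i_k+1}\partial_{j_1+1}\cdots\partial_{j_l+1}$; this is extended componentwise to products and linearly to formal sums of operators on unnormalized chains, and denoted by a prime. The homotopy $\varphi:C(X\times Y)\to C(X\times Y)$ of degree $+1$ is given by $\varphi_0=0$ and $\varphi_n=-\varphi_{n-1}'+(\nabla f)'s_0$ in degree $n>0$ (computed on unnormalized chains, then passed to normalized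 chains). Maps $F_k$: take $X=Y=EK$ and let $\Delta$ be the coproduct of $C(EK\times EK)$. $F_0=0$; $F_1$ is $f$ followed by projection to positive degrees and $s^{-1}$; and $F_k=-\sum_{i+j=k}(F_i\otimes F_j)\Delta\varphi:C(EK\times EK)\to T^k\bigl(s^{-1}(C(EK)\otimes C(EK))_+\bigr)$ for $k\ge2$. Extended cobar diagonal: with $\Lambda:EK\to EK\times EK$ the simplicial diagonal, $\xi_K=q\circ\sum_{k\ge1}F_k\circ C(\Lambda)$ (on each simplex of $EK$ only finitely many $F_k\circ C(\Lambda)$ are nonzero), and $\psi_{EK}:\Omega C(EK)\to\Omega C(EK)\otimes\Omega C(EK)$ is the algebra map with $\psi_{EK}[(1,x)]=\xi_K((1,x))$. *)

theory Defs
  imports "HOL-Algebra.QuotRing" "HOL-Library.Poly_Mapping"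
begin

text \<open>
  All modules that occur are free over the integers on explicit bases, so a module with basis
  \<open>B\<close> is rendered by the finitely supported functions \<open>'b \<Rightarrow>\<^sub>0 int\<close> with support in \<open>B\<close>
  (\<open>frag_of\<close>, \<open>frag_cmul\<close>, \<open>frag_extend\<close> of the library), the tensor product of modules with
  bases \<open>B\<close>, \<open>B'\<close> by the one with basis \<open>B \<times> B'\<close>, and the tensor algebra on a module with basis
  \<open>B\<close> by the one whose basis is the set of words \<open>lists B\<close>.
\<close>

section \<open>Graded free modules and the Koszul rule\<close>

definition ksign :: "int \<Rightarrow> int" where
  "ksign n = (if even n then 1 else - 1)"

definition bilin :: "('a \<Rightarrow> 'b \<Rightarrow> 'c \<Rightarrow>\<^sub>0 int) \<Rightarrow> ('a \<Rightarrow>\<^sub>0 int) \<Rightarrow> ('b \<Rightarrow>\<^sub>0 int) \<Rightarrow> 'c \<Rightarrow>\<^sub>0 int" where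
  "bilin f a b = frag_extend (\<lambda>x. frag_extend (f x) b) a"

definition tens :: "('a \<Rightarrow>\<^sub>0 int) \<Rightarrow> ('b \<Rightarrow>\<^sub>0 int) \<Rightarrow> ('a \<times> 'b) \<Rightarrow>\<^sub>0 int" where
  "tens = bilin (\<lambda>x y. frag_of (x, y))"

text \<open>
  \<open>tensor_map deg q f g\<close> is \<open>f \<otimes> g\<close> for linear maps \<open>f\<close> and \<open>g\<close>, where \<open>g\<close> has degree \<open>q\<close>:
  it sends \<open>x \<otimes> y\<close> to \<open>(-1)^(q |x|) f x \<otimes> g y\<close>.
\<close>
definition tensor_map ::
  "('a \<Rightarrow> int) \<Rightarrow> int \<Rightarrow> (('a \<Rightarrow>\<^sub>0 int) \<Rightarrow> 'c \<Rightarrow>\<^sub>0 int) \<Rightarrow> (('b \<Rightarrow>\<^sub>0 int) \<Rightarrow> 'd \<Rightarrow>\<^sub>0 int)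
    \<Rightarrow> (('a \<times> 'b) \<Rightarrow>\<^sub>0 int) \<Rightarrow> ('c \<times> 'd) \<Rightarrow>\<^sub>0 int" where
  "tensor_map deg q f g =
     frag_extend (\<lambda>(x, y). frag_cmul (ksign (q * deg x)) (tens (f (frag_of x)) (g (frag_of y))))"


section \<open>Graded algebras and chain Hopf algebras\<close>

text \<open>A graded algebra with a homogeneous basis; \<open>hdeg\<close> is the degree of the basis elements.\<close>
record 'w galg = "('w \<Rightarrow>\<^sub>0 int) ring" +
  hdeg :: "'w \<Rightarrow> int"

record 'w chain_hopf = "'w galg" +
  diff :: "('w \<Rightarrow>\<^sub>0 int) \<Rightarrow> 'w \<Rightarrow>\<^sub>0 int"
  aug :: "('w \<Rightarrow>\<^sub>0 int) \<Rightarrow> int"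
  diag :: "('w \<Rightarrow>\<^sub>0 int) \<Rightarrow> ('w \<times> 'w) \<Rightarrow>\<^sub>0 int"

definition homog :: "('w, 'm) galg_scheme \<Rightarrow> int \<Rightarrow> ('w \<Rightarrow>\<^sub>0 int) set" where
  "homog A n = {a \<in> carrier A. \<forall>w \<in> Poly_Mapping.keys a. hdeg A w = n}"

definition tensor_galg ::
  "('u, 'm) galg_scheme \<Rightarrow> ('v, 'n) galg_scheme \<Rightarrow> ('u \<times> 'v) galg" where
  "tensor_galg A B =
     \<lparr> carrier = {c. \<forall>(u, v) \<in> Poly_Mapping.keys c. frag_of u \<in> carrier A \<and> frag_of v \<in> carrier B},
       mult = bilin (\<lambda>(a, b) (c, d).
         frag_cmul (ksign (hdeg B b * hdeg A c))
           (tens (frag_of a \<otimes>\<^bsub>A\<^esub> frag_of c) (frag_of b \<otimes>\<^bsub>B\<^esub> frag_of d))),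
       one = tens \<one>\<^bsub>A\<^esub> \<one>\<^bsub>B\<^esub>,
       zero = 0,
       add = (+),
       hdeg = (\<lambda>(u, v). hdeg A u + hdeg B v) \<rparr>"

definition tensor_diff ::
  "('w, 'm) chain_hopf_scheme \<Rightarrow> (('w \<times> 'w) \<Rightarrow>\<^sub>0 int) \<Rightarrow> ('w \<times> 'w) \<Rightarrow>\<^sub>0 int" where
  "tensor_diff H c =
     tensor_map (hdeg H) 0 (diff H) id c + tensor_map (hdeg H) (- 1) id (diff H) c"

text \<open>
  A chain Hopf algebra is a monoid in chain coalgebras: an augmented chain algebra with a
  coassociative counital diagonal that is a morphism of chain algebras. No antipode is required
  (and none exists in general for the tensor algebra below, where \<open>1 + (y - k\<^sub>0)\<close> is group-like
  but not invertible).
\<close>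
locale chain_hopf_algebra = ring H for H :: "('w, 'm) chain_hopf_scheme" (structure) +
  assumes free_carrier: "\<exists>B. carrier H = {a. Poly_Mapping.keys a \<subseteq> B}"
    and add_eq: "add H = (+)"
    and zero_eq: "zero H = 0"
    and one_homog: "\<one> \<in> homog H 0"
    and mult_homog: "\<And>m n a b. \<lbrakk>a \<in> homog H m; b \<in> homog H n\<rbrakk> \<Longrightarrow> a \<otimes> b \<in> homog H (m + n)"
    and diff_add: "\<And>a b. \<lbrakk>a \<in> carrier H; b \<in> carrier H\<rbrakk> \<Longrightarrow> diff H (a + b) = diff H a + diff H b"
    and diff_homog: "\<And>n a. a \<in> homog H n \<Longrightarrow> diff H a \<in> homog H (n - 1)"
    and diff_diff: "\<And>a. a \<in> carrier H \<Longrightarrow> diff H (diff H a) = 0"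
    and Leibniz: "\<And>n a b. \<lbrakk>a \<in> homog H n; b \<in> carrier H\<rbrakk> \<Longrightarrow>
      diff H (a \<otimes> b) = diff H a \<otimes> b + frag_cmul (ksign n) (a \<otimes> diff H b)"
    and aug_add: "\<And>a b. \<lbrakk>a \<in> carrier H; b \<in> carrier H\<rbrakk> \<Longrightarrow> aug H (a + b) = aug H a + aug H b"
    and aug_mult: "\<And>a b. \<lbrakk>a \<in> carrier H; b \<in> carrier H\<rbrakk> \<Longrightarrow> aug H (a \<otimes> b) = aug H a * aug H b"
    and aug_one: "aug H \<one> = 1"
    and aug_homog: "\<And>n a. \<lbrakk>a \<in> homog H n; n \<noteq> 0\<rbrakk> \<Longrightarrow> aug H a = 0"
    and aug_diff: "\<And>a. a \<in> carrier H \<Longrightarrow> aug H (diff H a) = 0"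
    and diag_hom: "diag H \<in> ring_hom H (tensor_galg H H)"
    and diag_homog: "\<And>n a. a \<in> homog H n \<Longrightarrow> diag H a \<in> homog (tensor_galg H H) n"
    and diag_diff: "\<And>a. a \<in> carrier H \<Longrightarrow> diag H (diff H a) = tensor_diff H (diag H a)"
    and coassoc: "\<And>a. a \<in> carrier H \<Longrightarrow>
      frag_extend (\<lambda>((u, v), w). frag_of (u, (v, w)))
        (tensor_map (hdeg H) 0 (diag H) id (diag H a)) =
      tensor_map (hdeg H) 0 id (diag H) (diag H a)"
    and counit_left: "\<And>a. a \<in> carrier H \<Longrightarrow>
      frag_extend (\<lambda>(u, v). frag_cmul (aug H (frag_of u)) (frag_of v)) (diag H a) = a"
    and counit_right: "\<And>a. a \<in> carrier H \<Longrightarrow>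
      frag_extend (\<lambda>(u, v). frag_cmul (aug H (frag_of v)) (frag_of u)) (diag H a) = a"

definition chain_hopf_iso ::
  "('v, 'm) chain_hopf_scheme \<Rightarrow> ('w, 'n) chain_hopf_scheme
    \<Rightarrow> (('v \<Rightarrow>\<^sub>0 int) \<Rightarrow> 'w \<Rightarrow>\<^sub>0 int) \<Rightarrow> bool" where
  "chain_hopf_iso H H' h \<longleftrightarrow>
     chain_hopf_algebra H \<and> chain_hopf_algebra H' \<and>
     h \<in> ring_iso H H' \<and>
     (\<forall>n. h ` homog H n \<subseteq> homog H' n) \<and>
     (\<forall>a \<in> carrier H. h (diff H a) = diff H' (h a)) \<and>
     (\<forall>a \<in> carrier H. aug H' (h a) = aug H a) \<and>
     (\<forall>a \<in> carrier H. tensor_map (hdeg H) 0 h h (diag H a) = diag H' (h a))"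


section \<open>Tensor algebras\<close>

definition word_galg :: "'b set \<Rightarrow> ('b \<Rightarrow> int) \<Rightarrow> 'b list galg" where
  "word_galg B deg =
     \<lparr> carrier = {a. Poly_Mapping.keys a \<subseteq> lists B},
       mult = bilin (\<lambda>u v. frag_of (u @ v)),
       one = frag_of [],
       zero = 0,
       add = (+),
       hdeg = (\<lambda>w. sum_list (map deg w)) \<rparr>"

text \<open>The algebra map out of the tensor algebra that is given by \<open>g\<close> on generators.\<close>
definition alg_ext ::
  "('c \<Rightarrow>\<^sub>0 int, 'm) ring_scheme \<Rightarrow> ('b \<Rightarrow> 'c \<Rightarrow>\<^sub>0 int) \<Rightarrow> ('b list \<Rightarrow>\<^sub>0 int) \<Rightarrow> 'c \<Rightarrow>\<^sub>0 int" where
  "alg_ext R g = frag_extend (\<lambda>w. foldr (\<lambda>b c. g b \<otimes>\<^bsub>R\<^esub> c) w \<one>\<^bsub>R\<^esub>)"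

text \<open>The derivation of degree -1 of the tensor algebra that is given by \<open>g\<close> on generators.\<close>
primrec der_word :: "('b \<Rightarrow> int) \<Rightarrow> ('b \<Rightarrow> 'b list \<Rightarrow>\<^sub>0 int) \<Rightarrow> 'b list \<Rightarrow> 'b list \<Rightarrow>\<^sub>0 int" where
  "der_word deg g [] = 0"
| "der_word deg g (b # w) =
     bilin (\<lambda>u v. frag_of (u @ v)) (g b) (frag_of w)
     + frag_cmul (ksign (deg b)) (bilin (\<lambda>u v. frag_of (u @ v)) (frag_of [b]) (der_word deg g w))"

definition der_ext ::
  "('b \<Rightarrow> int) \<Rightarrow> ('b \<Rightarrow> 'b list \<Rightarrow>\<^sub>0 int) \<Rightarrow> ('b list \<Rightarrow>\<^sub>0 int) \<Rightarrow> 'b list \<Rightarrow>\<^sub>0 int" where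
  "der_ext deg g = frag_extend (der_word deg g)"

definition concat_tensor :: "('b list \<times> 'b list \<Rightarrow>\<^sub>0 int) \<Rightarrow> 'b list \<Rightarrow>\<^sub>0 int" where
  "concat_tensor = frag_extend (\<lambda>(u, v). frag_of (u @ v))"


section \<open>Simplicial sets\<close>

text \<open>\<open>face X n i\<close> and \<open>degen X n i\<close> are the operators \<open>\<partial>\<^sub>i\<close> and \<open>s\<^sub>i\<close> on \<open>simplices X n\<close>.\<close>
record 'a sset =
  simplices :: "nat \<Rightarrow> 'a set"
  face :: "nat \<Rightarrow> nat \<Rightarrow> 'a \<Rightarrow> 'a"
  degen :: "nat \<Rightarrow> nat \<Rightarrow> 'a \<Rightarrow> 'a"

record 'a pointed_sset = "'a sset" +
  basept :: 'a

locale simplicial_set =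
  fixes X :: "('a, 'm) sset_scheme"
  assumes face_closed: "\<And>n i x. \<lbrakk>x \<in> simplices X (Suc n); i \<le> Suc n\<rbrakk> \<Longrightarrow> face X (Suc n) i x \<in> simplices X n"
    and degen_closed: "\<And>n i x. \<lbrakk>x \<in> simplices X n; i \<le> n\<rbrakk> \<Longrightarrow> degen X n i x \<in> simplices X (Suc n)"
    and face_face: "\<And>n i j x. \<lbrakk>x \<in> simplices X (Suc (Suc n)); i < j; j \<le> Suc (Suc n)\<rbrakk> \<Longrightarrow>
      face X (Suc n) i (face X (Suc (Suc n)) j x) = face X (Suc n) (j - 1) (face X (Suc (Suc n)) i x)"
    and degen_degen: "\<And>n i j x. \<lbrakk>x \<in> simplices X n; i \<le> j; j \<le> n\<rbrakk> \<Longrightarrow>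
      degen X (Suc n) i (degen X n j x) = degen X (Suc n) (Suc j) (degen X n i x)"
    and face_degen_less: "\<And>n i j x. \<lbrakk>x \<in> simplices X (Suc n); i < j; j \<le> Suc n\<rbrakk> \<Longrightarrow>
      face X (Suc (Suc n)) i (degen X (Suc n) j x) = degen X n (j - 1) (face X (Suc n) i x)"
    and face_degen_same: "\<And>n i j x. \<lbrakk>x \<in> simplices X n; j \<le> n; i = j \<or> i = Suc j\<rbrakk> \<Longrightarrow>
      face X (Suc n) i (degen X n j x) = x"
    and face_degen_greater: "\<And>n i j x. \<lbrakk>x \<in> simplices X (Suc n); Suc j < i; i \<le> Suc (Suc n)\<rbrakk> \<Longrightarrow>
      face X (Suc (Suc n)) i (degen X (Suc n) j x) = degen X n j (face X (Suc n) (i - 1) x)"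

locale pointed_simplicial_set = simplicial_set X for X :: "('a, 'm) pointed_sset_scheme" +
  assumes basept_in: "basept X \<in> simplices X 0"

definition pointed_simplicial_map ::
  "'a pointed_sset \<Rightarrow> 'b pointed_sset \<Rightarrow> (nat \<Rightarrow> 'a \<Rightarrow> 'b) \<Rightarrow> bool" where
  "pointed_simplicial_map K L g \<longleftrightarrow>
     (\<forall>n. \<forall>x \<in> simplices K n. g n x \<in> simplices L n) \<and>
     (\<forall>n i. \<forall>x \<in> simplices K (Suc n). i \<le> Suc n \<longrightarrow>
        g n (face K (Suc n) i x) = face L (Suc n) i (g (Suc n) x)) \<and>
     (\<forall>n i. \<forall>x \<in> simplices K n. i \<le> n \<longrightarrow>
        g (Suc n) (degen K n i x) = degen L n i (g n x)) \<and>
     g 0 (basept K) = basept L"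

primrec base_simplex :: "('a, 'm) pointed_sset_scheme \<Rightarrow> nat \<Rightarrow> 'a" where
  "base_simplex K 0 = basept K"
| "base_simplex K (Suc n) = degen K n 0 (base_simplex K n)"

definition prod_sset :: "('a, 'm) sset_scheme \<Rightarrow> ('b, 'n) sset_scheme \<Rightarrow> ('a \<times> 'b) sset" where
  "prod_sset X Y =
     \<lparr> simplices = (\<lambda>n. simplices X n \<times> simplices Y n),
       face = (\<lambda>n i. map_prod (face X n i) (face Y n i)),
       degen = (\<lambda>n i. map_prod (degen X n i) (degen Y n i)) \<rparr>"


section \<open>The simplicial suspension\<close>

text \<open>
  \<open>None\<close> represents every \<open>b\<^sub>n\<close>; \<open>Some (i, x)\<close> represents the class of a pair \<open>(i, x)\<close> that is not
  identified with some \<open>b\<^sub>n\<close>. \<open>susp_pt K n i x\<close> is the class of \<open>(i, x)\<close> for \<open>x\<close> of dimension \<open>n\<close>.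
\<close>
definition susp_pt :: "('a, 'm) pointed_sset_scheme \<Rightarrow> nat \<Rightarrow> nat \<Rightarrow> 'a \<Rightarrow> (nat \<times> 'a) option" where
  "susp_pt K n i x = (if x = base_simplex K n then None else Some (i, x))"

text \<open>
  Since \<open>(i, x) = s\<^sub>0^(i-1) (1, x)\<close>, the simplicial identities turn the generating formulas for the
  faces and degeneracies into the ones below; conversely, the generating formulas are proved
  as lemmas afterwards.
\<close>
definition susp :: "'a pointed_sset \<Rightarrow> (nat \<times> 'a) option pointed_sset" where
  "susp K =
     \<lparr> simplices = (\<lambda>n. insert None
         {susp_pt K (n - i) i x | i x. 1 \<le> i \<and> i \<le> n \<and> x \<in> simplices K (n - i)}),
       face = (\<lambda>n j z. case z of
           None \<Rightarrow> None
         | Some (i, x) \<Rightarrow>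
             if j < i then (if i = 1 then None else Some (i - 1, x))
             else if n = i then None
             else susp_pt K (n - i - 1) i (face K (n - i) (j - i) x)),
       degen = (\<lambda>n j z. case z of
           None \<Rightarrow> None
         | Some (i, x) \<Rightarrow>
             if j < i then Some (Suc i, x)
             else susp_pt K (Suc (n - i)) i (degen K (n - i) (j - i) x)),
       basept = None \<rparr>"

definition susp_map ::
  "'b pointed_sset \<Rightarrow> (nat \<Rightarrow> 'a \<Rightarrow> 'b) \<Rightarrow> nat \<Rightarrow> (nat \<times> 'a) option \<Rightarrow> (nat \<times> 'b) option" where
  "susp_map L g n z = (case z of None \<Rightarrow> None | Some (i, x) \<Rightarrow> susp_pt L (n - i) i (g (n - i) x))"

context pointed_simplicial_set
begin

lemma base_simplex_in: "base_simplex X n \<in> simplices X n"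
  by (induction n) (auto simp: basept_in degen_closed)

lemma degen_base_simplex: "i \<le> n \<Longrightarrow> degen X n i (base_simplex X n) = base_simplex X (Suc n)"
proof (induction n arbitrary: i)
  case (Suc n)
  show ?case
  proof (cases i)
    case (Suc j)
    with Suc.prems have "j \<le> n" by simp
    then show ?thesis
      using degen_degen[OF base_simplex_in, of 0 j n] Suc.IH[of j] Suc by simp
  qed simp
qed simp

lemma face_base_simplex: "i \<le> Suc n \<Longrightarrow> face X (Suc n) i (base_simplex X (Suc n)) = base_simplex X n"
proof (cases "i = 0")
  case False
  assume "i \<le> Suc n"
  then have "i - 1 \<le> n" "i = Suc (i - 1)" using False by auto
  then show ?thesis
    using face_degen_same[OF base_simplex_in, of "i - 1" n i] degen_base_simplex[of "i - 1" n] by simp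
qed (simp add: face_degen_same[OF base_simplex_in])

end

lemma susp_face_0: "face (susp K) (Suc n) 0 (susp_pt K n 1 x) = basept (susp K)"
  by (simp add: susp_def susp_pt_def)

lemma susp_face_1: "face (susp K) 1 1 (susp_pt K 0 1 x) = basept (susp K)"
  by (simp add: susp_def susp_pt_def)

lemma susp_face_Suc:
  assumes "pointed_simplicial_set K" "i \<le> Suc n"
  shows "face (susp K) (Suc (Suc n)) (Suc i) (susp_pt K (Suc n) 1 x) =
    susp_pt K n 1 (face K (Suc n) i x)"
  using pointed_simplicial_set.face_base_simplex[OF assms] by (auto simp: susp_def susp_pt_def)

lemma susp_degen_0:
  assumes "1 \<le> i"
  shows "degen (susp K) (n + i) 0 (susp_pt K n i x) = susp_pt K n (Suc i) x"
  using assms by (simp add: susp_def susp_pt_def)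

lemma susp_degen_Suc:
  assumes "pointed_simplicial_set K" "i \<le> n"
  shows "degen (susp K) (Suc n) (Suc i) (susp_pt K n 1 x) = susp_pt K (Suc n) 1 (degen K n i x)"
  using pointed_simplicial_set.degen_base_simplex[OF assms] by (auto simp: susp_def susp_pt_def)


section \<open>Normalized chains\<close>

text \<open>
  Basis elements carry their dimension. The normalized chains (chains modulo degenerate simplices)
  have the nondegenerate simplices as basis, and \<open>nchain X n x\<close> is the class of an arbitrary
  \<open>n\<close>-simplex \<open>x\<close>.
\<close>
type_synonym 'a cell = "nat \<times> 'a"

abbreviation cdeg :: "'a cell \<Rightarrow> int" where
  "cdeg \<sigma> \<equiv> int (fst \<sigma>)"

definition degenerate :: "('a, 'm) sset_scheme \<Rightarrow> nat \<Rightarrow> 'a \<Rightarrow> bool" where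
  "degenerate X n x \<longleftrightarrow> (\<exists>m i y. n = Suc m \<and> i \<le> m \<and> y \<in> simplices X m \<and> x = degen X m i y)"

definition nondeg_cells :: "('a, 'm) sset_scheme \<Rightarrow> 'a cell set" where
  "nondeg_cells X = {(n, x). x \<in> simplices X n \<and> \<not> degenerate X n x}"

definition nchain :: "('a, 'm) sset_scheme \<Rightarrow> nat \<Rightarrow> 'a \<Rightarrow> 'a cell \<Rightarrow>\<^sub>0 int" where
  "nchain X n x = (if degenerate X n x then 0 else frag_of (n, x))"

definition bd :: "('a, 'm) sset_scheme \<Rightarrow> ('a cell \<Rightarrow>\<^sub>0 int) \<Rightarrow> 'a cell \<Rightarrow>\<^sub>0 int" where
  "bd X = frag_extend (\<lambda>(n, x).
     if n = 0 then 0 else (\<Sum>i\<le>n. frag_cmul ((- 1) ^ i) (nchain X (n - 1) (face X n i x))))"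

definition chain_map ::
  "('b, 'n) sset_scheme \<Rightarrow> (nat \<Rightarrow> 'a \<Rightarrow> 'b) \<Rightarrow> ('a cell \<Rightarrow>\<^sub>0 int) \<Rightarrow> 'b cell \<Rightarrow>\<^sub>0 int" where
  "chain_map Y g = frag_extend (\<lambda>(n, x). nchain Y n (g n x))"

text \<open>
  Formal simplicial operators are words in the letters \<open>s\<^sub>i\<close>, \<open>\<partial>\<^sub>j\<close>, written and applied as
  composites, i.e. the last letter of the word acts first.
\<close>
datatype letter = Deg nat | Fac nat

primrec act_letter :: "('a, 'm) sset_scheme \<Rightarrow> letter \<Rightarrow> 'a cell \<Rightarrow> 'a cell" where
  "act_letter X (Deg i) \<sigma> = (Suc (fst \<sigma>), degen X (fst \<sigma>) i (snd \<sigma>))"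
| "act_letter X (Fac i) \<sigma> = (fst \<sigma> - 1, face X (fst \<sigma>) i (snd \<sigma>))"

definition act :: "('a, 'm) sset_scheme \<Rightarrow> letter list \<Rightarrow> nat \<Rightarrow> 'a \<Rightarrow> 'a" where
  "act X w n x = snd (foldr (act_letter X) w (n, x))"

text \<open>In dimension \<open>n\<close>: \<open>\<partial>\<^sub>i\<^sub>+\<^sub>1 \<dots> \<partial>\<^sub>n\<close> and \<open>\<partial>\<^sub>0^i\<close>.\<close>
definition front_op :: "nat \<Rightarrow> nat \<Rightarrow> letter list" where
  "front_op n i = map Fac [Suc i..<Suc n]"

definition back_op :: "nat \<Rightarrow> letter list" where
  "back_op i = replicate i (Fac 0)"

definition coprod :: "('a, 'm) sset_scheme \<Rightarrow> ('a cell \<Rightarrow>\<^sub>0 int) \<Rightarrow> ('a cell \<times> 'a cell) \<Rightarrow>\<^sub>0 int" where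
  "coprod X = frag_extend (\<lambda>(n, x). \<Sum>i\<le>n.
     tens (nchain X i (act X (front_op n i) n x)) (nchain X (n - i) (act X (back_op i) n x)))"


section \<open>The tensor algebra on reduced chains\<close>

text \<open>
  Reduced chains have the basis \<open>{y - k\<^sub>0} \<union> {nondegenerate simplices of positive dimension}\<close>.
  Its elements are labelled by the nondegenerate simplices other than \<open>k\<^sub>0\<close>, and \<open>red_incl\<close> sends a
  label to the chain it stands for.
\<close>
definition red_cells :: "'a pointed_sset \<Rightarrow> 'a cell set" where
  "red_cells K = nondeg_cells K - {(0, basept K)}"

definition red_incl :: "'a pointed_sset \<Rightarrow> 'a cell \<Rightarrow> 'a cell \<Rightarrow>\<^sub>0 int" where
  "red_incl K \<sigma> = (if fst \<sigma> = 0 then frag_of \<sigma> - frag_of (0, basept K) else frag_of \<sigma>)"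

text \<open>
  The projection of chains onto reduced chains along the basepoint, followed by the inclusion of
  generators into the tensor algebra. On a reduced chain this just expresses the chain in the
  basis above: the coefficient of \<open>y - k\<^sub>0\<close> is the coefficient of \<open>y\<close>.
\<close>
definition red_gen :: "'a pointed_sset \<Rightarrow> ('a cell \<Rightarrow>\<^sub>0 int) \<Rightarrow> 'a cell list \<Rightarrow>\<^sub>0 int" where
  "red_gen K = frag_extend (\<lambda>\<sigma>. if \<sigma> = (0, basept K) then 0 else frag_of [\<sigma>])"

text \<open>
  The map from chains to the tensor algebra that is the inclusion on reduced chains and sends
  \<open>k\<^sub>0\<close> to 1; a vertex \<open>y\<close> is \<open>(y - k\<^sub>0) + k\<^sub>0\<close>.
\<close>
definition unit_gen :: "'a pointed_sset \<Rightarrow> ('a cell \<Rightarrow>\<^sub>0 int) \<Rightarrow> 'a cell list \<Rightarrow>\<^sub>0 int" where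
  "unit_gen K = frag_extend (\<lambda>\<sigma>. red_gen K (frag_of \<sigma>) + (if fst \<sigma> = 0 then frag_of [] else 0))"

definition tensor_chains_alg :: "'a pointed_sset \<Rightarrow> 'a cell list galg" where
  "tensor_chains_alg K = word_galg (red_cells K) cdeg"

text \<open>The augmentation kills all nonempty words, i.e. it is the coefficient of the empty word.\<close>
definition tensor_chains :: "'a pointed_sset \<Rightarrow> 'a cell list chain_hopf" where
  "tensor_chains K = galg.extend (tensor_chains_alg K) (chain_hopf.fields
     (der_ext cdeg (\<lambda>\<sigma>. red_gen K (bd K (red_incl K \<sigma>))))
     (\<lambda>a. Poly_Mapping.lookup a [])
     (alg_ext (tensor_galg (tensor_chains_alg K) (tensor_chains_alg K))
        (\<lambda>\<sigma>. tensor_map cdeg 0 (unit_gen K) (unit_gen K) (coprod K (red_incl K \<sigma>)))))"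

definition tensor_chains_map ::
  "'a pointed_sset \<Rightarrow> 'b pointed_sset \<Rightarrow> (nat \<Rightarrow> 'a \<Rightarrow> 'b) \<Rightarrow> ('a cell list \<Rightarrow>\<^sub>0 int) \<Rightarrow> 'b cell list \<Rightarrow>\<^sub>0 int" where
  "tensor_chains_map K L g =
     alg_ext (tensor_chains_alg L) (\<lambda>\<sigma>. red_gen L (chain_map L g (red_incl K \<sigma>)))"


section \<open>The cobar construction on the chains of a pointed simplicial set\<close>

text \<open>
  The coaugmentation coideal (the kernel of the counit) is the module of reduced chains, so the
  labels are those used above, now in desuspended degree, and \<open>red_gen\<close> is \<open>s\<^sup>-\<^sup>1\<close> composed with the
  projection to the coaugmentation coideal; it has degree -1.
\<close>
definition bar_deg :: "'a cell \<Rightarrow> int" where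
  "bar_deg \<sigma> = cdeg \<sigma> - 1"

definition red_coprod :: "'a pointed_sset \<Rightarrow> ('a cell \<Rightarrow>\<^sub>0 int) \<Rightarrow> ('a cell \<times> 'a cell) \<Rightarrow>\<^sub>0 int" where
  "red_coprod X c =
     coprod X c - (tens c (frag_of (0, basept X)) + tens (frag_of (0, basept X)) c)"

definition cobar_alg :: "'a pointed_sset \<Rightarrow> 'a cell list galg" where
  "cobar_alg X = word_galg (red_cells X) bar_deg"

definition cobar_diff :: "'a pointed_sset \<Rightarrow> ('a cell list \<Rightarrow>\<^sub>0 int) \<Rightarrow> 'a cell list \<Rightarrow>\<^sub>0 int" where
  "cobar_diff X = der_ext bar_deg (\<lambda>\<sigma>.
     - red_gen X (bd X (red_incl X \<sigma>))
     + concat_tensor (tensor_map cdeg (- 1) (red_gen X) (red_gen X) (red_coprod X (red_incl X \<sigma>))))"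

definition cobar_map ::
  "'a pointed_sset \<Rightarrow> 'b pointed_sset \<Rightarrow> (nat \<Rightarrow> 'a \<Rightarrow> 'b) \<Rightarrow> ('a cell list \<Rightarrow>\<^sub>0 int) \<Rightarrow> 'b cell list \<Rightarrow>\<^sub>0 int" where
  "cobar_map X Y g = alg_ext (cobar_alg Y) (\<lambda>\<sigma>. red_gen Y (chain_map Y g (red_incl X \<sigma>)))"

text \<open>
  The Milgram map, on words whose letters are pairs of simplices standing for \<open>x \<otimes> y\<close>. It is used
  for \<open>X\<close> with basepoint as its only vertex, so that all other simplices lie in the
  coaugmentation coideal.
\<close>
definition milgram ::
  "'a pointed_sset \<Rightarrow> (('a cell \<times> 'a cell) list \<Rightarrow>\<^sub>0 int) \<Rightarrow> ('a cell list \<times> 'a cell list) \<Rightarrow>\<^sub>0 int" where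
  "milgram X = alg_ext (tensor_galg (cobar_alg X) (cobar_alg X)) (\<lambda>(\<sigma>, \<tau>).
     if \<tau> = (0, basept X) then frag_of ([\<sigma>], [])
     else if \<sigma> = (0, basept X) then frag_of ([], [\<tau>])
     else 0)"


section \<open>The Eilenberg--Zilber data\<close>

type_synonym op_pair = "letter list \<times> letter list"

definition aw :: "('a, 'm) sset_scheme \<Rightarrow> ('b, 'n) sset_scheme
    \<Rightarrow> (('a \<times> 'b) cell \<Rightarrow>\<^sub>0 int) \<Rightarrow> ('a cell \<times> 'b cell) \<Rightarrow>\<^sub>0 int" where
  "aw X Y = frag_extend (\<lambda>(n, (x, y)). \<Sum>i\<le>n.
     tens (nchain X i (act X (front_op n i) n x)) (nchain Y (n - i) (act Y (back_op i) n y)))"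

definition shuffle_exp :: "nat set \<Rightarrow> nat" where
  "shuffle_exp \<mu> = (\<Sum>i<card \<mu>. sorted_list_of_set \<mu> ! i - i)"

text \<open>The operator \<open>s\<^sub>\<nu>\<^sub>q \<dots> s\<^sub>\<nu>\<^sub>1\<close> for \<open>\<nu>\<^sub>1 < \<dots> < \<nu>\<^sub>q\<close>.\<close>
definition degen_op :: "nat set \<Rightarrow> letter list" where
  "degen_op \<nu> = map Deg (rev (sorted_list_of_set \<nu>))"

text \<open>The composite \<open>\<nabla> f\<close> in dimension \<open>n\<close> as a formal sum of pairs of operators.\<close>
definition ez_op :: "nat \<Rightarrow> op_pair \<Rightarrow>\<^sub>0 int" where
  "ez_op n = (\<Sum>p\<le>n. \<Sum>\<mu> | \<mu> \<subseteq> {..<n} \<and> card \<mu> = p.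
     frag_cmul ((- 1) ^ shuffle_exp \<mu>)
       (frag_of (degen_op ({..<n} - \<mu>) @ front_op n p, degen_op \<mu> @ back_op p)))"

primrec shift_letter :: "letter \<Rightarrow> letter" where
  "shift_letter (Deg i) = Deg (Suc i)"
| "shift_letter (Fac i) = Fac (Suc i)"

definition derived_op :: "(op_pair \<Rightarrow>\<^sub>0 int) \<Rightarrow> op_pair \<Rightarrow>\<^sub>0 int" where
  "derived_op = frag_extend (\<lambda>(u, v). frag_of (map shift_letter u, map shift_letter v))"

definition comp_s0 :: "(op_pair \<Rightarrow>\<^sub>0 int) \<Rightarrow> op_pair \<Rightarrow>\<^sub>0 int" where
  "comp_s0 = frag_extend (\<lambda>(u, v). frag_of (u @ [Deg 0], v @ [Deg 0]))"

primrec phi_op :: "nat \<Rightarrow> op_pair \<Rightarrow>\<^sub>0 int" where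
  "phi_op 0 = 0"
| "phi_op (Suc n) = - derived_op (phi_op n) + comp_s0 (derived_op (ez_op (Suc n)))"

definition phi :: "('a, 'm) sset_scheme \<Rightarrow> ('b, 'n) sset_scheme
    \<Rightarrow> (('a \<times> 'b) cell \<Rightarrow>\<^sub>0 int) \<Rightarrow> ('a \<times> 'b) cell \<Rightarrow>\<^sub>0 int" where
  "phi X Y = frag_extend (\<lambda>(n, (x, y)).
     frag_extend (\<lambda>(u, v). nchain (prod_sset X Y) (Suc n) (act X u n x, act Y v n y)) (phi_op n))"


section \<open>The extended cobar diagonal\<close>

text \<open>
  The summands with \<open>i = 0\<close> or \<open>j = 0\<close> in the recursion for \<open>F\<^sub>k\<close> vanish because \<open>F\<^sub>0 = 0\<close>, and the
  \<open>F\<^sub>i\<close> have degree -1.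
\<close>
fun szF :: "'a pointed_sset \<Rightarrow> nat \<Rightarrow> (('a \<times> 'a) cell \<Rightarrow>\<^sub>0 int) \<Rightarrow> ('a cell \<times> 'a cell) list \<Rightarrow>\<^sub>0 int" where
  "szF X 0 = (\<lambda>c. 0)"
| "szF X (Suc 0) = (\<lambda>c.
     frag_extend (\<lambda>(\<sigma>, \<tau>). if fst \<sigma> + fst \<tau> = 0 then 0 else frag_of [(\<sigma>, \<tau>)]) (aw X X c))"
| "szF X (Suc (Suc k)) = (\<lambda>c. - (\<Sum>i\<in>{1..Suc k}.
     concat_tensor (tensor_map cdeg (- 1) (szF X i) (szF X (Suc (Suc k) - i))
       (coprod (prod_sset X X) (phi X X c)))))"

text \<open>\<open>Sum_any\<close> is the sum over the (finitely many) \<open>k\<close> with nonzero summand.\<close>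
definition xi :: "'a pointed_sset \<Rightarrow> ('a cell \<Rightarrow>\<^sub>0 int) \<Rightarrow> ('a cell list \<times> 'a cell list) \<Rightarrow>\<^sub>0 int" where
  "xi X c = milgram X (Sum_any (\<lambda>k. szF X k (chain_map (prod_sset X X) (\<lambda>n x. (x, x)) c)))"

text \<open>
  The labels of the generators of the cobar construction on \<open>C(EK)\<close> are exactly the \<open>(1, x)\<close> with
  \<open>x\<close> a nondegenerate simplex of \<open>K\<close> other than \<open>k\<^sub>0\<close>.
\<close>
definition cobar_susp :: "'a pointed_sset \<Rightarrow> (nat \<times> 'a) option cell list chain_hopf" where
  "cobar_susp K = galg.extend (cobar_alg (susp K)) (chain_hopf.fields
     (cobar_diff (susp K))
     (\<lambda>a. Poly_Mapping.lookup a [])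
     (alg_ext (tensor_galg (cobar_alg (susp K)) (cobar_alg (susp K)))
        (\<lambda>\<sigma>. xi (susp K) (frag_of \<sigma>))))"


section \<open>The comparison map\<close>

definition alpha :: "'a pointed_sset \<Rightarrow> ('a cell \<Rightarrow>\<^sub>0 int) \<Rightarrow> (nat \<times> 'a) option cell list \<Rightarrow>\<^sub>0 int" where
  "alpha K = frag_extend (\<lambda>(n, x).
     if (n, x) = (0, basept K) then frag_of []
     else if n = 0 then frag_of [(1, susp_pt K 0 1 x)] + frag_of []
     else frag_of [(Suc n, susp_pt K n 1 x)])"

definition alpha_hat ::
  "'a pointed_sset \<Rightarrow> ('a cell list \<Rightarrow>\<^sub>0 int) \<Rightarrow> (nat \<times> 'a) option cell list \<Rightarrow>\<^sub>0 int" where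
  "alpha_hat K = alg_ext (cobar_alg (susp K)) (\<lambda>\<sigma>. alpha K (red_incl K \<sigma>))"

end

theory Submission
  imports Defs
begin

text \<open>
  The simplicial suspension is so degenerate that nearly all of the cobar construction collapses.
  The nondegenerate simplices of \<open>EK\<close> other than \<open>b\<^sub>0\<close> are the pairs \<open>(1, x)\<close> with \<open>x\<close> nondegenerate and
  \<open>x \<noteq> k\<^sub>0\<close>. Hence \<open>\<Omega> C(EK)\<close> is the tensor algebra on the same labels as
  the reduced chains of \<open>K\<close>, in the same degrees, and the algebra map induced by \<open>\<alpha>\<close> is the
  renaming \<open>x \<mapsto> (1, x)\<close> of generators. As \<open>\<partial>\<^sub>0 (1, x)\<close> is a \<open>b\<^sub>n\<close>, every \<open>(1, x)\<close> is primitive, so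
  the quadratic part of the cobar differential vanishes, and the sign in \<open>\<partial>\<^sub>i\<^sub>+\<^sub>1 (1, x) = (1, \<partial>\<^sub>i x)\<close>
  cancels against that of \<open>- s\<^sup>-\<^sup>1 d s\<close>; this settles the differentials. What remains is the diagonal.

  Let \<open>x\<close> have dimension \<open>n\<close>. On \<open>\<Lambda> (1, x)\<close> the map \<open>F\<^sub>1\<close> yields the two primitive terms. For the
  others, unroll \<open>\<phi>\<close> once. The summands that come from \<open>\<phi>\<^sub>n\<close> by derivation act on the second
  entries of \<open>(1, x)\<close> only and give pairs \<open>((1, a), (1, b))\<close>, which are primitive again and so
  contribute nothing. In a summand of \<open>(\<nabla> f)' s\<^sub>0\<close> with \<open>n = p + q\<close>,
  the right component is still some \<open>(1, b)\<close>, which \<open>\<partial>\<^sub>0\<close> annihilates, while the left one is obtained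
  from \<open>(2, u)\<close>, where \<open>u\<close> is the front \<open>p\<close>-face of \<open>x\<close>, by the degeneracies indexed by \<open>\<nu>\<close>. A cut of such
  a simplex survives only if all these degeneracies go into the suspension coordinate, that is
  \<open>\<nu> = {0, \<dots>, q - 1}\<close>, and only at position \<open>q + 1\<close>, where it reads
  \<open>(b, (1, \<partial>\<^sub>0^p x)) \<otimes> ((1, u), b)\<close>. Every word of \<open>\<phi>\<close> begins with a degeneracy, so \<open>\<phi>\<close>, and with
  it \<open>F\<^sub>k\<close> for \<open>k \<ge> 2\<close>, vanishes on pairs with a component \<open>b\<close>. Therefore \<open>F\<^sub>k \<Lambda> (1, x) = 0\<close> for
  \<open>k \<ge> 3\<close>, and \<open>F\<^sub>2\<close> contributes \<open>[(1, u)] \<otimes> [(1, \<partial>\<^sub>0^p x)]\<close> for each \<open>p \<le> n\<close>, with the sign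
  \<open>-(-1)^((p+1)q) (-1)^(q+1) (-1)^(pq) = 1\<close>, whose last three factors stem from the shuffle, from passing
  the degree \<open>-1\<close> map \<open>F\<^sub>1\<close> across a \<open>(q+1)\<close>-simplex, and from interchanging the two words
  (\<open>szF_step_phi_diagonal\<close>, \<open>xi_susp_cell\<close>). These are the terms of \<open>\<Delta>\<^sub>K\<close>; the primitive terms
  account for the summands 1 in the images of the vertices \<open>y = (y - k\<^sub>0) + k\<^sub>0\<close> (\<open>chains_gen_diag_expand\<close>).

  The chain Hopf algebra axioms are checked on the side of \<open>K\<close>. Each is an identity between algebra maps
  or between derivations, so it suffices to verify it on generators
  (\<open>chain_hopf_algebra_word_hopf\<close>). There it is inherited from the chain coalgebra of \<open>K\<close>, because the
  map from \<open>C(K)\<close> that sends \<open>k\<^sub>0\<close> to 1 commutes with differentials and coproducts and hits all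
  generators (\<open>chains_word_hopf_data\<close>). The renaming of generators then transports everything to
  \<open>\<Omega> C(EK)\<close> (\<open>chain_hopf_iso_relabel\<close>).
\<close>

section \<open>Linear maps between free modules\<close>

text \<open>
  Multilinear identities are reduced to basis elements by \<open>frag_induct\<close>; the rules \<open>lin\<close> push the
  operations through differences, which closes the remaining induction step.
\<close>
named_theorems lin

lemma frag_extend_lin [lin]:
  "frag_extend f (a - b) = frag_extend f a - frag_extend f b"
  "frag_extend f (a + b) = frag_extend f a + frag_extend f b"
  "frag_extend f (- a) = - frag_extend f a"
  "frag_extend f (frag_cmul k a) = frag_cmul k (frag_extend f a)"
  "frag_extend f (sum h I) = (\<Sum>i\<in>I. frag_extend f (h i))"
proof -
  show "frag_extend f (sum h I) = (\<Sum>i\<in>I. frag_extend f (h i))"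
    by (cases "finite I") (simp_all add: frag_extend_sum o_def)
qed (simp_all add: frag_extend_diff frag_extend_add frag_extend_minus frag_extend_cmul)

lemma frag_cmul_lin [lin]:
  "frag_cmul k (a - b) = frag_cmul k a - frag_cmul k b"
  "frag_cmul k (a + b) = frag_cmul k a + frag_cmul k b"
  "frag_cmul k (- a) = - frag_cmul k a"
  "frag_cmul k (sum h I) = (\<Sum>i\<in>I. frag_cmul k (h i))"
  by (simp_all add: frag_cmul_distrib2 frag_cmul_sum poly_mapping_eq_iff fun_eq_iff algebra_simps lookup_minus)

lemma lin_sum:
  assumes "\<And>a b. F (a + b) = F a + F b" "F 0 = (0::'c::comm_monoid_add)"
  shows "F (sum h I) = (\<Sum>i\<in>I. F (h i))"
  by (induction I rule: infinite_finite_induct) (simp_all add: assms)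

lemma frag_induct [case_names zero of diff]:
  assumes "P 0" "\<And>x. P (frag_of x)" "\<And>a b. P a \<Longrightarrow> P b \<Longrightarrow> P (a - b)"
  shows "P a"
  using frag_induction[of a UNIV P] assms by blast

lemma frag_extend_fun_lin:
  "frag_extend (\<lambda>x. f x - g x) a = frag_extend f a - frag_extend g a"
  "frag_extend (\<lambda>x. f x + g x) a = frag_extend f a + frag_extend g a"
  "frag_extend (\<lambda>x. - f x) a = - frag_extend f a"
  "frag_extend (\<lambda>x. frag_cmul k (f x)) a = frag_cmul k (frag_extend f a)"
  "frag_extend (\<lambda>x. 0) a = 0"
  by (induction a rule: frag_induct; simp add: lin)+

lemma bilin_lin [lin]:
  "bilin f (a - b) c = bilin f a c - bilin f b c"
  "bilin f (a + b) c = bilin f a c + bilin f b c"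
  "bilin f (- a) c = - bilin f a c"
  "bilin f (frag_cmul k a) c = frag_cmul k (bilin f a c)"
  "bilin f (sum h I) c = (\<Sum>i\<in>I. bilin f (h i) c)"
  "bilin f x (d - e) = bilin f x d - bilin f x e"
  "bilin f x (d + e) = bilin f x d + bilin f x e"
  "bilin f x (- d) = - bilin f x d"
  "bilin f x (frag_cmul k d) = frag_cmul k (bilin f x d)"
  "bilin f x (sum h2 I) = (\<Sum>i\<in>I. bilin f x (h2 i))"
proof -
  show "bilin f x (sum h2 I) = (\<Sum>i\<in>I. bilin f x (h2 i))"
    by (rule lin_sum) (simp_all add: bilin_def lin frag_extend_fun_lin)
qed (simp_all add: bilin_def lin frag_extend_fun_lin)

lemma bilin_basis [simp]:
  "bilin f (frag_of x) (frag_of y) = f x y" "bilin f 0 b = 0" "bilin f a 0 = 0"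
  by (simp_all add: bilin_def frag_extend_fun_lin)

lemmas tens_lin [lin] = bilin_lin[of "\<lambda>x y. frag_of (x, y)", folded tens_def]
lemmas tens_basis [simp] = bilin_basis[of "\<lambda>x y. frag_of (x, y)", folded tens_def]

text \<open>
  Over the integers compatibility with differences already gives linearity.
\<close>
definition linear_map :: "(('a \<Rightarrow>\<^sub>0 int) \<Rightarrow> 'b \<Rightarrow>\<^sub>0 int) \<Rightarrow> bool" where
  "linear_map f \<longleftrightarrow> (\<forall>a b. f (a - b) = f a - f b)"

lemma linear_map_diff: "linear_map f \<Longrightarrow> f (a - b) = f a - f b"
  by (simp add: linear_map_def)

lemma linear_map_0: "linear_map f \<Longrightarrow> f 0 = 0"
  using linear_map_diff[of f 0 0] by simp

lemma linear_map_minus: "linear_map f \<Longrightarrow> f (- a) = - f a"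
  using linear_map_diff[of f 0 a] linear_map_0[of f] by simp

lemma linear_map_add: "linear_map f \<Longrightarrow> f (a + b) = f a + f b"
  using linear_map_diff[of f a "- b"] linear_map_minus[of f b] by simp

lemma linear_map_extend: "linear_map f \<Longrightarrow> f a = frag_extend (\<lambda>x. f (frag_of x)) a"
  by (induction a rule: frag_induct) (simp_all add: linear_map_0[of f] linear_map_diff[of f] frag_extend_diff)

lemma linear_map_cmul: "linear_map f \<Longrightarrow> f (frag_cmul k a) = frag_cmul k (f a)"
  using linear_map_extend[of f "frag_cmul k a"] linear_map_extend[of f a] by (simp add: frag_extend_cmul)

lemma linear_map_sum: "linear_map f \<Longrightarrow> f (sum h I) = (\<Sum>i\<in>I. f (h i))"
  by (rule lin_sum) (simp_all add: linear_map_0[of f] linear_map_add[of f])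

lemmas linear_map_simps = linear_map_0 linear_map_diff linear_map_minus linear_map_add
  linear_map_cmul linear_map_sum

lemma linear_mapI [intro]: "(\<And>a b. f (a - b) = f a - f b) \<Longrightarrow> linear_map f"
  by (simp add: linear_map_def)

lemma linear_map_frag_extend [intro]: "linear_map (frag_extend f)"
  by (auto simp: lin)

lemma linear_tensor_map: "linear_map (tensor_map deg q f g)"
  unfolding tensor_map_def by (rule linear_map_frag_extend)

lemmas tensor_map_lin [lin] = linear_map_simps[OF linear_tensor_map]

lemma tensor_map_basis [simp]:
  "tensor_map deg q f g (frag_of (x, y)) =
     frag_cmul (ksign (q * deg x)) (tens (f (frag_of x)) (g (frag_of y)))"
  "tensor_map deg q f g 0 = 0"
  by (simp_all add: tensor_map_def)

lemma linear_alg_ext: "linear_map (alg_ext R g)"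
  unfolding alg_ext_def by (rule linear_map_frag_extend)

lemmas alg_ext_lin [lin] = linear_map_simps[OF linear_alg_ext]

lemma alg_ext_basis [simp]:
  "alg_ext R g (frag_of w) = foldr (\<lambda>b c. g b \<otimes>\<^bsub>R\<^esub> c) w \<one>\<^bsub>R\<^esub>" "alg_ext R g 0 = 0"
  by (simp_all add: alg_ext_def)

lemma linear_der_ext: "linear_map (der_ext deg g)"
  unfolding der_ext_def by (rule linear_map_frag_extend)

lemmas der_ext_lin [lin] = linear_map_simps[OF linear_der_ext]

lemma der_ext_basis [simp]:
  "der_ext deg g (frag_of w) = der_word deg g w" "der_ext deg g 0 = 0"
  by (simp_all add: der_ext_def)

lemma ksign_simps [simp]:
  "ksign 0 = 1" "ksign 1 = - 1" "ksign (- n) = ksign n" "ksign n * ksign n = 1"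
  by (simp_all add: ksign_def)

lemma ksign_add: "ksign (m + n) = ksign m * ksign n"
  by (simp add: ksign_def)

lemma ksign_diff: "ksign (m - n) = ksign m * ksign n"
  by (simp add: ksign_def)

abbreviation supp :: "('a \<Rightarrow>\<^sub>0 int) \<Rightarrow> 'a set" where
  "supp \<equiv> Poly_Mapping.keys"

definition homogeneous :: "('a \<Rightarrow> int) \<Rightarrow> int \<Rightarrow> ('a \<Rightarrow>\<^sub>0 int) \<Rightarrow> bool" where
  "homogeneous deg n a \<longleftrightarrow> supp a \<subseteq> {w. deg w = n}"

lemma homogeneous_simps [simp]:
  "homogeneous deg n 0" "homogeneous deg n (frag_of x) \<longleftrightarrow> deg x = n"
  by (simp_all add: homogeneous_def)

lemma homogeneous_lin:
  "homogeneous deg n a \<Longrightarrow> homogeneous deg n b \<Longrightarrow> homogeneous deg n (a - b)"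
  "homogeneous deg n a \<Longrightarrow> homogeneous deg n b \<Longrightarrow> homogeneous deg n (a + b)"
  "homogeneous deg n a \<Longrightarrow> homogeneous deg n (- a)"
  "homogeneous deg n a \<Longrightarrow> homogeneous deg n (frag_cmul k a)"
  using keys_diff[of a b] keys_add[of a b] keys_cmul[of k a]
  by (auto simp: homogeneous_def)

lemma homogeneous_sum:
  "(\<And>i. i \<in> I \<Longrightarrow> homogeneous deg n (h i)) \<Longrightarrow> homogeneous deg n (sum h I)"
  by (induction I rule: infinite_finite_induct) (simp_all add: homogeneous_lin)

lemma homogeneous_induct [consumes 1, case_names zero of diff]:
  assumes "homogeneous deg n a" "P 0" "\<And>x. deg x = n \<Longrightarrow> P (frag_of x)"
    "\<And>a b. P a \<Longrightarrow> P b \<Longrightarrow> P (a - b)"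
  shows "P a"
  using frag_induction[of a "{w. deg w = n}" P] assms by (auto simp: homogeneous_def)

lemma homogeneous_frag_extend:
  assumes "homogeneous deg n a" "\<And>x. deg x = n \<Longrightarrow> homogeneous deg' m (f x)"
  shows "homogeneous deg' m (frag_extend f a)"
  using assms(1) by (induction rule: homogeneous_induct) (simp_all add: lin homogeneous_lin assms)

lemma homogeneous_bilin:
  assumes "homogeneous deg n a" "homogeneous deg' m b"
    "\<And>x y. deg x = n \<Longrightarrow> deg' y = m \<Longrightarrow> homogeneous deg'' k (f x y)"
  shows "homogeneous deg'' k (bilin f a b)"
  unfolding bilin_def by (intro homogeneous_frag_extend[OF assms(1)] homogeneous_frag_extend[OF assms(2)] assms)

lemma homogeneous_tens:
  assumes "homogeneous deg n a" "homogeneous deg' m b"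
  shows "homogeneous (\<lambda>(u, v). deg u + deg' v) (n + m) (tens a b)"
  unfolding tens_def by (rule homogeneous_bilin[OF assms]) simp

lemma keys_frag_extend_subset:
  "supp a \<subseteq> S \<Longrightarrow> (\<And>x. x \<in> S \<Longrightarrow> supp (f x) \<subseteq> T) \<Longrightarrow> supp (frag_extend f a) \<subseteq> T"
  using keys_frag_extend[of f a] by blast

lemma keys_bilin_subset:
  "supp a \<subseteq> S \<Longrightarrow> supp b \<subseteq> T \<Longrightarrow> (\<And>x y. x \<in> S \<Longrightarrow> y \<in> T \<Longrightarrow> supp (f x y) \<subseteq> U) \<Longrightarrow>
   supp (bilin f a b) \<subseteq> U"
  unfolding bilin_def by (intro keys_frag_extend_subset)

lemma keys_tens_subset: "supp a \<subseteq> S \<Longrightarrow> supp b \<subseteq> T \<Longrightarrow> supp (tens a b) \<subseteq> S \<times> T"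
  unfolding tens_def by (rule keys_bilin_subset) auto

text \<open>
  The Koszul sign sees only the degree of the first factor, so the second may be inhomogeneous.
\<close>
lemma tensor_map_tens:
  assumes "linear_map f" "linear_map g" "homogeneous deg n a"
  shows "tensor_map deg q f g (tens a b) = frag_cmul (ksign (q * n)) (tens (f a) (g b))"
  using assms(3)
proof (induction rule: homogeneous_induct)
  case (of x)
  then show ?case
    by (induction b rule: frag_induct) (simp_all add: lin linear_map_simps[OF assms(1)] linear_map_simps[OF assms(2)])
qed (simp_all add: lin linear_map_simps[OF assms(1)] linear_map_simps[OF assms(2)])

lemma tensor_map_tens_0:
  assumes "linear_map f" "linear_map g"
  shows "tensor_map deg 0 f g (tens a b) = tens (f a) (g b)"
proof (induction a rule: frag_induct)
  case (of x)
  then show ?case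
    by (induction b rule: frag_induct) (simp_all add: lin linear_map_simps[OF assms(1)] linear_map_simps[OF assms(2)])
qed (simp_all add: lin linear_map_simps[OF assms(1)] linear_map_simps[OF assms(2)])

section \<open>Graded algebras and their tensor products\<close>

text \<open>
  The laws are required of all finitely supported functions, whatever the carrier: the concatenation
  product does not depend on the set of letters. Calculations then need no membership conditions.
\<close>
locale graded_alg =
  fixes A :: "('w, 'm) galg_scheme" (structure)
  assumes mult_diff_left: "(a - b) \<otimes> c = a \<otimes> c - b \<otimes> c"
    and mult_diff_right: "a \<otimes> (b - c) = a \<otimes> b - a \<otimes> c"
    and mult_assoc: "(a \<otimes> b) \<otimes> c = a \<otimes> (b \<otimes> c)"
    and mult_one_left [simp]: "\<one> \<otimes> a = a"
    and mult_one_right [simp]: "a \<otimes> \<one> = a"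
    and homogeneous_one: "homogeneous (hdeg A) 0 \<one>"
    and homogeneous_mult_basis: "homogeneous (hdeg A) (hdeg A u + hdeg A v) (frag_of u \<otimes> frag_of v)"
begin

lemma linear_left: "linear_map (\<lambda>a. a \<otimes> c)"
  by (auto simp: mult_diff_left)

lemma linear_right: "linear_map (\<lambda>c. a \<otimes> c)"
  by (auto simp: mult_diff_right)

lemmas mult_lin = linear_map_simps[OF linear_left] linear_map_simps[OF linear_right]

lemma homogeneous_mult:
  assumes "homogeneous (hdeg A) m a" "homogeneous (hdeg A) n b"
  shows "homogeneous (hdeg A) (m + n) (a \<otimes> b)"
  using assms(1)
proof (induction rule: homogeneous_induct)
  case (of x)
  from assms(2) show ?case
    by (induction rule: homogeneous_induct)
      (use of homogeneous_mult_basis[of x] in \<open>auto simp: mult_lin homogeneous_lin\<close>)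
qed (simp_all add: mult_lin homogeneous_lin)

end

lemma tensor_galg_sel:
  "mult (tensor_galg A B) = bilin (\<lambda>(a, b) (c, d).
         frag_cmul (ksign (hdeg B b * hdeg A c))
           (tens (frag_of a \<otimes>\<^bsub>A\<^esub> frag_of c) (frag_of b \<otimes>\<^bsub>B\<^esub> frag_of d)))"
  "one (tensor_galg A B) = tens \<one>\<^bsub>A\<^esub> \<one>\<^bsub>B\<^esub>"
  "hdeg (tensor_galg A B) = (\<lambda>(u, v). hdeg A u + hdeg B v)"
  "add (tensor_galg A B) = (+)" "zero (tensor_galg A B) = 0"
  "carrier (tensor_galg A B) =
     {c. \<forall>(u, v) \<in> supp c. frag_of u \<in> carrier A \<and> frag_of v \<in> carrier B}"
  by (simp_all add: tensor_galg_def)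

lemma word_galg_sel [simp]:
  "mult (word_galg B deg) = bilin (\<lambda>u v. frag_of (u @ v))"
  "one (word_galg B deg) = frag_of []"
  "hdeg (word_galg B deg) = (\<lambda>w. sum_list (map deg w))"
  "add (word_galg B deg) = (+)" "zero (word_galg B deg) = 0"
  "carrier (word_galg B deg) = {a. supp a \<subseteq> lists B}"
  by (simp_all add: word_galg_def)

text \<open>
  An induction whose basis case is a tensor, in the form in which \<open>tensor_mult_tens\<close> and
  \<open>tensor_map_tens_0\<close> apply.
\<close>
lemma tens_induct [case_names zero tens diff]:
  assumes "P 0" "\<And>u v. P (tens (frag_of u) (frag_of v))" "\<And>a b. P a \<Longrightarrow> P b \<Longrightarrow> P (a - b)"
  shows "P a"
proof (induction a rule: frag_induct)
  case (of x)
  then show ?case using assms(2)[of "fst x" "snd x"] by simp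
qed (use assms in auto)

lemma word_graded_alg: "graded_alg (word_galg B deg)"
proof
  fix a b c :: "'a list \<Rightarrow>\<^sub>0 int"
  show "a \<otimes>\<^bsub>word_galg B deg\<^esub> b \<otimes>\<^bsub>word_galg B deg\<^esub> c = a \<otimes>\<^bsub>word_galg B deg\<^esub> (b \<otimes>\<^bsub>word_galg B deg\<^esub> c)"
  proof (induction a rule: frag_induct)
    case (of x)
    then show ?case
    proof (induction b rule: frag_induct)
      case (of x)
      then show ?case
        by (induction c rule: frag_induct) (simp_all add: lin)
    qed (simp_all add: lin)
  qed (simp_all add: lin)
  show "\<one>\<^bsub>word_galg B deg\<^esub> \<otimes>\<^bsub>word_galg B deg\<^esub> a = a"
    by (induction a rule: frag_induct) (simp_all add: lin)
  show "a \<otimes>\<^bsub>word_galg B deg\<^esub> \<one>\<^bsub>word_galg B deg\<^esub> = a"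
    by (induction a rule: frag_induct) (simp_all add: lin)
qed (simp_all add: lin)

locale graded_alg_pair = A: graded_alg A + B: graded_alg B
  for A :: "('u, 'm) galg_scheme" and B :: "('v, 'n) galg_scheme"
begin

lemma tensor_mult_tens:
  assumes "homogeneous (hdeg B) n b" "homogeneous (hdeg A) m c"
  shows "tens a b \<otimes>\<^bsub>tensor_galg A B\<^esub> tens c d =
    frag_cmul (ksign (n * m)) (tens (a \<otimes>\<^bsub>A\<^esub> c) (b \<otimes>\<^bsub>B\<^esub> d))"
proof (induction a rule: frag_induct)
  case (of x)
  from assms(1) show ?case
  proof (induction rule: homogeneous_induct)
    case (of y)
    from assms(2) show ?case
    proof (induction rule: homogeneous_induct)
      case (of z)
      then show ?case using \<open>hdeg B y = n\<close>
        by (induction d rule: frag_induct) (simp_all add: lin tensor_galg_sel B.mult_lin)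
    qed (simp_all add: lin tensor_galg_sel A.mult_lin)
  qed (simp_all add: lin tensor_galg_sel B.mult_lin)
qed (simp_all add: lin tensor_galg_sel A.mult_lin)

lemma tensor_mult_basis:
  "frag_of (a, b) \<otimes>\<^bsub>tensor_galg A B\<^esub> frag_of (c, d) =
    frag_cmul (ksign (hdeg B b * hdeg A c))
      (tens (frag_of a \<otimes>\<^bsub>A\<^esub> frag_of c) (frag_of b \<otimes>\<^bsub>B\<^esub> frag_of d))"
  by (simp add: tensor_galg_sel)

text \<open>
  Associativity holds because moving past a product costs the product of the signs; this is where
  the additivity of degrees under multiplication enters.
\<close>
lemma graded_alg_tensor: "graded_alg (tensor_galg A B)"
proof
  fix a b c :: "'u \<times> 'v \<Rightarrow>\<^sub>0 int"
  let ?T = "tensor_galg A B"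
  show "(a - b) \<otimes>\<^bsub>?T\<^esub> c = a \<otimes>\<^bsub>?T\<^esub> c - b \<otimes>\<^bsub>?T\<^esub> c" "a \<otimes>\<^bsub>?T\<^esub> (b - c) = a \<otimes>\<^bsub>?T\<^esub> b - a \<otimes>\<^bsub>?T\<^esub> c"
    by (simp_all add: tensor_galg_sel lin)
  show "a \<otimes>\<^bsub>?T\<^esub> b \<otimes>\<^bsub>?T\<^esub> c = a \<otimes>\<^bsub>?T\<^esub> (b \<otimes>\<^bsub>?T\<^esub> c)"
  proof (induction a rule: frag_induct)
    case (of x)
    show ?case
    proof (induction b rule: frag_induct)
      case (of y)
      show ?case
      proof (induction c rule: frag_induct)
        case (of z)
        obtain x1 x2 y1 y2 z1 z2 where xyz: "x = (x1, x2)" "y = (y1, y2)" "z = (z1, z2)"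
          by (cases x, cases y, cases z) auto
        have "tens (frag_of x1 \<otimes>\<^bsub>A\<^esub> frag_of y1) (frag_of x2 \<otimes>\<^bsub>B\<^esub> frag_of y2) \<otimes>\<^bsub>?T\<^esub> tens (frag_of z1) (frag_of z2)
          = frag_cmul (ksign ((hdeg B x2 + hdeg B y2) * hdeg A z1))
           (tens (frag_of x1 \<otimes>\<^bsub>A\<^esub> frag_of y1 \<otimes>\<^bsub>A\<^esub> frag_of z1) (frag_of x2 \<otimes>\<^bsub>B\<^esub> frag_of y2 \<otimes>\<^bsub>B\<^esub> frag_of z2))"
          by (intro tensor_mult_tens B.homogeneous_mult) simp_all
        moreover have "tens (frag_of x1) (frag_of x2) \<otimes>\<^bsub>?T\<^esub> tens (frag_of y1 \<otimes>\<^bsub>A\<^esub> frag_of z1) (frag_of y2 \<otimes>\<^bsub>B\<^esub> frag_of z2)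
          = frag_cmul (ksign (hdeg B x2 * (hdeg A y1 + hdeg A z1)))
           (tens (frag_of x1 \<otimes>\<^bsub>A\<^esub> (frag_of y1 \<otimes>\<^bsub>A\<^esub> frag_of z1)) (frag_of x2 \<otimes>\<^bsub>B\<^esub> (frag_of y2 \<otimes>\<^bsub>B\<^esub> frag_of z2)))"
          by (intro tensor_mult_tens A.homogeneous_mult) simp_all
        moreover have "(frag_cmul k p) \<otimes>\<^bsub>?T\<^esub> q = frag_cmul k (p \<otimes>\<^bsub>?T\<^esub> q)"
          "p \<otimes>\<^bsub>?T\<^esub> (frag_cmul k q) = frag_cmul k (p \<otimes>\<^bsub>?T\<^esub> q)" for k p q
          by (simp_all add: tensor_galg_sel lin)
        ultimately show ?case
          by (simp add: xyz tensor_mult_basis A.mult_assoc B.mult_assoc)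
            (simp add: ring_distribs ksign_add mult_ac)
      qed (simp_all add: tensor_galg_sel lin)
    qed (simp_all add: tensor_galg_sel lin)
  qed (simp_all add: tensor_galg_sel lin)
  show "\<one>\<^bsub>?T\<^esub> \<otimes>\<^bsub>?T\<^esub> a = a"
  proof (induction a rule: tens_induct)
    case (tens u v)
    show ?case
      using tensor_mult_tens[OF B.homogeneous_one, where a = "\<one>\<^bsub>A\<^esub>" and c = "frag_of u" and d = "frag_of v"]
      by (simp add: tensor_galg_sel(2))
  qed (simp_all add: tensor_galg_sel lin)
  show "a \<otimes>\<^bsub>?T\<^esub> \<one>\<^bsub>?T\<^esub> = a"
  proof (induction a rule: tens_induct)
    case (tens u v)
    show ?case
      using tensor_mult_tens[OF _ A.homogeneous_one, where a = "frag_of u" and b = "frag_of v" and d = "\<one>\<^bsub>B\<^esub>"]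
      by (simp add: tensor_galg_sel(2))
  qed (simp_all add: tensor_galg_sel lin)
next
  show "homogeneous (hdeg (tensor_galg A B)) 0 \<one>\<^bsub>tensor_galg A B\<^esub>"
    using homogeneous_tens[OF A.homogeneous_one B.homogeneous_one] by (simp add: tensor_galg_sel)
next
  fix x y :: "'u \<times> 'v"
  obtain x1 x2 y1 y2 where xy: "x = (x1, x2)" "y = (y1, y2)"
    by (cases x, cases y) auto
  show "homogeneous (hdeg (tensor_galg A B)) (hdeg (tensor_galg A B) x + hdeg (tensor_galg A B) y)
     (frag_of x \<otimes>\<^bsub>tensor_galg A B\<^esub> frag_of y)"
    using homogeneous_tens[OF A.homogeneous_mult_basis B.homogeneous_mult_basis, of x1 y1 x2 y2]
    by (simp add: xy tensor_galg_sel homogeneous_lin add_ac)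
qed

end

text \<open>
  Preservation of degrees is part of the notion, since otherwise tensor products of homomorphisms
  would not respect the Koszul signs.
\<close>
locale graded_alg_hom = A: graded_alg A + B: graded_alg B
  for A :: "('u, 'm) galg_scheme" and B :: "('v, 'n) galg_scheme" and f +
  assumes linear: "linear_map f"
    and hom_mult: "f (a \<otimes>\<^bsub>A\<^esub> b) = f a \<otimes>\<^bsub>B\<^esub> f b"
    and hom_one: "f \<one>\<^bsub>A\<^esub> = \<one>\<^bsub>B\<^esub>"
    and hom_degree: "homogeneous (hdeg B) (hdeg A u) (f (frag_of u))"
begin
lemmas hom_lin = linear_map_simps[OF linear]
lemma hom_homogeneous: "homogeneous (hdeg A) n a \<Longrightarrow> homogeneous (hdeg B) n (f a)"
  by (induction rule: homogeneous_induct) (use hom_degree in \<open>auto simp: hom_lin homogeneous_lin\<close>)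
end

lemma graded_alg_hom_comp:
  assumes "graded_alg_hom A B f" "graded_alg_hom B C g"
  shows "graded_alg_hom A C (\<lambda>a. g (f a))"
proof -
  interpret f: graded_alg_hom A B f by fact
  interpret g: graded_alg_hom B C g by fact
  show ?thesis
    by unfold_locales (auto simp: f.hom_lin g.hom_lin f.hom_mult g.hom_mult f.hom_one g.hom_one
        f.hom_degree intro: g.hom_homogeneous)
qed

lemma graded_alg_hom_id: "graded_alg A \<Longrightarrow> graded_alg_hom A A id"
proof -
  assume "graded_alg A"
  then interpret graded_alg A .
  show ?thesis by unfold_locales auto
qed

lemma graded_alg_hom_tensor:
  fixes A :: "('a, 'm) galg_scheme" and B :: "('b, 'n) galg_scheme"
  assumes "graded_alg_hom A A' f" "graded_alg_hom B B' g" "hdeg A = deg"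
  shows "graded_alg_hom (tensor_galg A B) (tensor_galg A' B') (tensor_map deg 0 f g)"
proof -
  interpret f: graded_alg_hom A A' f by fact
  interpret g: graded_alg_hom B B' g by fact
  interpret AB: graded_alg_pair A B by unfold_locales
  interpret AB': graded_alg_pair A' B' by unfold_locales
  interpret T: graded_alg "tensor_galg A B" by (rule AB.graded_alg_tensor)
  interpret T': graded_alg "tensor_galg A' B'" by (rule AB'.graded_alg_tensor)
  note tens = tensor_map_tens_0[OF f.linear g.linear]
  show ?thesis
  proof
    fix a b
    show "tensor_map deg 0 f g (a \<otimes>\<^bsub>tensor_galg A B\<^esub> b) =
      tensor_map deg 0 f g a \<otimes>\<^bsub>tensor_galg A' B'\<^esub> tensor_map deg 0 f g b"
    proof (induction a rule: frag_induct)
      case (of x)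
      show ?case
      proof (induction b rule: frag_induct)
        case (of y)
        obtain x1 x2 y1 y2 where xy: "x = (x1, x2)" "y = (y1, y2)"
          by (cases x, cases y) auto
        show ?case
          using AB'.tensor_mult_tens[OF g.hom_degree f.hom_degree, where a = "f (frag_of x1)" and d = "g (frag_of y2)"]
          by (simp add: xy AB.tensor_mult_basis lin tens f.hom_mult g.hom_mult)
      qed (simp_all add: lin T.mult_lin T'.mult_lin)
    qed (simp_all add: lin T.mult_lin T'.mult_lin)
    show "tensor_map deg 0 f g \<one>\<^bsub>tensor_galg A B\<^esub> = \<one>\<^bsub>tensor_galg A' B'\<^esub>"
      by (simp add: tensor_galg_sel tens f.hom_one g.hom_one)
    fix u :: "'a \<times> 'b"
    obtain u1 u2 where "u = (u1, u2)" by (cases u)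
    then show "homogeneous (hdeg (tensor_galg A' B')) (hdeg (tensor_galg A B) u) (tensor_map deg 0 f g (frag_of u))"
      using homogeneous_tens[OF f.hom_degree g.hom_degree, of u1 u2]
      by (simp add: tensor_galg_sel)
  qed (auto simp: lin)
qed

definition reassoc :: "(('u \<times> 'v) \<times> 'w \<Rightarrow>\<^sub>0 int) \<Rightarrow> 'u \<times> 'v \<times> 'w \<Rightarrow>\<^sub>0 int" where
  "reassoc = frag_extend (\<lambda>((u, v), w). frag_of (u, (v, w)))"

lemma reassoc_basis [simp]: "reassoc (frag_of ((u, v), w)) = frag_of (u, (v, w))" "reassoc 0 = 0"
  by (simp_all add: reassoc_def)

lemma linear_reassoc: "linear_map (reassoc)"
  unfolding reassoc_def by (rule linear_map_frag_extend)

lemmas reassoc_lin [lin] = linear_map_simps[OF linear_reassoc]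

lemma reassoc_tens [simp]: "reassoc (tens (tens a b) c) = tens a (tens b c)"
proof (induction a rule: frag_induct)
  case (of x)
  show ?case
  proof (induction b rule: frag_induct)
    case (of x)
    then show ?case
      by (induction c rule: frag_induct) (simp_all add: lin)
  qed (simp_all add: lin)
qed (simp_all add: lin)

text \<open>
  For either bracketing the product of \<open>x\<^sub>1 \<otimes> x\<^sub>2 \<otimes> x\<^sub>3\<close> and \<open>y\<^sub>1 \<otimes> y\<^sub>2 \<otimes> y\<^sub>3\<close> carries the sign of
  \<open>|x\<^sub>2| |y\<^sub>1| + |x\<^sub>3| |y\<^sub>1| + |x\<^sub>3| |y\<^sub>2|\<close>.
\<close>
lemma graded_alg_hom_reassoc:
  assumes "graded_alg A" "graded_alg B" "graded_alg C"
  shows "graded_alg_hom (tensor_galg (tensor_galg A B) C) (tensor_galg A (tensor_galg B C)) reassoc"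
proof -
  interpret A: graded_alg A by fact
  interpret B: graded_alg B by fact
  interpret C: graded_alg C by fact
  interpret AB: graded_alg_pair A B by unfold_locales
  interpret BC: graded_alg_pair B C by unfold_locales
  interpret TAB: graded_alg "tensor_galg A B" by (rule AB.graded_alg_tensor)
  interpret TBC: graded_alg "tensor_galg B C" by (rule BC.graded_alg_tensor)
  interpret L: graded_alg_pair "tensor_galg A B" C by unfold_locales
  interpret R: graded_alg_pair A "tensor_galg B C" by unfold_locales
  interpret TL: graded_alg "tensor_galg (tensor_galg A B) C" by (rule L.graded_alg_tensor)
  interpret TR: graded_alg "tensor_galg A (tensor_galg B C)" by (rule R.graded_alg_tensor)
  show ?thesis
  proof
    fix a b :: "('a \<times> 'c) \<times> 'e \<Rightarrow>\<^sub>0 int"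
    show "reassoc (a \<otimes>\<^bsub>tensor_galg (tensor_galg A B) C\<^esub> b) =
      reassoc a \<otimes>\<^bsub>tensor_galg A (tensor_galg B C)\<^esub> reassoc b"
    proof (induction a rule: frag_induct)
      case (of x)
      show ?case
      proof (induction b rule: frag_induct)
        case (of y)
        obtain x1 x2 x3 y1 y2 y3 where xy: "x = ((x1, x2), x3)" "y = ((y1, y2), y3)"
          by (metis surj_pair)
        show ?case
          by (simp add: xy R.tensor_mult_basis L.tensor_mult_basis AB.tensor_mult_basis BC.tensor_mult_basis lin)
            (simp add: tensor_galg_sel ring_distribs ksign_add mult_ac)
      qed (simp_all add: lin TL.mult_lin TR.mult_lin)
    qed (simp_all add: lin TL.mult_lin TR.mult_lin)
  next
    show "reassoc \<one>\<^bsub>tensor_galg (tensor_galg A B) C\<^esub> = \<one>\<^bsub>tensor_galg A (tensor_galg B C)\<^esub>"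
      by (simp add: tensor_galg_sel)
    fix u :: "('a \<times> 'c) \<times> 'e"
    obtain u1 u2 u3 where "u = ((u1, u2), u3)" by (metis surj_pair)
    then show "homogeneous (hdeg (tensor_galg A (tensor_galg B C))) (hdeg (tensor_galg (tensor_galg A B) C) u)
       (reassoc (frag_of u))"
      by (simp add: tensor_galg_sel)
  qed (auto simp: lin)
qed

section \<open>Chain Hopf structures on tensor algebras\<close>

lemma graded_alg_hom_alg_ext:
  assumes "graded_alg R" "\<And>b. homogeneous (hdeg R) (deg b) (g b)"
  shows "graded_alg_hom (word_galg B deg) R (alg_ext R g)"
proof -
  interpret R: graded_alg R by fact
  interpret W: graded_alg "word_galg B deg" by (rule word_graded_alg)
  have app: "alg_ext R g (frag_of (u @ v)) = alg_ext R g (frag_of u) \<otimes>\<^bsub>R\<^esub> alg_ext R g (frag_of v)" for u v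
    by (induction u) (simp_all add: R.mult_assoc)
  show ?thesis
  proof
    fix a b
    show "alg_ext R g (a \<otimes>\<^bsub>word_galg B deg\<^esub> b) = alg_ext R g a \<otimes>\<^bsub>R\<^esub> alg_ext R g b"
    proof (induction a rule: frag_induct)
      case (of u)
      show ?case
      proof (induction b rule: frag_induct)
        case (of v)
        then show ?case using app[of u v] by simp
      qed (simp_all add: lin R.mult_lin)
    qed (simp_all add: lin R.mult_lin)
    fix u
    show "homogeneous (hdeg R) (hdeg (word_galg B deg) u) (alg_ext R g (frag_of u))"
      by (induction u) (use R.homogeneous_mult assms(2) R.homogeneous_one in auto)
  qed (auto simp: lin)
qed

text \<open>
  The freeness of the tensor algebra, in the form in which all Hopf axioms are reduced to generators.
\<close>
lemma graded_alg_hom_eq_on_words: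
  assumes "graded_alg_hom (word_galg B deg) R f" "graded_alg_hom (word_galg B deg) R f'"
    and gen: "\<And>b. b \<in> B \<Longrightarrow> f (frag_of [b]) = f' (frag_of [b])"
    and "supp a \<subseteq> lists B"
  shows "f a = f' a"
proof -
  interpret f: graded_alg_hom "word_galg B deg" R f by fact
  interpret f': graded_alg_hom "word_galg B deg" R f' by fact
  have word: "f (frag_of w) = f' (frag_of w)" if "w \<in> lists B" for w
    using that
  proof (induction w)
    case Nil
    then show ?case using f.hom_one f'.hom_one by simp
  next
    case (Cons b w)
    then have "b \<in> B" "f (frag_of w) = f' (frag_of w)" by auto
    moreover have "frag_of (b # w) = frag_of [b] \<otimes>\<^bsub>word_galg B deg\<^esub> frag_of w" by simp
    ultimately show ?case by (simp only: f.hom_mult f'.hom_mult gen)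
  qed
  show ?thesis
    using assms(4)
    by (induction rule: frag_induction) (simp_all add: word f.hom_lin f'.hom_lin)
qed

text \<open>
  Both Hopf algebras of the comparison have this form.
\<close>
definition word_hopf :: "'b set \<Rightarrow> ('b \<Rightarrow> int) \<Rightarrow> ('b \<Rightarrow> 'b list \<Rightarrow>\<^sub>0 int)
    \<Rightarrow> ('b \<Rightarrow> 'b list \<times> 'b list \<Rightarrow>\<^sub>0 int) \<Rightarrow> 'b list chain_hopf" where
  "word_hopf B deg g D = galg.extend (word_galg B deg) (chain_hopf.fields
     (der_ext deg g)
     (\<lambda>a. Poly_Mapping.lookup a [])
     (alg_ext (tensor_galg (word_galg B deg) (word_galg B deg)) D))"

lemma word_hopf_sel [simp]:
  "mult (word_hopf B deg g D) = bilin (\<lambda>u v. frag_of (u @ v))"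
  "one (word_hopf B deg g D) = frag_of []"
  "hdeg (word_hopf B deg g D) = (\<lambda>w. sum_list (map deg w))"
  "add (word_hopf B deg g D) = (+)" "zero (word_hopf B deg g D) = 0"
  "carrier (word_hopf B deg g D) = {a. supp a \<subseteq> lists B}"
  "diff (word_hopf B deg g D) = der_ext deg g"
  "aug (word_hopf B deg g D) = (\<lambda>a. Poly_Mapping.lookup a [])"
  "diag (word_hopf B deg g D) = alg_ext (tensor_galg (word_galg B deg) (word_galg B deg)) D"
  "tensor_galg (word_hopf B deg g D) (word_hopf B deg g D) =
     tensor_galg (word_galg B deg) (word_galg B deg)"
  by (simp_all add: word_hopf_def galg.defs chain_hopf.defs word_galg_def tensor_galg_def)

text \<open>
  The degree condition is imposed on every label, not only on those that generate the carrier, so that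
  the differential is homogeneous on the algebra \<open>W\<close> of words in arbitrary labels.
\<close>
locale word_derivation =
  fixes deg :: "'b \<Rightarrow> int" and g :: "'b \<Rightarrow> 'b list \<Rightarrow>\<^sub>0 int"
  assumes g_homogeneous: "homogeneous (\<lambda>w. sum_list (map deg w)) (deg \<sigma> - 1) (g \<sigma>)"
begin

abbreviation W where "W \<equiv> word_galg UNIV deg"
abbreviation wdeg where "wdeg w \<equiv> sum_list (map deg w)"
abbreviation der where "der \<equiv> der_ext deg g"
abbreviation wmul (infixl "\<cdot>" 70) where "wmul \<equiv> bilin (\<lambda>u v. frag_of (u @ v))"

sublocale W: graded_alg W by (rule word_graded_alg)

lemma Leibniz_word: "der_word deg g (u @ v) =
    der_word deg g u \<cdot> frag_of v + frag_cmul (ksign (wdeg u)) (frag_of u \<cdot> der_word deg g v)"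
proof (induction u)
  case Nil
  show ?case using W.mult_one_left[of "der_word deg g v"] by simp
next
  case (Cons b u)
  have "frag_of [b] \<cdot> (frag_of u \<cdot> c) = frag_of (b # u) \<cdot> c" "g b \<cdot> frag_of (u @ v) = g b \<cdot> frag_of u \<cdot> frag_of v"
    "frag_of [b] \<cdot> (c \<cdot> frag_of v) = frag_of [b] \<cdot> c \<cdot> frag_of v" for c
    using W.mult_assoc[of "frag_of [b]" "frag_of u" c] W.mult_assoc[of "g b" "frag_of u" "frag_of v"]
      W.mult_assoc[of "frag_of [b]" c "frag_of v"]
    by simp_all
  then show ?case
    by (simp add: Cons.IH lin ksign_add algebra_simps)
qed

lemma Leibniz:
  assumes "homogeneous wdeg n a"
  shows "der (a \<cdot> b) = der a \<cdot> b + frag_cmul (ksign n) (a \<cdot> der b)"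
  using assms
proof (induction rule: homogeneous_induct)
  case (of u)
  then show ?case
    by (induction b rule: frag_induct) (simp_all add: lin Leibniz_word algebra_simps)
qed (simp_all add: lin algebra_simps)

lemma der_homogeneous:
  assumes "homogeneous wdeg n a"
  shows "homogeneous wdeg (n - 1) (der a)"
  unfolding der_ext_def
proof (rule homogeneous_frag_extend[OF assms])
  fix w assume "wdeg w = n"
  then show "homogeneous wdeg (n - 1) (der_word deg g w)"
  proof (induction w arbitrary: n)
    case (Cons b w)
    have "homogeneous wdeg ((deg b - 1) + wdeg w) (g b \<cdot> frag_of w)"
      using W.homogeneous_mult[of "deg b - 1" "g b" "wdeg w" "frag_of w"] g_homogeneous by simp
    moreover have "homogeneous wdeg (deg b + (wdeg w - 1)) (frag_of [b] \<cdot> der_word deg g w)"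
      using W.homogeneous_mult[of "deg b" "frag_of [b]" "wdeg w - 1"] Cons.IH by simp
    ultimately show ?case
      using Cons.prems by (simp add: homogeneous_lin algebra_simps)
  qed simp
qed

abbreviation T where "T \<equiv> tensor_galg W W"
abbreviation tdiff where "tdiff c \<equiv> tensor_map wdeg 0 der id c + tensor_map wdeg (- 1) id der c"

sublocale WW: graded_alg_pair W W ..
sublocale T: graded_alg T by (rule WW.graded_alg_tensor)

lemma linear_der: "linear_map der" "linear_map id" by (auto simp: lin)

lemma tdiff_tens: "homogeneous wdeg m a \<Longrightarrow>
    tdiff (tens a b) = tens (der a) b + frag_cmul (ksign m) (tens a (der b))"
  using tensor_map_tens_0[OF linear_der, of wdeg a b]
    tensor_map_tens[OF linear_der(2,1), of wdeg m a "- 1" b] by simp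

lemma ksign_cancel: "ksign n * (ksign n * k) = k"
  by (simp add: ksign_def)

text \<open>
  Both sides consist of four terms, one for each tensor factor of \<open>x\<close> and \<open>y\<close> that is
  differentiated; the signs agree because the differential lowers degrees by one.
\<close>
lemma tdiff_Leibniz:
  assumes "homogeneous (hdeg T) n x"
  shows "tdiff (x \<otimes>\<^bsub>T\<^esub> y) = tdiff x \<otimes>\<^bsub>T\<^esub> y + frag_cmul (ksign n) (x \<otimes>\<^bsub>T\<^esub> tdiff y)"
  using assms
proof (induction rule: homogeneous_induct)
  case (of x)
  show ?case
  proof (induction y rule: frag_induct)
    case (of y)
    obtain a b c d where xy: "x = (a, b)" "y = (c, d)" by (cases x, cases y) auto
    have n: "n = wdeg a + wdeg b" using \<open>hdeg T x = n\<close> by (simp add: xy tensor_galg_sel)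
    let ?a = "frag_of a" and ?b = "frag_of b" and ?c = "frag_of c" and ?d = "frag_of d"
    have h: "homogeneous wdeg (wdeg w - 1) (der (frag_of w))" "homogeneous wdeg (wdeg w) (frag_of w)" for w
      by (rule der_homogeneous) simp_all
    have ac: "homogeneous wdeg (wdeg a + wdeg c) (?a \<cdot> ?c)" by simp
    have xymul: "frag_of x \<otimes>\<^bsub>T\<^esub> frag_of y = frag_cmul (ksign (wdeg b * wdeg c)) (tens (?a \<cdot> ?c) (?b \<cdot> ?d))"
      by (simp add: xy WW.tensor_mult_basis)
    have d: "tdiff (frag_of x) = tens (der ?a) ?b + frag_cmul (ksign (wdeg a)) (tens ?a (der ?b))"
      "tdiff (frag_of y) = tens (der ?c) ?d + frag_cmul (ksign (wdeg c)) (tens ?c (der ?d))"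
      using tdiff_tens[OF h(2), of a ?b] tdiff_tens[OF h(2), of c ?d] by (simp_all add: xy)
    have m: "tens (der ?a) ?b \<otimes>\<^bsub>T\<^esub> frag_of y = frag_cmul (ksign (wdeg b * wdeg c)) (tens (der ?a \<cdot> ?c) (?b \<cdot> ?d))"
      "tens ?a (der ?b) \<otimes>\<^bsub>T\<^esub> frag_of y = frag_cmul (ksign ((wdeg b - 1) * wdeg c)) (tens (?a \<cdot> ?c) (der ?b \<cdot> ?d))"
      "frag_of x \<otimes>\<^bsub>T\<^esub> tens (der ?c) ?d = frag_cmul (ksign (wdeg b * (wdeg c - 1))) (tens (?a \<cdot> der ?c) (?b \<cdot> ?d))"
      "frag_of x \<otimes>\<^bsub>T\<^esub> tens ?c (der ?d) = frag_cmul (ksign (wdeg b * wdeg c)) (tens (?a \<cdot> ?c) (?b \<cdot> der ?d))"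
      using WW.tensor_mult_tens[of "wdeg b" ?b "wdeg c" ?c "der ?a" ?d]
        WW.tensor_mult_tens[of "wdeg b - 1" "der ?b" "wdeg c" ?c ?a ?d]
        WW.tensor_mult_tens[of "wdeg b" ?b "wdeg c - 1" "der ?c" ?a ?d]
        WW.tensor_mult_tens[of "wdeg b" ?b "wdeg c" ?c ?a "der ?d"] h
      by (simp_all add: xy)
    have L: "der (?a \<cdot> ?c) = der ?a \<cdot> ?c + frag_cmul (ksign (wdeg a)) (?a \<cdot> der ?c)"
      "der (?b \<cdot> ?d) = der ?b \<cdot> ?d + frag_cmul (ksign (wdeg b)) (?b \<cdot> der ?d)"
      by (rule Leibniz, simp)+
    have lhs: "tdiff (frag_of x \<otimes>\<^bsub>T\<^esub> frag_of y) =
      frag_cmul (ksign (wdeg b * wdeg c)) (tens (der (?a \<cdot> ?c)) (?b \<cdot> ?d)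
       + frag_cmul (ksign (wdeg a + wdeg c)) (tens (?a \<cdot> ?c) (der (?b \<cdot> ?d))))"
      by (simp only: xymul tensor_map_lin(5) frag_cmul_lin(2)[symmetric] tdiff_tens[OF ac])
    show ?case
      unfolding lhs d L n T.mult_lin m tens_lin frag_cmul_lin frag_cmul_cmul
      by (simp only: ring_distribs ksign_add ksign_diff ksign_simps mult_1_right mult_1_left mult_ac ksign_cancel add_ac)
  qed (simp_all add: tensor_map_lin T.mult_lin frag_cmul_lin algebra_simps)
qed (simp_all add: tensor_map_lin T.mult_lin frag_cmul_lin algebra_simps)

end

text \<open>
  The last five conditions are the Hopf axioms for words of length one; \<open>g_supp\<close> excludes the empty
  word, so that the differential maps into the augmentation ideal.
\<close>
locale word_hopf_data = word_derivation deg g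
  for B :: "'b set" and deg :: "'b \<Rightarrow> int" and g +
  fixes D :: "'b \<Rightarrow> 'b list \<times> 'b list \<Rightarrow>\<^sub>0 int"
  assumes D_homogeneous: "homogeneous (\<lambda>(u, v). wdeg u + wdeg v) (deg \<sigma>) (D \<sigma>)"
    and g_supp: "\<sigma> \<in> B \<Longrightarrow> supp (g \<sigma>) \<subseteq> lists B - {[]}"
    and D_supp: "\<sigma> \<in> B \<Longrightarrow> supp (D \<sigma>) \<subseteq> lists B \<times> lists B"
    and der_g: "\<sigma> \<in> B \<Longrightarrow> der (g \<sigma>) = 0"
    and diag_g: "\<sigma> \<in> B \<Longrightarrow> alg_ext T D (g \<sigma>) = tdiff (D \<sigma>)"
    and coassoc_D: "\<sigma> \<in> B \<Longrightarrow>
      reassoc (tensor_map wdeg 0 (alg_ext T D) id (D \<sigma>)) = tensor_map wdeg 0 id (alg_ext T D) (D \<sigma>)"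
    and counit_left_D: "\<sigma> \<in> B \<Longrightarrow>
      frag_extend (\<lambda>(u, v). if u = [] then frag_of v else 0) (D \<sigma>) = frag_of [\<sigma>]"
    and counit_right_D: "\<sigma> \<in> B \<Longrightarrow>
      frag_extend (\<lambda>(u, v). if v = [] then frag_of u else 0) (D \<sigma>) = frag_of [\<sigma>]"
begin

abbreviation H where "H \<equiv> word_hopf B deg g D"
abbreviation \<Delta> where "\<Delta> \<equiv> alg_ext T D"

lemma \<Delta>_eq: "alg_ext (tensor_galg (word_galg B deg) (word_galg B deg)) D = \<Delta>"
  by (simp add: alg_ext_def tensor_galg_sel)

lemma \<Delta>_hom: "graded_alg_hom W T \<Delta>"
  by (rule graded_alg_hom_alg_ext[OF T.graded_alg_axioms]) (simp add: D_homogeneous tensor_galg_sel)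

sublocale \<Delta>: graded_alg_hom W T \<Delta> by (rule \<Delta>_hom)

lemma graded_alg_hom_eq:
  assumes "graded_alg_hom W R f" "graded_alg_hom W R f'"
    and "\<And>b. b \<in> B \<Longrightarrow> f (frag_of [b]) = f' (frag_of [b])" "supp a \<subseteq> lists B"
  shows "f a = f' a"
proof -
  have "graded_alg_hom (word_galg B deg) R h" if h: "graded_alg_hom W R h" for h
  proof -
    interpret h: graded_alg_hom W R h by fact
    interpret W': graded_alg "word_galg B deg" by (rule word_graded_alg)
    show ?thesis
      by unfold_locales (use h.linear h.hom_mult h.hom_one h.hom_degree in simp_all)
  qed
  then show ?thesis using graded_alg_hom_eq_on_words assms by metis
qed

lemma der_supp:
  assumes "supp a \<subseteq> lists B"
  shows "supp (der a) \<subseteq> lists B - {[]}"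
  unfolding der_ext_def
proof (rule keys_frag_extend_subset[OF assms])
  fix w assume "w \<in> lists B"
  then show "supp (der_word deg g w) \<subseteq> lists B - {[]}"
  proof (induction w)
    case (Cons b w)
    have "supp (g b \<cdot> frag_of w) \<subseteq> lists B - {[]}"
      by (rule keys_bilin_subset[OF g_supp[OF Cons.hyps(1)], of _ "{w}"]) (use Cons in auto)
    moreover have "supp (frag_of [b] \<cdot> der_word deg g w) \<subseteq> lists B - {[]}"
      by (rule keys_bilin_subset[OF _ Cons.IH, of _ "{[b]}"]) (use Cons in auto)
    ultimately show ?case
      using keys_add[of "g b \<cdot> frag_of w" "frag_cmul (ksign (deg b)) (frag_of [b] \<cdot> der_word deg g w)"]
        keys_cmul[of "ksign (deg b)" "frag_of [b] \<cdot> der_word deg g w"] by simp blast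
  qed simp
qed

lemma mult_supp:
  "supp a \<subseteq> lists B \<Longrightarrow> supp b \<subseteq> lists B \<Longrightarrow> supp (a \<cdot> b) \<subseteq> lists B"
  by (rule keys_bilin_subset) auto

lemma T_mult_supp:
  assumes "supp x \<subseteq> lists B \<times> lists B" "supp y \<subseteq> lists B \<times> lists B"
  shows "supp (x \<otimes>\<^bsub>T\<^esub> y) \<subseteq> lists B \<times> lists B"
  unfolding tensor_galg_sel(1) by (rule keys_bilin_subset[OF assms]) (auto split: if_splits)

lemma \<Delta>_supp:
  assumes "supp a \<subseteq> lists B"
  shows "supp (\<Delta> a) \<subseteq> lists B \<times> lists B"
  unfolding alg_ext_def
proof (rule keys_frag_extend_subset[OF assms])
  fix w assume "w \<in> lists B"
  then show "supp (foldr (\<lambda>b. (\<otimes>\<^bsub>T\<^esub>) (D b)) w \<one>\<^bsub>T\<^esub>) \<subseteq> lists B \<times> lists B"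
    by (induction w) (simp_all add: tensor_galg_sel(2) D_supp T_mult_supp)
qed

text \<open>
  In the square of the differential of a product the two mixed terms cancel, since differentiating the
  left factor changes the parity of its degree.
\<close>
lemma der_der:
  assumes "supp a \<subseteq> lists B"
  shows "der (der a) = 0"
  using assms
proof (induction rule: frag_induction)
  case (one w)
  then show ?case
  proof (induction w)
    case (Cons b w)
    then have b: "b \<in> B" and IH: "der (der (frag_of w)) = 0" by simp_all
    have gb: "der (frag_of [b]) = g b" using W.mult_one_right by simp
    have "der (frag_of [b] \<cdot> frag_of w) = g b \<cdot> frag_of w + frag_cmul (ksign (deg b)) (frag_of [b] \<cdot> der (frag_of w))"
      using Leibniz[of "deg b" "frag_of [b]" "frag_of w"] unfolding gb by simp
    then have "der (der (frag_of [b] \<cdot> frag_of w)) = 0"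
      using Leibniz[OF g_homogeneous, of b "frag_of w"] Leibniz[of "deg b" "frag_of [b]" "der (frag_of w)"]
      unfolding gb IH der_g[OF b] by (simp add: lin ksign_diff flip: frag_cmul_distrib)
    then show ?case by simp
  qed simp
qed (simp_all add: lin)

text \<open>
  Both sides are derivations along the diagonal.
\<close>
lemma diag_der:
  assumes "supp a \<subseteq> lists B"
  shows "\<Delta> (der a) = tdiff (\<Delta> a)"
  using assms
proof (induction rule: frag_induction)
  case (one w)
  then show ?case
  proof (induction w)
    case Nil
    then show ?case by (simp add: tensor_galg_sel(2))
  next
    case (Cons b w)
    then have b: "b \<in> B" and IH: "\<Delta> (der (frag_of w)) = tdiff (\<Delta> (frag_of w))"
      by (simp_all add: id_def)
    have hD: "homogeneous (hdeg T) (deg b) (D b)" using D_homogeneous by (simp add: tensor_galg_sel)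
    have hm: "\<Delta> (x \<cdot> y) = \<Delta> x \<otimes>\<^bsub>T\<^esub> \<Delta> y" for x y
      using \<Delta>.hom_mult by simp
    have Db: "\<Delta> (frag_of [b]) = D b" by simp
    have gb: "der (frag_of [b]) = g b" using W.mult_one_right by simp
    have "\<Delta> (der (frag_of [b] \<cdot> frag_of w)) = \<Delta> (g b) \<otimes>\<^bsub>T\<^esub> \<Delta> (frag_of w)
        + frag_cmul (ksign (deg b)) (D b \<otimes>\<^bsub>T\<^esub> \<Delta> (der (frag_of w)))"
      using Leibniz[of "deg b" "frag_of [b]" "frag_of w"]
      by (simp only: homogeneous_simps list.map sum_list.Cons sum_list.Nil add_0_right alg_ext_lin hm Db gb simp_thms)
    also have "\<dots> = tdiff (D b \<otimes>\<^bsub>T\<^esub> \<Delta> (frag_of w))"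
      by (simp only: tdiff_Leibniz[OF hD] diag_g[OF b] IH)
    also have "\<dots> = tdiff (\<Delta> (frag_of [b] \<cdot> frag_of w))"
      by (simp only: hm Db)
    finally show ?case by (simp add: id_def)
  qed
qed (simp_all add: lin algebra_simps)

definition counit_l :: "('b list \<times> 'b list \<Rightarrow>\<^sub>0 int) \<Rightarrow> 'b list \<Rightarrow>\<^sub>0 int" where
  "counit_l = frag_extend (\<lambda>(u, v). if u = [] then frag_of v else 0)"

definition counit_r :: "('b list \<times> 'b list \<Rightarrow>\<^sub>0 int) \<Rightarrow> 'b list \<Rightarrow>\<^sub>0 int" where
  "counit_r = frag_extend (\<lambda>(u, v). if v = [] then frag_of u else 0)"

text \<open>
  Multiplicativity is compatible with the Koszul sign, because the counit kills all words except the
  empty one, whose degree is 0.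
\<close>
lemma counit_hom: "graded_alg_hom T W counit_l" "graded_alg_hom T W counit_r"
proof -
  show "graded_alg_hom T W counit_l"
  proof
    fix x y
    show "counit_l (x \<otimes>\<^bsub>T\<^esub> y) = counit_l x \<otimes>\<^bsub>W\<^esub> counit_l y"
    proof (induction x rule: frag_induct)
      case (of x)
      then show ?case
        by (induction y rule: frag_induct)
          (auto simp: tensor_galg_sel counit_l_def lin split: prod.splits)
    qed (simp_all add: lin T.mult_lin counit_l_def)
  qed (auto simp: lin counit_l_def tensor_galg_sel split: prod.splits)
  show "graded_alg_hom T W counit_r"
  proof
    fix x y
    show "counit_r (x \<otimes>\<^bsub>T\<^esub> y) = counit_r x \<otimes>\<^bsub>W\<^esub> counit_r y"
    proof (induction x rule: frag_induct)
      case (of x)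
      then show ?case
        by (induction y rule: frag_induct)
          (auto simp: tensor_galg_sel counit_r_def lin split: prod.splits)
    qed (simp_all add: lin T.mult_lin counit_r_def)
  qed (auto simp: lin counit_r_def tensor_galg_sel split: prod.splits)
qed

lemma counit:
  assumes "supp a \<subseteq> lists B"
  shows "counit_l (\<Delta> a) = a" "counit_r (\<Delta> a) = a"
proof -
  show "counit_l (\<Delta> a) = a"
    using graded_alg_hom_eq[OF graded_alg_hom_comp[OF \<Delta>_hom counit_hom(1)] graded_alg_hom_id[OF W.graded_alg_axioms] _ assms]
      counit_left_D by (simp add: counit_l_def)
  show "counit_r (\<Delta> a) = a"
    using graded_alg_hom_eq[OF graded_alg_hom_comp[OF \<Delta>_hom counit_hom(2)] graded_alg_hom_id[OF W.graded_alg_axioms] _ assms]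
      counit_right_D by (simp add: counit_r_def)
qed

text \<open>
  Both sides are algebra maps into the threefold tensor product.
\<close>
lemma coassociative:
  assumes "supp a \<subseteq> lists B"
  shows "reassoc (tensor_map wdeg 0 \<Delta> id (\<Delta> a)) = tensor_map wdeg 0 id \<Delta> (\<Delta> a)"
proof (rule graded_alg_hom_eq[OF _ _ _ assms])
  have id: "graded_alg_hom W W id" by (rule graded_alg_hom_id[OF W.graded_alg_axioms])
  show "graded_alg_hom W (tensor_galg W T) (\<lambda>a. reassoc (tensor_map wdeg 0 \<Delta> id (\<Delta> a)))"
    by (rule graded_alg_hom_comp[OF graded_alg_hom_comp[OF \<Delta>_hom graded_alg_hom_tensor[OF \<Delta>_hom id]]
          graded_alg_hom_reassoc])
      (simp_all add: W.graded_alg_axioms)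
  show "graded_alg_hom W (tensor_galg W T) (\<lambda>a. tensor_map wdeg 0 id \<Delta> (\<Delta> a))"
    by (rule graded_alg_hom_comp[OF \<Delta>_hom graded_alg_hom_tensor[OF id \<Delta>_hom]]) simp
qed (use coassoc_D in \<open>simp add: id_def\<close>)

lemma homog_iff: "a \<in> homog H n \<longleftrightarrow> supp a \<subseteq> lists B \<and> homogeneous wdeg n a"
  by (auto simp: homog_def homogeneous_def)

lemma T_carrier: "carrier (tensor_galg (word_galg B deg) (word_galg B deg)) = {c. supp c \<subseteq> lists B \<times> lists B}"
  by (auto simp: tensor_galg_sel)

lemma T_homog_iff: "c \<in> homog (tensor_galg (word_galg B deg) (word_galg B deg)) n \<longleftrightarrow>
    supp c \<subseteq> lists B \<times> lists B \<and> homogeneous (hdeg T) n c"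
  unfolding homog_def T_carrier by (auto simp: homogeneous_def tensor_galg_sel)

lemma lookup_mult: "Poly_Mapping.lookup (a \<cdot> b) [] = Poly_Mapping.lookup a [] * Poly_Mapping.lookup b []"
proof (induction a rule: frag_induct)
  case (of u)
  show ?case
    by (induction b rule: frag_induct) (simp_all add: bilin_lin lookup_minus right_diff_distrib)
qed (simp_all add: bilin_lin lookup_minus left_diff_distrib)

lemma ring_H: "ring H"
proof (rule ringI)
  show "abelian_group H"
  proof (rule abelian_groupI)
    fix a b assume "a \<in> carrier H" "b \<in> carrier H"
    then show "a \<oplus>\<^bsub>H\<^esub> b \<in> carrier H" using keys_add[of a b] by auto
  next
    fix a assume "a \<in> carrier H"
    then show "\<exists>b\<in>carrier H. b \<oplus>\<^bsub>H\<^esub> a = \<zero>\<^bsub>H\<^esub>" by (intro bexI[of _ "- a"]) auto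
  qed (simp_all add: algebra_simps)
  show "monoid H"
    by (rule monoidI) (use W.mult_assoc W.mult_one_left W.mult_one_right mult_supp in simp_all)
qed (simp_all add: lin)

theorem chain_hopf_algebra_word_hopf: "chain_hopf_algebra H"
proof -
  have counits: "frag_extend (\<lambda>(u, v). frag_cmul (aug H (frag_of u)) (frag_of v)) = counit_l"
    "frag_extend (\<lambda>(u, v). frag_cmul (aug H (frag_of v)) (frag_of u)) = counit_r"
    unfolding counit_l_def counit_r_def by (rule arg_cong[where f = frag_extend]; auto)+
  show ?thesis
  proof (intro chain_hopf_algebra.intro chain_hopf_algebra_axioms.intro ring_H)
    show "\<exists>B. carrier H = {a. supp a \<subseteq> B}" by (rule exI[of _ "lists B"]) simp
    show "\<one>\<^bsub>H\<^esub> \<in> homog H 0" by (simp add: homog_iff)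
    fix m n a b
    show "a \<in> homog H m \<Longrightarrow> b \<in> homog H n \<Longrightarrow> a \<otimes>\<^bsub>H\<^esub> b \<in> homog H (m + n)"
      using W.homogeneous_mult[of m a n b] by (simp add: homog_iff mult_supp)
    show "a \<in> homog H n \<Longrightarrow> diff H a \<in> homog H (n - 1)"
      using der_supp[of a] der_homogeneous[of n a] by (simp add: homog_iff) blast
    show "a \<in> homog H n \<Longrightarrow> b \<in> carrier H \<Longrightarrow>
      diff H (a \<otimes>\<^bsub>H\<^esub> b) = diff H a \<otimes>\<^bsub>H\<^esub> b + frag_cmul (ksign n) (a \<otimes>\<^bsub>H\<^esub> diff H b)"
      by (simp add: homog_iff Leibniz)
    show "aug H a = 0" if "a \<in> homog H n" "n \<noteq> 0"
    proof -
      have "[] \<notin> supp a" using that by (auto simp: homog_iff homogeneous_def)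
      then show ?thesis by (simp add: in_keys_iff)
    qed
    show "diag H \<in> ring_hom H (tensor_galg H H)"
      unfolding word_hopf_sel(9,10) \<Delta>_eq
    proof (rule ring_hom_memI)
      fix a b assume "a \<in> carrier H" "b \<in> carrier H"
      then show "\<Delta> a \<in> carrier (tensor_galg (word_galg B deg) (word_galg B deg))"
        by (simp add: T_carrier \<Delta>_supp)
      show "\<Delta> (a \<otimes>\<^bsub>H\<^esub> b) = \<Delta> a \<otimes>\<^bsub>tensor_galg (word_galg B deg) (word_galg B deg)\<^esub> \<Delta> b"
        using \<Delta>.hom_mult[of a b] by (simp add: tensor_galg_sel)
      show "\<Delta> (a \<oplus>\<^bsub>H\<^esub> b) = \<Delta> a \<oplus>\<^bsub>tensor_galg (word_galg B deg) (word_galg B deg)\<^esub> \<Delta> b"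
        by (simp add: tensor_galg_sel lin)
    next
      show "\<Delta> \<one>\<^bsub>H\<^esub> = \<one>\<^bsub>tensor_galg (word_galg B deg) (word_galg B deg)\<^esub>"
        by (simp add: tensor_galg_sel)
    qed
    show "a \<in> homog H n \<Longrightarrow> diag H a \<in> homog (tensor_galg H H) n"
      unfolding word_hopf_sel \<Delta>_eq using \<Delta>.hom_homogeneous[of n a] by (simp add: homog_iff T_homog_iff \<Delta>_supp)
    show "a \<in> carrier H \<Longrightarrow> diag H (diff H a) = tensor_diff H (diag H a)"
      unfolding word_hopf_sel \<Delta>_eq tensor_diff_def by (simp add: diag_der)
    show "a \<in> carrier H \<Longrightarrow> frag_extend (\<lambda>((u, v), w). frag_of (u, (v, w)))
        (tensor_map (hdeg H) 0 (diag H) id (diag H a)) = tensor_map (hdeg H) 0 id (diag H) (diag H a)"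
      unfolding word_hopf_sel \<Delta>_eq reassoc_def[symmetric] by (simp add: coassociative)
    show "a \<in> carrier H \<Longrightarrow> frag_extend (\<lambda>(u, v). frag_cmul (aug H (frag_of u)) (frag_of v)) (diag H a) = a"
      "a \<in> carrier H \<Longrightarrow> frag_extend (\<lambda>(u, v). frag_cmul (aug H (frag_of v)) (frag_of u)) (diag H a) = a"
      unfolding counits unfolding word_hopf_sel \<Delta>_eq by (simp_all add: counit)
    show "aug H (diff H a) = 0" if "a \<in> carrier H"
    proof -
      have "[] \<notin> supp (der a)" using der_supp[of a] that by auto
      then show ?thesis by (simp add: in_keys_iff)
    qed
  qed (simp_all add: lin lookup_add lookup_mult der_der)
qed

end

section \<open>Relabelling the generators of a tensor Hopf algebra\<close>

definition relabel :: "('a \<Rightarrow> 'b) \<Rightarrow> ('a \<Rightarrow>\<^sub>0 int) \<Rightarrow> 'b \<Rightarrow>\<^sub>0 int" where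
  "relabel r = frag_extend (\<lambda>x. frag_of (r x))"

lemma linear_relabel: "linear_map (relabel r)"
  unfolding relabel_def by (rule linear_map_frag_extend)

lemmas relabel_lin [lin] = linear_map_simps[OF linear_relabel]

lemma relabel_basis [simp]: "relabel r (frag_of x) = frag_of (r x)" "relabel r 0 = 0"
  by (simp_all add: relabel_def)

lemma relabel_concat: "relabel (map r) (bilin (\<lambda>u v. frag_of (u @ v)) a b) =
    bilin (\<lambda>u v. frag_of (u @ v)) (relabel (map r) a) (relabel (map r) b)"
proof (induction a rule: frag_induct)
  case (of x)
  show ?case by (induction b rule: frag_induct) (simp_all add: lin)
qed (simp_all add: lin)

lemma relabel_tens: "relabel (map_prod r s) (tens a b) = tens (relabel r a) (relabel s b)"
proof (induction a rule: frag_induct)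
  case (of x)
  show ?case by (induction b rule: frag_induct) (simp_all add: lin)
qed (simp_all add: lin)

lemma relabel_reassoc: "reassoc (relabel (map_prod (map_prod r s) t) a) = relabel (map_prod r (map_prod s t)) (reassoc a)"
proof (induction a rule: frag_induct)
  case (of x)
  then show ?case by (cases x; cases "fst x") simp
qed (simp_all add: lin)

lemma relabel_tensor_map:
  assumes "supp z \<subseteq> S \<times> S'" "\<And>u. u \<in> S \<Longrightarrow> deg' (r u) = deg u"
    "\<And>u. u \<in> S \<Longrightarrow> f' (frag_of (r u)) = relabel r' (f (frag_of u))"
    "\<And>u. u \<in> S' \<Longrightarrow> h' (frag_of (s u)) = relabel s' (h (frag_of u))"
  shows "tensor_map deg' q f' h' (relabel (map_prod r s) z) = relabel (map_prod r' s') (tensor_map deg q f h z)"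
  using assms(1)
  by (induction rule: frag_induction) (auto simp: lin relabel_tens assms)

lemma relabel_supp: "supp a \<subseteq> S \<Longrightarrow> supp (relabel r a) \<subseteq> r ` S"
  unfolding relabel_def by (rule keys_frag_extend_subset) auto

lemma relabel_relabel: "relabel r (relabel s a) = relabel (\<lambda>x. r (s x)) a"
  by (induction a rule: frag_induct) (simp_all add: lin)

lemma relabel_ident: "supp a \<subseteq> S \<Longrightarrow> (\<And>x. x \<in> S \<Longrightarrow> r x = x) \<Longrightarrow> relabel r a = a"
  by (induction rule: frag_induction) (simp_all add: lin)

text \<open>
  The structure maps on the target are known only on the image of \<open>r\<close>, where they are carried over
  from \<open>B\<close>; on other labels only their degrees matter.
\<close>
locale hopf_relabelling = word_hopf_data B deg g D + target: word_derivation deg' g'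
  for B :: "'b set" and deg g D and deg' :: "'c \<Rightarrow> int" and g' +
  fixes D' :: "'c \<Rightarrow> 'c list \<times> 'c list \<Rightarrow>\<^sub>0 int" and r :: "'b \<Rightarrow> 'c"
  assumes D'_homogeneous: "homogeneous (\<lambda>(u, v). target.wdeg u + target.wdeg v) (deg' \<tau>) (D' \<tau>)"
    and deg_r: "deg' (r \<sigma>) = deg \<sigma>"
    and g_r: "\<sigma> \<in> B \<Longrightarrow> g' (r \<sigma>) = relabel (map r) (g \<sigma>)"
    and D_r: "\<sigma> \<in> B \<Longrightarrow> D' (r \<sigma>) = relabel (map_prod (map r) (map r)) (D \<sigma>)"
begin

abbreviation \<Delta>' where "\<Delta>' \<equiv> alg_ext target.T D'"
abbreviation \<rho> where "\<rho> \<equiv> relabel (map r)"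
abbreviation \<rho>\<rho> where "\<rho>\<rho> \<equiv> relabel (map_prod (map r) (map r))"

lemma wdeg_r: "target.wdeg (map r w) = wdeg w"
  by (induction w) (simp_all add: deg_r)

lemma der_relabel:
  assumes "supp a \<subseteq> lists B"
  shows "target.der (\<rho> a) = \<rho> (der a)"
  using assms
proof (induction rule: frag_induction)
  case (one w)
  then show ?case
  proof (induction w)
    case (Cons b w)
    then show ?case
      by (simp add: g_r deg_r relabel_lin relabel_concat)
  qed simp
qed (simp_all add: lin)

lemma mult_relabel: "\<rho>\<rho> (x \<otimes>\<^bsub>T\<^esub> y) = \<rho>\<rho> x \<otimes>\<^bsub>target.T\<^esub> \<rho>\<rho> y"
proof (induction x rule: frag_induct)
  case (of x)
  show ?case
  proof (induction y rule: frag_induct)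
    case (of y)
    obtain a b c d where xy: "x = (a, b)" "y = (c, d)" by (cases x, cases y) auto
    show ?case
      by (simp add: xy tensor_galg_sel lin del: map_map) (simp add: wdeg_r flip: map_map)
  qed (simp_all add: lin T.mult_lin target.T.mult_lin)
qed (simp_all add: lin T.mult_lin target.T.mult_lin)

lemma diag_relabel:
  assumes "supp a \<subseteq> lists B"
  shows "\<Delta>' (\<rho> a) = \<rho>\<rho> (\<Delta> a)"
  using assms
proof (induction rule: frag_induction)
  case (one w)
  then show ?case
  proof (induction w)
    case (Cons b w)
    then show ?case by (simp add: mult_relabel D_r)
  qed (simp add: tensor_galg_sel)
qed (simp_all add: lin)

lemma counit_relabel:
  "frag_extend (\<lambda>(u, v). if u = [] then frag_of v else 0) (\<rho>\<rho> z) =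
     \<rho> (frag_extend (\<lambda>(u, v). if u = [] then frag_of v else 0) z)"
  "frag_extend (\<lambda>(u, v). if v = [] then frag_of u else 0) (\<rho>\<rho> z) =
     \<rho> (frag_extend (\<lambda>(u, v). if v = [] then frag_of u else 0) z)"
  by (induction z rule: frag_induct; auto simp: lin)+

lemma relabelled_words: "map r ` lists B = lists (r ` B)"
  by (simp add: lists_image)

text \<open>
  Renaming commutes with the extensions to words, so each condition is the image of the one for \<open>B\<close>.
\<close>
theorem relabelled_word_hopf_data: "word_hopf_data (r ` B) deg' g' D'"
proof
  fix \<tau>
  show "homogeneous (\<lambda>(u, v). target.wdeg u + target.wdeg v) (deg' \<tau>) (D' \<tau>)" by (rule D'_homogeneous)
  assume "\<tau> \<in> r ` B"
  then obtain \<sigma> where \<tau>: "\<tau> = r \<sigma>" and \<sigma>: "\<sigma> \<in> B" by auto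
  note gs = g_supp[OF \<sigma>] and Ds = D_supp[OF \<sigma>]
  have gs': "supp (g \<sigma>) \<subseteq> lists B" using gs by auto
  show "supp (g' \<tau>) \<subseteq> lists (r ` B) - {[]}"
  proof -
    have "map r ` (lists B - {[]}) \<subseteq> lists (r ` B) - {[]}" by auto
    then show ?thesis
      using relabel_supp[OF gs, of "map r"] unfolding \<tau> g_r[OF \<sigma>] by (rule subset_trans[rotated])
  qed
  show "supp (D' \<tau>) \<subseteq> lists (r ` B) \<times> lists (r ` B)"
    using relabel_supp[OF Ds, of "map_prod (map r) (map r)"] unfolding \<tau> D_r[OF \<sigma>] relabelled_words[symmetric] by auto
  show "target.der (g' \<tau>) = 0"
    unfolding \<tau> g_r[OF \<sigma>] der_relabel[OF gs'] der_g[OF \<sigma>] by simp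
  have words: "target.der (frag_of (map r u)) = \<rho> (der (frag_of u))" "\<Delta>' (frag_of (map r u)) = \<rho>\<rho> (\<Delta> (frag_of u))"
    if "u \<in> lists B" for u
    using der_relabel[of "frag_of u"] diag_relabel[of "frag_of u"] that by (simp_all del: der_ext_basis alg_ext_basis)
  have idr: "id (frag_of (map r u)) = \<rho> (id (frag_of u))" for u by simp
  show "\<Delta>' (g' \<tau>) = target.tdiff (D' \<tau>)"
    unfolding \<tau> g_r[OF \<sigma>] D_r[OF \<sigma>] diag_relabel[OF gs'] diag_g[OF \<sigma>] relabel_lin
    by (intro arg_cong2[where f = "(+)"] relabel_tensor_map[symmetric, OF Ds] wdeg_r words idr)
  show "reassoc (tensor_map target.wdeg 0 \<Delta>' id (D' \<tau>)) = tensor_map target.wdeg 0 id \<Delta>' (D' \<tau>)"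
  proof -
    have "tensor_map target.wdeg 0 \<Delta>' id (D' \<tau>) = relabel (map_prod (map_prod (map r) (map r)) (map r)) (tensor_map wdeg 0 \<Delta> id (D \<sigma>))"
      unfolding \<tau> D_r[OF \<sigma>] by (intro relabel_tensor_map[OF Ds] wdeg_r words idr)
    moreover have "tensor_map target.wdeg 0 id \<Delta>' (D' \<tau>) = relabel (map_prod (map r) (map_prod (map r) (map r))) (tensor_map wdeg 0 id \<Delta> (D \<sigma>))"
      unfolding \<tau> D_r[OF \<sigma>] by (intro relabel_tensor_map[OF Ds] wdeg_r words idr)
    ultimately show ?thesis by (simp only: relabel_reassoc coassoc_D[OF \<sigma>])
  qed
  show "frag_extend (\<lambda>(u, v). if u = [] then frag_of v else 0) (D' \<tau>) = frag_of [\<tau>]"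
    "frag_extend (\<lambda>(u, v). if v = [] then frag_of u else 0) (D' \<tau>) = frag_of [\<tau>]"
    unfolding \<tau> D_r[OF \<sigma>] counit_relabel counit_left_D[OF \<sigma>] counit_right_D[OF \<sigma>] by simp_all
qed

theorem chain_hopf_iso_relabel:
  assumes inj: "inj_on r B" and h: "\<And>a. supp a \<subseteq> lists B \<Longrightarrow> h a = \<rho> a"
  shows "chain_hopf_iso (word_hopf B deg g D) (word_hopf (r ` B) deg' g' D') h"
proof -
  interpret R: word_hopf_data "r ` B" deg' g' D' by (rule relabelled_word_hopf_data)
  let ?s = "inv_into B r"
  have closed: "supp (\<rho> a) \<subseteq> lists (r ` B)" if "supp a \<subseteq> lists B" for a
    using relabel_supp[OF that, of "map r"] by (simp add: relabelled_words)
  have closed': "supp (relabel (map ?s) a) \<subseteq> lists B" if "supp a \<subseteq> lists (r ` B)" for a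
  proof -
    have "map ?s w \<in> lists B" if "w \<in> lists (r ` B)" for w
      using that by (auto simp: in_lists_conv_set inv_into_into)
    then show ?thesis using relabel_supp[OF that, of "map ?s"] by blast
  qed
  have sr: "relabel (map ?s) (\<rho> a) = a" if "supp a \<subseteq> lists B" for a
    unfolding relabel_relabel
    by (rule relabel_ident[OF that]) (auto simp: in_lists_conv_set inv_into_f_f[OF inj] intro!: map_idI)
  have rs: "\<rho> (relabel (map ?s) a) = a" if "supp a \<subseteq> lists (r ` B)" for a
    unfolding relabel_relabel
    by (rule relabel_ident[OF that]) (auto simp: in_lists_conv_set f_inv_into_f intro!: map_idI)
  have bij: "bij_betw h (carrier H) (carrier R.H)"
    by (rule bij_betw_byWitness[where f' = "relabel (map ?s)"]) (simp_all add: image_subset_iff h sr rs closed closed')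
  have hom: "h \<in> ring_hom H R.H"
  proof (rule ring_hom_memI)
    fix a b assume "a \<in> carrier H" "b \<in> carrier H"
    then have a: "supp a \<subseteq> lists B" and b: "supp b \<subseteq> lists B" by simp_all
    show "h a \<in> carrier R.H" using a by (simp add: h closed)
    show "h (a \<otimes>\<^bsub>H\<^esub> b) = h a \<otimes>\<^bsub>R.H\<^esub> h b"
      using a b by (simp add: h mult_supp relabel_concat)
    have "supp (a + b) \<subseteq> lists B" using keys_add[of a b] a b by (meson Un_least subset_trans)
    then show "h (a \<oplus>\<^bsub>H\<^esub> b) = h a \<oplus>\<^bsub>R.H\<^esub> h b"
      using a b by (simp add: h relabel_lin)
  qed (simp add: h)
  have lookup: "Poly_Mapping.lookup (\<rho> a) [] = Poly_Mapping.lookup a []" for a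
    by (induction a rule: frag_induct) (auto simp: lin lookup_minus)
  have tensor: "tensor_map wdeg 0 h h z = \<rho>\<rho> z" if "supp z \<subseteq> lists B \<times> lists B" for z
    using that
  proof (induction rule: frag_induction)
    case (one p)
    have "h (frag_of w) = frag_of (map r w)" if "w \<in> lists B" for w
      using h[of "frag_of w"] that by simp
    with one show ?case by (cases p) simp
  qed (simp_all add: lin)
  have homog: "h ` homog H n \<subseteq> homog R.H n" for n
  proof -
    have "homogeneous target.wdeg n (\<rho> a)" if "homogeneous wdeg n a" for a
      unfolding relabel_def using that by (rule homogeneous_frag_extend) (simp add: wdeg_r del: map_map)
    then show ?thesis using closed by (auto simp: homog_iff R.homog_iff h)
  qed
  show ?thesis
    unfolding chain_hopf_iso_def ring_iso_def
    using chain_hopf_algebra_word_hopf R.chain_hopf_algebra_word_hopf bij hom homog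
    by (auto simp: h der_supp[THEN subset_trans] der_relabel[symmetric] lookup \<Delta>_eq R.\<Delta>_eq tensor \<Delta>_supp diag_relabel)
qed

end

section \<open>Front and back faces\<close>

lemma act_Nil [simp]: "act X [] n x = x"
  by (simp add: act_def)

lemma act_snoc: "act X (w @ [l]) n x = act X w (fst (act_letter X l (n, x))) (snd (act_letter X l (n, x)))"
  by (simp add: act_def)

text \<open>
  The faces spanned by the vertices \<open>0, \<dots>, i\<close> and by the vertices \<open>i, \<dots>, n\<close>.
\<close>
definition front_face :: "('a, 'm) sset_scheme \<Rightarrow> nat \<Rightarrow> nat \<Rightarrow> 'a \<Rightarrow> 'a" where
  "front_face X n i x = act X (front_op n i) n x"

definition back_face :: "('a, 'm) sset_scheme \<Rightarrow> nat \<Rightarrow> nat \<Rightarrow> 'a \<Rightarrow> 'a" where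
  "back_face X n i x = act X (back_op i) n x"

lemma front_same [simp]: "front_face X n n x = x"
  by (simp add: front_face_def front_op_def)

lemma front_Suc: "i \<le> n \<Longrightarrow> front_face X (Suc n) i x = front_face X n i (face X (Suc n) (Suc n) x)"
  by (simp add: front_face_def front_op_def act_snoc)

lemma back_0 [simp]: "back_face X n 0 x = x"
  by (simp add: back_face_def back_op_def)

lemma back_Suc: "back_face X (Suc n) (Suc i) x = back_face X n i (face X (Suc n) 0 x)"
proof -
  have "back_op (Suc i) = back_op i @ [Fac 0]"
    by (simp add: back_op_def replicate_append_same)
  then show ?thesis by (simp add: back_face_def act_snoc)
qed

lemma degenerateI: "y \<in> simplices X m \<Longrightarrow> i \<le> m \<Longrightarrow> degenerate X (Suc m) (degen X m i y)"
  unfolding degenerate_def by blast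

lemma not_degenerate_0 [simp]: "\<not> degenerate X 0 x"
  by (simp add: degenerate_def)

lemma nchain_degen: "y \<in> simplices X m \<Longrightarrow> i \<le> m \<Longrightarrow> nchain X (Suc m) (degen X m i y) = 0"
  by (simp add: nchain_def degenerateI)

lemma nchain_0: "nchain X 0 x = frag_of (0, x)"
  by (simp add: nchain_def)

lemma nchain_homogeneous: "homogeneous cdeg (int n) (nchain X n x)"
  by (simp add: nchain_def)

lemma nchain_supp: "x \<in> simplices X n \<Longrightarrow> supp (nchain X n x) \<subseteq> nondeg_cells X"
  by (simp add: nchain_def nondeg_cells_def)

lemma nchain_nondeg: "(n, x) \<in> nondeg_cells X \<Longrightarrow> nchain X n x = frag_of (n, x)"
  by (simp add: nchain_def nondeg_cells_def)

context simplicial_set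
begin

lemma front_closed: "x \<in> simplices X n \<Longrightarrow> i \<le> n \<Longrightarrow> front_face X n i x \<in> simplices X i"
proof (induction n arbitrary: x)
  case (Suc n)
  then show ?case by (cases "i = Suc n") (simp_all add: front_Suc face_closed)
qed simp

lemma back_closed: "x \<in> simplices X n \<Longrightarrow> i \<le> n \<Longrightarrow> back_face X n i x \<in> simplices X (n - i)"
proof (induction n arbitrary: x i)
  case (Suc n)
  then show ?case by (cases i) (simp_all add: back_Suc face_closed)
qed simp

text \<open>
  The following lemmas say what becomes of a front or back face when a vertex of the simplex is
  deleted or repeated: it all depends on whether that vertex belongs to the face. They are proved by
  peeling off the outermost face operator, the last one for front faces and \<open>\<partial>\<^sub>0\<close> for back faces.
\<close>
lemma front_face_greater:
  "x \<in> simplices X (Suc n) \<Longrightarrow> i < j \<Longrightarrow> j \<le> Suc n \<Longrightarrow> front_face X n i (face X (Suc n) j x) = front_face X (Suc n) i x"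
proof (induction n arbitrary: x)
  case (Suc n)
  show ?case
  proof (cases "j = Suc (Suc n)")
    case True
    then show ?thesis using Suc.prems by (simp add: front_Suc)
  next
    case False
    then have "front_face X (Suc n) i (face X (Suc (Suc n)) j x) = front_face X n i (face X (Suc n) j (face X (Suc (Suc n)) (Suc (Suc n)) x))"
      using Suc.prems face_face[of x n j "Suc (Suc n)"] by (simp add: front_Suc)
    then show ?thesis
      using False Suc.prems Suc.IH[of "face X (Suc (Suc n)) (Suc (Suc n)) x"] by (simp add: front_Suc[of i "Suc n"] face_closed)
  qed
next
  case 0
  then have "i = 0" "j = Suc 0" by simp_all
  then show ?case by (simp add: front_Suc)
qed

lemma front_face_le:
  "x \<in> simplices X (Suc n) \<Longrightarrow> j \<le> i \<Longrightarrow> i \<le> n \<Longrightarrow>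
   front_face X n i (face X (Suc n) j x) = face X (Suc i) j (front_face X (Suc n) (Suc i) x)"
proof (induction n arbitrary: x)
  case (Suc n)
  show ?case
  proof (cases "i = Suc n")
    case False
    then have "front_face X (Suc n) i (face X (Suc (Suc n)) j x) = front_face X n i (face X (Suc n) j (face X (Suc (Suc n)) (Suc (Suc n)) x))"
      using Suc.prems face_face[of x n j "Suc (Suc n)"] by (simp add: front_Suc)
    then show ?thesis
      using False Suc.prems Suc.IH[of "face X (Suc (Suc n)) (Suc (Suc n)) x"] by (simp add: front_Suc[of "Suc i" "Suc n"] face_closed)
  qed simp
qed simp

lemma back_face_le:
  "x \<in> simplices X (Suc n) \<Longrightarrow> j \<le> i \<Longrightarrow> i \<le> n \<Longrightarrow> back_face X n i (face X (Suc n) j x) = back_face X (Suc n) (Suc i) x"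
proof (induction n arbitrary: x i j)
  case 0
  then show ?case by (simp add: back_Suc)
next
  case (Suc n)
  show ?case
  proof (cases i)
    case 0
    then show ?thesis using Suc.prems by (simp add: back_Suc)
  next
    case i: (Suc i')
    show ?thesis
    proof (cases j)
      case 0
      then show ?thesis by (simp add: i back_Suc)
    next
      case j: (Suc j')
      then have "face X (Suc n) 0 (face X (Suc (Suc n)) j x) = face X (Suc n) j' (face X (Suc (Suc n)) 0 x)"
        using face_face[of x n 0 j] Suc.prems by simp
      then show ?thesis
        using Suc.IH[of "face X (Suc (Suc n)) 0 x" j' i'] Suc.prems by (simp add: i j back_Suc face_closed)
    qed
  qed
qed

lemma back_face_greater:
  "x \<in> simplices X (Suc n) \<Longrightarrow> i < j \<Longrightarrow> j \<le> Suc n \<Longrightarrow>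
   back_face X n i (face X (Suc n) j x) = face X (Suc n - i) (j - i) (back_face X (Suc n) i x)"
proof (induction n arbitrary: x i j)
  case (Suc n)
  show ?case
  proof (cases i)
    case i: (Suc i')
    have "face X (Suc n) 0 (face X (Suc (Suc n)) j x) = face X (Suc n) (j - 1) (face X (Suc (Suc n)) 0 x)"
      using face_face[of x n 0 j] Suc.prems by simp
    then show ?thesis
      using Suc.IH[of "face X (Suc (Suc n)) 0 x" i' "j - 1"] Suc.prems by (simp add: i back_Suc face_closed)
  qed simp
next
  case 0
  then have "i = 0" "j = Suc 0" by simp_all
  then show ?case by simp
qed

lemma front_degen_ge:
  "x \<in> simplices X n \<Longrightarrow> i \<le> k \<Longrightarrow> k \<le> n \<Longrightarrow> front_face X (Suc n) i (degen X n k x) = front_face X n i x"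
proof (induction n arbitrary: x)
  case 0
  then show ?case by (simp add: front_Suc face_degen_same)
next
  case (Suc n)
  show ?case
  proof (cases "k = Suc n")
    case True
    then show ?thesis using Suc.prems by (simp add: front_Suc[of _ "Suc n"] face_degen_same)
  next
    case False
    then show ?thesis
      using Suc.prems Suc.IH[of "face X (Suc n) (Suc n) x"] face_degen_greater[of x n k "Suc (Suc n)"]
      by (simp add: front_Suc[of i "Suc n"] front_Suc[of i n] face_closed)
  qed
qed

lemma front_degen_less:
  "x \<in> simplices X n \<Longrightarrow> k < i \<Longrightarrow> i \<le> Suc n \<Longrightarrow> front_face X (Suc n) i (degen X n k x) = degen X (i - 1) k (front_face X n (i - 1) x)"
proof (induction n arbitrary: x)
  case 0
  then have "i = Suc 0" by simp
  then show ?case by simp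
next
  case (Suc n)
  show ?case
  proof (cases "i = Suc (Suc n)")
    case False
    obtain i' where "i = Suc i'" using Suc.prems by (cases i) auto
    with False show ?thesis
      using Suc.prems Suc.IH[of "face X (Suc n) (Suc n) x"] face_degen_greater[of x n k "Suc (Suc n)"]
      by (simp add: front_Suc[of "Suc i'" "Suc n"] front_Suc[of i' n] face_closed)
  qed simp
qed

lemma back_degen_ge:
  "x \<in> simplices X n \<Longrightarrow> i \<le> k \<Longrightarrow> k \<le> n \<Longrightarrow> back_face X (Suc n) i (degen X n k x) = degen X (n - i) (k - i) (back_face X n i x)"
proof (induction n arbitrary: x i k)
  case (Suc n)
  show ?case
  proof (cases i)
    case i: (Suc i')
    then show ?thesis
      using face_degen_less[of x n 0 k] Suc.prems Suc.IH[of "face X (Suc n) 0 x" i' "k - 1"]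
      by (simp add: back_Suc face_closed)
  qed simp
qed simp

lemma front_front: "a \<le> i \<Longrightarrow> i \<le> n \<Longrightarrow> front_face X i a (front_face X n i x) = front_face X n a x"
proof (induction n arbitrary: x)
  case (Suc n)
  then show ?case by (cases "i = Suc n") (simp_all add: front_Suc)
qed simp

lemma back_back: "i + b \<le> n \<Longrightarrow> back_face X (n - i) b (back_face X n i x) = back_face X n (i + b) x"
proof (induction n arbitrary: x i)
  case (Suc n)
  then show ?case by (cases i) (simp_all add: back_Suc)
qed simp

lemma back_front:
  "x \<in> simplices X n \<Longrightarrow> a \<le> i \<Longrightarrow> i \<le> n \<Longrightarrow> back_face X i a (front_face X n i x) = front_face X (n - a) (i - a) (back_face X n a x)"
proof (induction n arbitrary: x)
  case (Suc n)
  show ?case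
  proof (cases "i = Suc n")
    case False
    then have "a \<le> n" using Suc.prems by simp
    then show ?thesis
      using False Suc.prems Suc.IH[of "face X (Suc n) (Suc n) x"] back_face_greater[of x n a "Suc n"]
        back_closed[of x "Suc n" a]
      by (simp add: front_Suc[of i n] front_Suc[of "i - a" "n - a"] face_closed Suc_diff_le)
  qed simp
qed simp

lemma face_front: "x \<in> simplices X n \<Longrightarrow> i < n \<Longrightarrow> face X (Suc i) (Suc i) (front_face X n (Suc i) x) = front_face X n i x"
  using front_front[of i "Suc i" n x] by (simp add: front_Suc)

lemma face_back: "i < n \<Longrightarrow> face X (n - i) 0 (back_face X n i x) = back_face X n (Suc i) x"
  using back_back[of i 1 n x] by (cases "n - i") (auto simp: back_Suc)

text \<open>
  The formula for the boundary also holds on degenerate simplices: the two faces of \<open>s\<^sub>k y\<close> that delete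
  a copy of the repeated vertex are both \<open>y\<close> and cancel, the other ones are degenerate.
\<close>
lemma bd_nchain:
  assumes x: "x \<in> simplices X (Suc n)"
  shows "bd X (nchain X (Suc n) x) = (\<Sum>i\<le>Suc n. frag_cmul ((- 1) ^ i) (nchain X n (face X (Suc n) i x)))"
proof (cases "degenerate X (Suc n) x")
  case True
  then obtain k y where y: "k \<le> n" "y \<in> simplices X n" and xy: "x = degen X n k y"
    by (auto simp: degenerate_def)
  have zero: "nchain X n (face X (Suc n) i x) = 0" if i: "i \<le> Suc n" "i \<noteq> k" "i \<noteq> Suc k" for i
  proof -
    obtain m where n: "n = Suc m" using i y(1) by (cases n) (auto simp: le_Suc_eq)
    show ?thesis
    proof (cases "i < k")
      case True
      then show ?thesis
        using y n face_degen_less[of y m i k] by (auto simp: xy intro!: nchain_degen face_closed)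
    next
      case False
      then show ?thesis
        using y n i face_degen_greater[of y m k i] by (auto simp: xy intro!: nchain_degen face_closed)
    qed
  qed
  have "(\<Sum>i\<le>Suc n. frag_cmul ((- 1) ^ i) (nchain X n (face X (Suc n) i x))) =
    (\<Sum>i\<in>{k, Suc k}. frag_cmul ((- 1) ^ i) (nchain X n (face X (Suc n) i x)))"
    using y(1) by (intro sum.mono_neutral_right) (auto simp: zero)
  also have "\<dots> = 0"
    using y by (simp add: xy face_degen_same flip: frag_cmul_distrib)
  finally show ?thesis using True by (simp add: nchain_def bd_def)
qed (simp add: nchain_def bd_def)

text \<open>
  Likewise for the coproduct: a cut of \<open>s\<^sub>k y\<close> at \<open>i \<le> k\<close> leaves the repetition in the back face, any
  other cut leaves it in the front face.
\<close>
lemma coprod_nchain: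
  assumes x: "x \<in> simplices X n"
  shows "coprod X (nchain X n x) = (\<Sum>i\<le>n. tens (nchain X i (front_face X n i x)) (nchain X (n - i) (back_face X n i x)))"
proof (cases "degenerate X n x")
  case True
  then obtain m k y where n: "n = Suc m" and y: "k \<le> m" "y \<in> simplices X m" and xy: "x = degen X m k y"
    by (auto simp: degenerate_def)
  have "tens (nchain X i (front_face X n i x)) (nchain X (n - i) (back_face X n i x)) = 0" if "i \<le> n" for i
  proof (cases "i \<le> k")
    case True
    then show ?thesis
      using y by (simp add: n xy back_degen_ge Suc_diff_le nchain_degen back_closed)
  next
    case False
    then obtain i' where "i = Suc i'" by (cases i) auto
    then show ?thesis
      using y False that by (simp add: n xy front_degen_less nchain_degen front_closed)
  qed
  then have "(\<Sum>i\<le>n. tens (nchain X i (front_face X n i x)) (nchain X (n - i) (back_face X n i x))) = 0"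
    by (intro sum.neutral) simp
  then show ?thesis using True by (simp add: nchain_def coprod_def)
qed (simp add: nchain_def coprod_def front_face_def back_face_def)

end

section \<open>The chain coalgebra of a simplicial set\<close>

lemma linear_bd: "linear_map (bd X)"
  unfolding bd_def by (rule linear_map_frag_extend)

lemmas bd_lin [lin] = linear_map_simps[OF linear_bd]

lemma linear_coprod: "linear_map (coprod X)"
  unfolding coprod_def by (rule linear_map_frag_extend)

lemmas coprod_lin [lin] = linear_map_simps[OF linear_coprod]

lemma linear_id: "linear_map id"
  by auto

lemma bd_coprod_0 [simp]: "bd X 0 = 0" "coprod X 0 = 0" "bd X (frag_of (0, x)) = 0"
  by (simp_all add: bd_def coprod_def)

text \<open>
  The terms with \<open>j < i\<close> and those with \<open>i \<le> j\<close> correspond to each other under \<open>(i, j) \<mapsto> (j, i - 1)\<close>,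
  with opposite signs.
\<close>
lemma alternating_double_sum_zero:
  fixes f :: "nat \<Rightarrow> nat \<Rightarrow> 'c \<Rightarrow>\<^sub>0 int"
  assumes "\<And>i j. j < i \<Longrightarrow> i \<le> Suc n \<Longrightarrow> f i j = f j (i - 1)"
  shows "(\<Sum>i\<le>Suc n. \<Sum>j\<le>n. frag_cmul ((- 1) ^ i * (- 1) ^ j) (f i j)) = 0"
proof -
  let ?g = "\<lambda>(i, j). frag_cmul ((- 1) ^ i * (- 1) ^ j) (f i j)"
  let ?A = "SIGMA i:{..Suc n}. {..<i}" and ?B = "SIGMA i:{..n}. {i..n}"
  have split: "{..Suc n} \<times> {..n} = ?A \<union> ?B" by auto
  have "(\<Sum>i\<le>Suc n. \<Sum>j\<le>n. ?g (i, j)) = sum ?g ({..Suc n} \<times> {..n})"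
    by (simp add: sum.cartesian_product)
  also have "\<dots> = sum ?g ?A + sum ?g ?B"
    unfolding split by (rule sum.union_disjoint) auto
  also have "sum ?g ?A = (\<Sum>p\<in>?B. - ?g p)"
  proof (rule sum.reindex_bij_witness[where i = "\<lambda>(i, j). (Suc j, i)" and j = "\<lambda>(i, j). (j, i - 1)"])
    fix p assume "p \<in> ?A"
    then obtain i j where p: "p = (Suc i, j)" "j \<le> i" "i \<le> n"
      by (cases p; cases "fst p") auto
    show "- ?g (case p of (i, j) \<Rightarrow> (j, i - 1)) = ?g p"
      using assms[of j "Suc i"] p by (simp add: mult.commute)
  qed auto
  also have "\<dots> + sum ?g ?B = 0"
    by (simp add: sum_negf)
  finally show ?thesis by simp
qed

context simplicial_set
begin

lemma bd_bd_nchain: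
  assumes x: "x \<in> simplices X n"
  shows "bd X (bd X (nchain X n x)) = 0"
proof (cases n)
  case 0
  then show ?thesis by (simp add: nchain_0)
next
  case n: (Suc m)
  show ?thesis
  proof (cases m)
    case 0
    then show ?thesis
      using x by (simp add: n bd_nchain lin nchain_0)
  next
    case m: (Suc k)
    have "bd X (bd X (nchain X n x)) = (\<Sum>i\<le>Suc (Suc k). \<Sum>j\<le>Suc k.
        frag_cmul ((- 1) ^ i * (- 1) ^ j) (nchain X k (face X (Suc k) j (face X (Suc (Suc k)) i x))))"
      using x by (simp add: n m bd_nchain bd_lin frag_cmul_lin face_closed del: sum.atMost_Suc)
    also have "\<dots> = 0"
      using x face_face by (intro alternating_double_sum_zero) (simp add: n m)
    finally show ?thesis .
  qed
qed

text \<open>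
  A face of \<open>x\<close> that deletes vertex \<open>j\<close>, cut at \<open>i\<close>, is a face of the front factor if \<open>j \<le> i\<close> and of
  the back factor otherwise. The differential of the coproduct contains two further families,
  the last faces of the front factors and the zeroth faces of the back factors, which cancel.
\<close>
lemma coprod_bd_nchain:
  assumes x: "x \<in> simplices X n"
  shows "coprod X (bd X (nchain X n x)) =
    tensor_map cdeg 0 (bd X) id (coprod X (nchain X n x)) + tensor_map cdeg (- 1) id (bd X) (coprod X (nchain X n x))"
proof (cases n)
  case 0
  then show ?thesis by (simp add: nchain_0 coprod_def front_op_def back_op_def)
next
  case n: (Suc m)
  \<comment> \<open>The terms in which the front (\<open>P\<close>) or the back factor (\<open>Q\<close>) loses its vertex \<open>j\<close>.\<close>
  define P where "P i j = tens (nchain X i (face X (Suc i) j (front_face X n (Suc i) x)))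
      (nchain X (m - i) (back_face X n (Suc i) x))" for i j
  define Q where "Q i j = tens (nchain X i (front_face X n i x))
      (nchain X (m - i) (face X (n - i) j (back_face X n i x)))" for i j
  \<comment> \<open>The two families that cancel.\<close>
  have PQ: "P i (Suc i) = Q i 0" if "i \<le> m" for i
    using that x by (simp add: P_def Q_def n face_front face_back[of i n x, unfolded n])
  have "coprod X (bd X (nchain X n x)) =
      (\<Sum>j\<le>n. \<Sum>i\<le>m. frag_cmul ((- 1) ^ j) (if j \<le> i then P i j else Q i (j - i)))"
  proof -
    have "coprod X (nchain X m (face X n j x)) = (\<Sum>i\<le>m. if j \<le> i then P i j else Q i (j - i))" if "j \<le> n" for j
    proof -
      have "coprod X (nchain X m (face X n j x)) = (\<Sum>i\<le>m. tens (nchain X i (front_face X m i (face X n j x)))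
          (nchain X (m - i) (back_face X m i (face X n j x))))"
        using that x by (simp add: coprod_nchain face_closed n)
      also have "\<dots> = (\<Sum>i\<le>m. if j \<le> i then P i j else Q i (j - i))"
        using that x by (intro sum.cong)
          (simp_all add: P_def Q_def n front_face_le front_face_greater back_face_le back_face_greater)
      finally show ?thesis .
    qed
    then show ?thesis
      using x by (simp add: n bd_nchain coprod_lin frag_cmul_lin del: sum.atMost_Suc)
  qed
  also have "\<dots> = (\<Sum>i\<le>m. \<Sum>j\<le>n. frag_cmul ((- 1) ^ j) (if j \<le> i then P i j else Q i (j - i)))"
    by (rule sum.swap)
  also have "\<dots> = (\<Sum>i\<le>m. (\<Sum>j\<le>Suc i. frag_cmul ((- 1) ^ j) (P i j))
      + (\<Sum>j\<le>n - i. frag_cmul ((- 1) ^ (i + j)) (Q i j)))"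
  proof (rule sum.cong)
    fix i assume "i \<in> {..m}"
    then have i: "i \<le> m" by simp
    have "(\<Sum>j\<le>n. frag_cmul ((- 1) ^ j) (if j \<le> i then P i j else Q i (j - i))) =
       (\<Sum>j\<le>i. frag_cmul ((- 1) ^ j) (P i j)) + (\<Sum>j\<in>{Suc i..n}. frag_cmul ((- 1) ^ j) (Q i (j - i)))"
    proof -
      have "{..n} = {..i} \<union> {Suc i..n}" using i n by auto
      then show ?thesis by (simp add: sum.union_disjoint ivl_disj_int)
    qed
    also have "(\<Sum>j\<in>{Suc i..n}. frag_cmul ((- 1) ^ j) (Q i (j - i))) =
      (\<Sum>j\<in>{Suc 0..n - i}. frag_cmul ((- 1) ^ (i + j)) (Q i j))"
      using i n by (intro sum.reindex_bij_witness[where i = "\<lambda>j. i + j" and j = "\<lambda>j. j - i"]) auto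
    also have "\<dots> = (\<Sum>j\<le>n - i. frag_cmul ((- 1) ^ (i + j)) (Q i j)) - frag_cmul ((- 1) ^ i) (Q i 0)"
    proof -
      have "{..n - i} = insert 0 {Suc 0..n - i}" by auto
      then show ?thesis by simp
    qed
    finally show "(\<Sum>j\<le>n. frag_cmul ((- 1) ^ j) (if j \<le> i then P i j else Q i (j - i))) =
       (\<Sum>j\<le>Suc i. frag_cmul ((- 1) ^ j) (P i j)) + (\<Sum>j\<le>n - i. frag_cmul ((- 1) ^ (i + j)) (Q i j))"
      using PQ[OF i] by (simp add: algebra_simps flip: minus_frag_cmul)
  qed simp
  also have "\<dots> = (\<Sum>i\<le>m. \<Sum>j\<le>Suc i. frag_cmul ((- 1) ^ j) (P i j))
      + (\<Sum>i\<le>m. \<Sum>j\<le>n - i. frag_cmul ((- 1) ^ (i + j)) (Q i j))"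
    by (rule sum.distrib)
  also have "(\<Sum>i\<le>m. \<Sum>j\<le>Suc i. frag_cmul ((- 1) ^ j) (P i j)) =
      tensor_map cdeg 0 (bd X) id (coprod X (nchain X n x))"
  proof -
    have "tensor_map cdeg 0 (bd X) id (coprod X (nchain X n x)) =
      (\<Sum>i\<le>n. tens (bd X (nchain X i (front_face X n i x))) (nchain X (n - i) (back_face X n i x)))"
      using x by (simp add: coprod_nchain tensor_map_lin tensor_map_tens_0[OF linear_bd linear_id])
    also have "\<dots> = (\<Sum>i\<le>m. tens (bd X (nchain X (Suc i) (front_face X n (Suc i) x))) (nchain X (m - i) (back_face X n (Suc i) x)))"
      by (simp add: n sum.atMost_shift nchain_0 lessThan_Suc_atMost)
    also have "\<dots> = (\<Sum>i\<le>m. \<Sum>j\<le>Suc i. frag_cmul ((- 1) ^ j) (P i j))"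
      using x by (intro sum.cong refl) (simp add: n P_def bd_nchain front_closed tens_lin del: sum.atMost_Suc)
    finally show ?thesis by simp
  qed
  also have "(\<Sum>i\<le>m. \<Sum>j\<le>n - i. frag_cmul ((- 1) ^ (i + j)) (Q i j)) =
      tensor_map cdeg (- 1) id (bd X) (coprod X (nchain X n x))"
  proof -
    have "tensor_map cdeg (- 1) id (bd X) (coprod X (nchain X n x)) =
      (\<Sum>i\<le>n. frag_cmul ((- 1) ^ i) (tens (nchain X i (front_face X n i x)) (bd X (nchain X (n - i) (back_face X n i x)))))"
      using x by (simp add: coprod_nchain tensor_map_lin tensor_map_tens[OF linear_id linear_bd nchain_homogeneous]
          ksign_def minus_one_power_iff)
    also have "\<dots> = (\<Sum>i\<le>m. frag_cmul ((- 1) ^ i) (tens (nchain X i (front_face X n i x)) (bd X (nchain X (n - i) (back_face X n i x)))))"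
      by (simp add: n nchain_0)
    also have "\<dots> = (\<Sum>i\<le>m. \<Sum>j\<le>n - i. frag_cmul ((- 1) ^ (i + j)) (Q i j))"
    proof (intro sum.cong refl)
      fix i assume "i \<in> {..m}"
      then have ni: "n - i = Suc (m - i)" "i \<le> n" using n by auto
      show "frag_cmul ((- 1) ^ i) (tens (nchain X i (front_face X n i x)) (bd X (nchain X (n - i) (back_face X n i x)))) =
         (\<Sum>j\<le>n - i. frag_cmul ((- 1) ^ (i + j)) (Q i j))"
        using back_closed[OF x ni(2)] unfolding Q_def ni(1)
        by (simp add: bd_nchain tens_lin frag_cmul_lin power_add del: sum.atMost_Suc)
    qed
    finally show ?thesis by simp
  qed
  finally show ?thesis .
qed

text \<open>
  Both sides are the sum over all cuts of \<open>x\<close> into three pieces; \<open>G a b\<close> is the cut whose pieces have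
  dimensions \<open>a\<close>, \<open>b\<close> and the rest.
\<close>
lemma coassoc_nchain:
  assumes x: "x \<in> simplices X n"
  shows "reassoc (tensor_map cdeg 0 (coprod X) id (coprod X (nchain X n x))) =
    tensor_map cdeg 0 id (coprod X) (coprod X (nchain X n x))"
proof -
  define G where "G a b = tens (nchain X a (front_face X n a x))
    (tens (nchain X b (front_face X (n - a) b (back_face X n a x)))
      (nchain X (n - (a + b)) (back_face X n (a + b) x)))" for a b
  have "reassoc (tensor_map cdeg 0 (coprod X) id (coprod X (nchain X n x))) = (\<Sum>i\<le>n. \<Sum>a\<le>i. G a (i - a))"
  proof -
    have "reassoc (tens (coprod X (nchain X i (front_face X n i x))) (nchain X (n - i) (back_face X n i x))) =
      (\<Sum>a\<le>i. G a (i - a))" if "i \<le> n" for i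
      using x that by (simp add: coprod_nchain front_closed tens_lin reassoc_lin G_def front_front back_front)
    then show ?thesis
      using x by (simp add: coprod_nchain tensor_map_lin reassoc_lin tensor_map_tens_0[OF linear_coprod linear_id])
  qed
  also have "\<dots> = (\<Sum>(a, b)\<in>{(a, b). a + b \<le> n}. G a b)"
    by (rule sum.triangle_reindex_eq[symmetric])
  also have "{(a, b). a + b \<le> n} = (SIGMA a:{..n}. {..n - a})"
    by auto
  also have "(\<Sum>(a, b)\<in>(SIGMA a:{..n}. {..n - a}). G a b) = (\<Sum>a\<le>n. \<Sum>b\<le>n - a. G a b)"
    by (simp add: sum.Sigma)
  also have "\<dots> = tensor_map cdeg 0 id (coprod X) (coprod X (nchain X n x))"
  proof -
    have "tens (nchain X a (front_face X n a x)) (coprod X (nchain X (n - a) (back_face X n a x))) =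
      (\<Sum>b\<le>n - a. G a b)" if "a \<le> n" for a
    proof -
      have "tens (nchain X b (front_face X (n - a) b (back_face X n a x)))
         (nchain X (n - a - b) (back_face X (n - a) b (back_face X n a x))) =
        tens (nchain X b (front_face X (n - a) b (back_face X n a x)))
          (nchain X (n - (a + b)) (back_face X n (a + b) x))" if "b \<le> n - a" for b
        using back_back[of a b n x] that \<open>a \<le> n\<close> by simp
      then show ?thesis
        using x that by (simp add: coprod_nchain back_closed tens_lin G_def)
    qed
    then show ?thesis
      using x by (simp add: coprod_nchain tensor_map_lin tensor_map_tens_0[OF linear_id linear_coprod])
  qed
  finally show ?thesis .
qed

lemma counit_left_nchain:
  assumes x: "x \<in> simplices X n"
  shows "frag_extend (\<lambda>(\<sigma>, \<tau>). if fst \<sigma> = 0 then frag_of \<tau> else 0) (coprod X (nchain X n x)) = nchain X n x"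
proof -
  have e: "frag_extend (\<lambda>(\<sigma>, \<tau>). if fst \<sigma> = 0 then frag_of \<tau> else 0) (tens (nchain X i y) (nchain X j z)) =
    (if i = 0 then nchain X j z else 0)" for i j y z
    by (auto simp: nchain_def)
  show ?thesis
    using x by (simp add: coprod_nchain lin e sum.delta)
qed

lemma counit_right_nchain:
  assumes x: "x \<in> simplices X n"
  shows "frag_extend (\<lambda>(\<sigma>, \<tau>). if fst \<tau> = 0 then frag_of \<sigma> else 0) (coprod X (nchain X n x)) = nchain X n x"
proof -
  have e: "frag_extend (\<lambda>(\<sigma>, \<tau>). if fst \<tau> = 0 then frag_of \<sigma> else 0) (tens (nchain X i y) (nchain X j z)) =
    (if j = 0 then nchain X i y else 0)" for i j y z
    by (auto simp: nchain_def)
  have "(\<Sum>i\<le>n. if n - i = 0 then nchain X i (front_face X n i x) else 0) = (\<Sum>i\<le>n. if i = n then nchain X n x else 0)"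
    by (intro sum.cong) auto
  then show ?thesis
    using x by (simp add: coprod_nchain lin e sum.delta)
qed

end

section \<open>The Hopf algebra on reduced chains\<close>

abbreviation word_deg :: "('b \<Rightarrow> int) \<Rightarrow> 'b list \<Rightarrow> int" where
  "word_deg deg w \<equiv> sum_list (map deg w)"

lemma linear_red_gen: "linear_map (red_gen K)"
  unfolding red_gen_def by (rule linear_map_frag_extend)

lemmas red_gen_lin [lin] = linear_map_simps[OF linear_red_gen]

lemma linear_unit_gen: "linear_map (unit_gen K)"
  unfolding unit_gen_def by (rule linear_map_frag_extend)

lemmas unit_gen_lin [lin] = linear_map_simps[OF linear_unit_gen]

lemma red_gen_basis [simp]:
  "red_gen K (frag_of \<sigma>) = (if \<sigma> = (0, basept K) then 0 else frag_of [\<sigma>])" "red_gen K 0 = 0"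
  by (simp_all add: red_gen_def)

lemma unit_gen_basis [simp]:
  "unit_gen K (frag_of \<sigma>) = (if \<sigma> = (0, basept K) then 0 else frag_of [\<sigma>]) + (if fst \<sigma> = 0 then frag_of [] else 0)"
  "unit_gen K 0 = 0"
  by (simp_all add: unit_gen_def)

lemma homogeneous_red_gen: "homogeneous cdeg n a \<Longrightarrow> homogeneous (word_deg cdeg) n (red_gen K a)"
  unfolding red_gen_def by (rule homogeneous_frag_extend) auto

lemma homogeneous_unit_gen: "homogeneous cdeg n a \<Longrightarrow> homogeneous (word_deg cdeg) n (unit_gen K a)"
  unfolding unit_gen_def by (rule homogeneous_frag_extend) (auto intro: homogeneous_lin)

lemma homogeneous_red_incl: "homogeneous cdeg (cdeg \<sigma>) (red_incl K \<sigma>)"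
  by (auto simp: red_incl_def intro: homogeneous_lin)

lemma homogeneous_bd: "homogeneous cdeg n a \<Longrightarrow> homogeneous cdeg (n - 1) (bd X a)"
  unfolding bd_def
proof (rule homogeneous_frag_extend)
  fix \<sigma> :: "'a cell" assume "cdeg \<sigma> = n"
  moreover have "homogeneous cdeg (int k - 1) (nchain X (k - 1) y)" if "k \<noteq> 0" for k y
    using that by (simp add: nchain_def of_nat_diff)
  ultimately show "homogeneous cdeg (n - 1) (case \<sigma> of (n, x) \<Rightarrow> if n = 0 then 0
      else (\<Sum>i\<le>n. frag_cmul ((- 1) ^ i) (nchain X (n - 1) (face X n i x))))"
    by (auto split: prod.splits intro!: homogeneous_sum homogeneous_lin)
qed

lemma homogeneous_coprod:
  assumes "homogeneous cdeg n a"
  shows "homogeneous (\<lambda>(\<sigma>, \<tau>). cdeg \<sigma> + cdeg \<tau>) n (coprod X a)"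
  unfolding coprod_def
proof (rule homogeneous_frag_extend[OF assms])
  fix \<sigma> :: "'a cell" assume \<sigma>: "cdeg \<sigma> = n"
  obtain k x where kx: "\<sigma> = (k, x)" by (cases \<sigma>)
  have "homogeneous (\<lambda>(\<sigma>, \<tau>). cdeg \<sigma> + cdeg \<tau>) (int k) (tens (nchain X i y) (nchain X (k - i) z))"
    if "i \<le> k" for i y z
    using homogeneous_tens[OF nchain_homogeneous[of i X y] nchain_homogeneous[of "k - i" X z]] that
    by (simp add: of_nat_diff)
  then show "homogeneous (\<lambda>(\<sigma>, \<tau>). cdeg \<sigma> + cdeg \<tau>) n (case \<sigma> of (n, x) \<Rightarrow> \<Sum>i\<le>n.
     tens (nchain X i (act X (front_op n i) n x)) (nchain X (n - i) (act X (back_op i) n x)))"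
    using \<sigma> by (auto simp: kx intro!: homogeneous_sum)
qed

lemma homogeneous_tensor_map_0:
  assumes "homogeneous (\<lambda>(u, v). deg u + deg v) n a"
    "\<And>u. homogeneous deg' (deg u) (f (frag_of u))" "\<And>u. homogeneous deg' (deg u) (g (frag_of u))"
  shows "homogeneous (\<lambda>(u, v). deg' u + deg' v) n (tensor_map d 0 f g a)"
  unfolding tensor_map_def
  by (rule homogeneous_frag_extend[OF assms(1)])
    (use homogeneous_tens[OF assms(2) assms(3)] in auto)

lemma supp_tensor_map:
  assumes "supp a \<subseteq> S \<times> S'" "\<And>u. u \<in> S \<Longrightarrow> supp (f (frag_of u)) \<subseteq> T" "\<And>u. u \<in> S' \<Longrightarrow> supp (g (frag_of u)) \<subseteq> T'"
  shows "supp (tensor_map deg q f g a) \<subseteq> T \<times> T'"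
  unfolding tensor_map_def
proof (rule keys_frag_extend_subset[OF assms(1)])
  fix p assume "p \<in> S \<times> S'"
  then show "supp (case p of (x, y) \<Rightarrow> frag_cmul (ksign (q * deg x)) (tens (f (frag_of x)) (g (frag_of y)))) \<subseteq> T \<times> T'"
    using keys_tens_subset[OF assms(2) assms(3)] keys_cmul by (auto split: prod.splits)
qed

lemma supp_sum: "(\<And>i. i \<in> I \<Longrightarrow> supp (h i) \<subseteq> S) \<Longrightarrow> supp (sum h I) \<subseteq> S"
proof (induction I rule: infinite_finite_induct)
  case (insert i I)
  then show ?case using keys_add[of "h i" "sum h I"] by auto
qed simp_all

context simplicial_set
begin

lemma bd_supp:
  assumes "supp c \<subseteq> nondeg_cells X"
  shows "supp (bd X c) \<subseteq> nondeg_cells X"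
  unfolding bd_def
proof (rule keys_frag_extend_subset[OF assms])
  fix \<sigma> assume "\<sigma> \<in> nondeg_cells X"
  then obtain n x where \<sigma>: "\<sigma> = (n, x)" and x: "x \<in> simplices X n" by (auto simp: nondeg_cells_def)
  show "supp (case \<sigma> of (n, x) \<Rightarrow> if n = 0 then 0
      else (\<Sum>i\<le>n. frag_cmul ((- 1) ^ i) (nchain X (n - 1) (face X n i x)))) \<subseteq> nondeg_cells X"
  proof (cases n)
    case (Suc m)
    have "supp (frag_cmul ((- 1) ^ i) (nchain X m (face X (Suc m) i x))) \<subseteq> nondeg_cells X" if "i \<le> Suc m" for i
      using x that Suc by (intro order_trans[OF keys_cmul] nchain_supp face_closed) simp_all
    then have "supp (\<Sum>i\<le>Suc m. frag_cmul ((- 1) ^ i) (nchain X m (face X (Suc m) i x))) \<subseteq> nondeg_cells X"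
      by (intro supp_sum) simp
    then show ?thesis by (simp add: \<sigma> Suc del: sum.atMost_Suc)
  qed (simp add: \<sigma>)
qed

lemma coprod_supp:
  assumes "supp c \<subseteq> nondeg_cells X"
  shows "supp (coprod X c) \<subseteq> nondeg_cells X \<times> nondeg_cells X"
  unfolding coprod_def
proof (rule keys_frag_extend_subset[OF assms])
  fix \<sigma> assume "\<sigma> \<in> nondeg_cells X"
  then obtain n x where \<sigma>: "\<sigma> = (n, x)" and x: "x \<in> simplices X n" by (auto simp: nondeg_cells_def)
  show "supp (case \<sigma> of (n, x) \<Rightarrow> \<Sum>i\<le>n.
     tens (nchain X i (act X (front_op n i) n x)) (nchain X (n - i) (act X (back_op i) n x)))
     \<subseteq> nondeg_cells X \<times> nondeg_cells X"
    unfolding \<sigma> front_face_def[symmetric] back_face_def[symmetric] prod.case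
    using front_closed[OF x] back_closed[OF x]
    by (intro supp_sum keys_tens_subset nchain_supp) simp_all
qed

text \<open>
  Identities between chain operators are checked on the classes of all simplices, degenerate ones
  included, for which the formulas \<open>bd_nchain\<close> and \<open>coprod_nchain\<close> are available.
\<close>
lemma chain_eqI:
  assumes "linear_map f" "linear_map h" "supp c \<subseteq> nondeg_cells X"
    and "\<And>n x. x \<in> simplices X n \<Longrightarrow> f (nchain X n x) = h (nchain X n x)"
  shows "f c = h c"
  using assms(3)
proof (induction rule: frag_induction)
  case (one \<sigma>)
  then show ?case using assms(4)[of "snd \<sigma>" "fst \<sigma>"] nchain_nondeg[of "fst \<sigma>" "snd \<sigma>" X]
    by (auto simp: nondeg_cells_def)
qed (simp_all add: linear_map_simps[OF assms(1)] linear_map_simps[OF assms(2)])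

lemma bd_bd: "supp c \<subseteq> nondeg_cells X \<Longrightarrow> bd X (bd X c) = 0"
  by (rule chain_eqI[where f = "\<lambda>c. bd X (bd X c)" and h = "\<lambda>_. 0"]) (auto simp: lin bd_bd_nchain)

lemma coprod_bd:
  "supp c \<subseteq> nondeg_cells X \<Longrightarrow> coprod X (bd X c) =
    tensor_map cdeg 0 (bd X) id (coprod X c) + tensor_map cdeg (- 1) id (bd X) (coprod X c)"
  by (rule chain_eqI[where f = "\<lambda>c. coprod X (bd X c)" and h = "\<lambda>c.
        tensor_map cdeg 0 (bd X) id (coprod X c) + tensor_map cdeg (- 1) id (bd X) (coprod X c)"])
    (auto simp: lin coprod_bd_nchain)

lemma coprod_coassoc:
  "supp c \<subseteq> nondeg_cells X \<Longrightarrow> reassoc (tensor_map cdeg 0 (coprod X) id (coprod X c)) =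
    tensor_map cdeg 0 id (coprod X) (coprod X c)"
  by (rule chain_eqI[where f = "\<lambda>c. reassoc (tensor_map cdeg 0 (coprod X) id (coprod X c))"
        and h = "\<lambda>c. tensor_map cdeg 0 id (coprod X) (coprod X c)"])
    (auto simp: lin coassoc_nchain)

lemma coprod_counit:
  assumes "supp c \<subseteq> nondeg_cells X"
  shows "frag_extend (\<lambda>(\<sigma>, \<tau>). if fst \<sigma> = 0 then frag_of \<tau> else 0) (coprod X c) = c"
    "frag_extend (\<lambda>(\<sigma>, \<tau>). if fst \<tau> = 0 then frag_of \<sigma> else 0) (coprod X c) = c"
  by (rule chain_eqI[OF _ _ assms, where h = "\<lambda>c. c" and f = "\<lambda>c. frag_extend (\<lambda>(\<sigma>, \<tau>). if fst \<sigma> = 0 then frag_of \<tau> else 0) (coprod X c)"];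
      auto simp: lin counit_left_nchain)
    (rule chain_eqI[OF _ _ assms, where h = "\<lambda>c. c" and f = "\<lambda>c. frag_extend (\<lambda>(\<sigma>, \<tau>). if fst \<tau> = 0 then frag_of \<sigma> else 0) (coprod X c)"];
      auto simp: lin counit_right_nchain)

end

text \<open>
  The unit component of \<open>unit_gen\<close> is the counit of the chains, and the two vertices of an edge
  contribute opposite signs.
\<close>
lemma unit_gen_bd: "unit_gen K (bd K c) = red_gen K (bd K c)"
proof -
  define e where "e = frag_extend (\<lambda>\<sigma>::'a cell. if fst \<sigma> = 0 then frag_of ([]::'a cell list) else 0)"
  have "unit_gen K a = red_gen K a + e a" for a
    by (induction a rule: frag_induct) (simp_all add: lin e_def)
  moreover have "e (bd K c) = 0"
  proof (induction c rule: frag_induct)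
    case (of \<sigma>)
    obtain n x where \<sigma>: "\<sigma> = (n, x)" by (cases \<sigma>)
    have n: "e (nchain K m y) = (if m = 0 then frag_of [] else 0)" for m y
      by (simp add: e_def nchain_def)
    have l: "e (sum h I) = (\<Sum>i\<in>I. e (h i))" "e (frag_cmul k a) = frag_cmul k (e a)"
      for h :: "nat \<Rightarrow> _" and I k a
      by (simp_all add: e_def lin)
    show ?case
    proof (cases n)
      case 0
      then show ?thesis by (simp add: \<sigma> e_def)
    next
      case (Suc m)
      then have "e (bd K (frag_of \<sigma>)) = (\<Sum>i\<le>Suc m. frag_cmul ((- 1) ^ i) (if m = 0 then frag_of [] else 0))"
        by (simp add: \<sigma> bd_def l n del: sum.atMost_Suc)
      then show ?thesis by (cases m) (simp_all del: sum.atMost_Suc, simp)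
    qed
  qed (simp_all add: e_def lin)
  ultimately show ?thesis by simp
qed

definition chains_gen_diff :: "'a pointed_sset \<Rightarrow> 'a cell \<Rightarrow> 'a cell list \<Rightarrow>\<^sub>0 int" where
  "chains_gen_diff K \<sigma> = red_gen K (bd K (red_incl K \<sigma>))"

definition chains_gen_diag :: "'a pointed_sset \<Rightarrow> 'a cell \<Rightarrow> 'a cell list \<times> 'a cell list \<Rightarrow>\<^sub>0 int" where
  "chains_gen_diag K \<sigma> = tensor_map cdeg 0 (unit_gen K) (unit_gen K) (coprod K (red_incl K \<sigma>))"

lemma tensor_chains_eq:
  "tensor_chains K = word_hopf (red_cells K) cdeg (chains_gen_diff K) (chains_gen_diag K)"
  unfolding tensor_chains_def tensor_chains_alg_def word_hopf_def
  by (simp add: chains_gen_diff_def[abs_def] chains_gen_diag_def[abs_def])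

lemma chains_word_derivation: "word_derivation cdeg (chains_gen_diff K)"
  unfolding chains_gen_diff_def
  by unfold_locales (intro homogeneous_red_gen homogeneous_bd homogeneous_red_incl)

lemma unit_gen_red_incl: "\<sigma> \<in> red_cells K \<Longrightarrow> unit_gen K (red_incl K \<sigma>) = frag_of [\<sigma>]"
  by (auto simp: red_incl_def red_cells_def lin)

text \<open>
  Fixes the record type for which the constructions on pointed simplicial sets are defined.
\<close>
locale based_sset = pointed_simplicial_set K for K :: "'a pointed_sset"

context based_sset
begin

interpretation word_derivation cdeg "chains_gen_diff K" by (rule chains_word_derivation)

abbreviation "\<eta> \<equiv> unit_gen K"
abbreviation "\<Delta>\<^sub>T \<equiv> alg_ext T (chains_gen_diag K)"

lemma basept_cell: "(0, basept K) \<in> nondeg_cells K"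
  by (simp add: nondeg_cells_def basept_in)

lemma red_incl_supp: "\<sigma> \<in> red_cells K \<Longrightarrow> supp (red_incl K \<sigma>) \<subseteq> nondeg_cells K"
  using basept_cell keys_diff[of "frag_of \<sigma>" "frag_of (0, basept K)"]
  by (auto simp: red_incl_def red_cells_def)

lemma unit_gen_supp: "supp c \<subseteq> nondeg_cells K \<Longrightarrow> supp (\<eta> c) \<subseteq> lists (red_cells K)"
  unfolding unit_gen_def
proof (erule keys_frag_extend_subset)
  fix \<sigma> assume "\<sigma> \<in> nondeg_cells K"
  then show "supp (red_gen K (frag_of \<sigma>) + (if fst \<sigma> = 0 then frag_of [] else 0)) \<subseteq> lists (red_cells K)"
    using keys_add[of "frag_of [\<sigma>]" "frag_of []"] by (auto simp: red_cells_def)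
qed

lemma red_gen_supp: "supp c \<subseteq> nondeg_cells K \<Longrightarrow> supp (red_gen K c) \<subseteq> lists (red_cells K) - {[]}"
  unfolding red_gen_def
  by (erule keys_frag_extend_subset) (auto simp: red_cells_def)

text \<open>
  Together with \<open>diag_unit_gen\<close>: \<open>\<eta>\<close> is a morphism of chain coalgebras. Unlike the
  inclusion of the generators it takes all chains to the tensor algebra, so that the coproduct, which
  does not preserve reduced chains, can be followed through it.
\<close>
lemma der_unit_gen:
  assumes "supp c \<subseteq> nondeg_cells K"
  shows "der (\<eta> c) = \<eta> (bd K c)"
  using assms
proof (induction rule: frag_induction)
  case (one \<sigma>)
  have "der (frag_of [\<sigma>]) = chains_gen_diff K \<sigma>" using W.mult_one_right by simp
  moreover have "bd K (red_incl K \<sigma>) = bd K (frag_of \<sigma>)"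
    by (cases \<sigma>) (simp add: red_incl_def lin)
  ultimately have "der (frag_of [\<sigma>]) = \<eta> (bd K (frag_of \<sigma>))"
    by (simp add: chains_gen_diff_def unit_gen_bd)
  then show ?case by (auto simp: lin)
qed (simp_all add: lin)

lemma diag_unit_gen:
  assumes "supp c \<subseteq> nondeg_cells K"
  shows "\<Delta>\<^sub>T (\<eta> c) = tensor_map cdeg 0 \<eta> \<eta> (coprod K c)"
  using assms
proof (induction rule: frag_induction)
  case (one \<sigma>)
  have one: "\<Delta>\<^sub>T (frag_of []) = frag_of ([], [])" by (simp add: tensor_galg_sel)
  have base: "tensor_map cdeg 0 \<eta> \<eta> (coprod K (frag_of (0, y))) = tens (\<eta> (frag_of (0, y))) (\<eta> (frag_of (0, y)))" for y
    by (simp add: coprod_def front_op_def back_op_def nchain_0)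
  have gen: "\<Delta>\<^sub>T (frag_of [\<sigma>]) = tensor_map cdeg 0 \<eta> \<eta> (coprod K (red_incl K \<sigma>))"
    using T.mult_one_right[of "chains_gen_diag K \<sigma>"] by (simp add: chains_gen_diag_def)
  have "\<eta> (frag_of \<sigma>) = (if \<sigma> = (0, basept K) then frag_of [] else if fst \<sigma> = 0 then frag_of [\<sigma>] + frag_of [] else frag_of [\<sigma>])"
    by auto
  then show ?case
    using base[of "basept K"] by (auto simp: red_incl_def coprod_lin tensor_map_lin alg_ext_lin gen one simp del: alg_ext_basis)
qed (simp_all add: lin)

lemma diff_tensor_unit_gen:
  assumes "supp z \<subseteq> nondeg_cells K \<times> nondeg_cells K"
  shows "tdiff (tensor_map cdeg 0 \<eta> \<eta> z) =
    tensor_map cdeg 0 \<eta> \<eta> (tensor_map cdeg 0 (bd K) id z + tensor_map cdeg (- 1) id (bd K) z)"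
  using assms
proof (induction rule: frag_induction)
  case (one p)
  then obtain \<sigma> \<tau> where p: "p = (\<sigma>, \<tau>)" "\<sigma> \<in> nondeg_cells K" "\<tau> \<in> nondeg_cells K" by auto
  have d: "der (\<eta> (frag_of \<rho>)) = \<eta> (bd K (frag_of \<rho>))" if "\<rho> \<in> nondeg_cells K" for \<rho>
    using that by (intro der_unit_gen) simp
  have "tdiff (tens (\<eta> (frag_of \<sigma>)) (\<eta> (frag_of \<tau>))) =
    tens (\<eta> (bd K (frag_of \<sigma>))) (\<eta> (frag_of \<tau>)) + frag_cmul (ksign (cdeg \<sigma>)) (tens (\<eta> (frag_of \<sigma>)) (\<eta> (bd K (frag_of \<tau>))))"
    using tdiff_tens[OF homogeneous_unit_gen, of "cdeg \<sigma>" "frag_of \<sigma>" K "\<eta> (frag_of \<tau>)"] d p by simp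
  moreover have "tensor_map cdeg 0 \<eta> \<eta> (frag_of (\<sigma>, \<tau>)) = tens (\<eta> (frag_of \<sigma>)) (\<eta> (frag_of \<tau>))"
    by (simp del: unit_gen_basis)
  moreover have "tensor_map cdeg 0 \<eta> \<eta> (tensor_map cdeg 0 (bd K) id (frag_of (\<sigma>, \<tau>)) + tensor_map cdeg (- 1) id (bd K) (frag_of (\<sigma>, \<tau>))) =
     tens (\<eta> (bd K (frag_of \<sigma>))) (\<eta> (frag_of \<tau>)) + frag_cmul (ksign (cdeg \<sigma>)) (tens (\<eta> (frag_of \<sigma>)) (\<eta> (bd K (frag_of \<tau>))))"
    by (simp add: lin tensor_map_tens_0[OF linear_unit_gen linear_unit_gen] del: unit_gen_basis)
  ultimately show ?case unfolding p by (simp only:)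
qed (simp_all add: tensor_map_lin algebra_simps)

lemma coassoc_unit_gen:
  assumes "supp z \<subseteq> nondeg_cells K \<times> nondeg_cells K"
  shows "reassoc (tensor_map wdeg 0 \<Delta>\<^sub>T id (tensor_map cdeg 0 \<eta> \<eta> z)) =
      tensor_map cdeg 0 \<eta> (tensor_map cdeg 0 \<eta> \<eta>) (reassoc (tensor_map cdeg 0 (coprod K) id z))"
    "tensor_map wdeg 0 id \<Delta>\<^sub>T (tensor_map cdeg 0 \<eta> \<eta> z) =
      tensor_map cdeg 0 \<eta> (tensor_map cdeg 0 \<eta> \<eta>) (tensor_map cdeg 0 id (coprod K) z)"
proof -
  have \<Delta>: "linear_map \<Delta>\<^sub>T" and \<eta>\<eta>: "linear_map (tensor_map cdeg 0 \<eta> \<eta>)" by (auto simp: lin)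
  have d: "\<Delta>\<^sub>T (\<eta> (frag_of \<rho>)) = tensor_map cdeg 0 \<eta> \<eta> (coprod K (frag_of \<rho>))" if "\<rho> \<in> nondeg_cells K" for \<rho>
    using that by (intro diag_unit_gen) simp
  have re: "reassoc (tens (tensor_map cdeg 0 \<eta> \<eta> y) (\<eta> c)) =
      tensor_map cdeg 0 \<eta> (tensor_map cdeg 0 \<eta> \<eta>) (reassoc (tens y c))" for y c
  proof (induction y rule: tens_induct)
    case (tens u v)
    show ?case
      by (simp add: tensor_map_tens_0[OF linear_unit_gen linear_unit_gen] tensor_map_tens_0[OF linear_unit_gen \<eta>\<eta>]
        del: unit_gen_basis tensor_map_basis tens_basis)
  qed (simp_all add: lin)
  show "reassoc (tensor_map wdeg 0 \<Delta>\<^sub>T id (tensor_map cdeg 0 \<eta> \<eta> z)) =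
      tensor_map cdeg 0 \<eta> (tensor_map cdeg 0 \<eta> \<eta>) (reassoc (tensor_map cdeg 0 (coprod K) id z))"
    using assms
  proof (induction rule: frag_induction)
    case (one p)
    then show ?case
      by (auto simp: tensor_map_tens_0[OF \<Delta> linear_id, unfolded id_def] d re simp del: unit_gen_basis)
  qed (simp_all add: lin)
  show "tensor_map wdeg 0 id \<Delta>\<^sub>T (tensor_map cdeg 0 \<eta> \<eta> z) =
      tensor_map cdeg 0 \<eta> (tensor_map cdeg 0 \<eta> \<eta>) (tensor_map cdeg 0 id (coprod K) z)"
    using assms
  proof (induction rule: frag_induction)
    case (one p)
    then show ?case
      by (auto simp: tensor_map_tens_0[OF linear_id \<Delta>, unfolded id_def] tensor_map_tens_0[OF linear_unit_gen \<eta>\<eta>] d simp del: unit_gen_basis)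
  qed (simp_all add: lin)
qed

text \<open>
  The augmentation of \<open>\<eta> \<sigma>\<close> is 1 on vertices and 0 in positive dimensions.
\<close>
lemma counit_unit_gen:
  "frag_extend (\<lambda>(u, v). if u = [] then frag_of v else 0) (tensor_map cdeg 0 \<eta> \<eta> z) =
     \<eta> (frag_extend (\<lambda>(\<sigma>, \<tau>). if fst \<sigma> = 0 then frag_of \<tau> else 0) z)"
  "frag_extend (\<lambda>(u, v). if v = [] then frag_of u else 0) (tensor_map cdeg 0 \<eta> \<eta> z) =
     \<eta> (frag_extend (\<lambda>(\<sigma>, \<tau>). if fst \<tau> = 0 then frag_of \<sigma> else 0) z)"
proof -
  have l: "frag_extend (\<lambda>(u, v). if u = [] then frag_of v else 0) (tens (\<eta> (frag_of \<sigma>)) b) = (if fst \<sigma> = 0 then b else 0)" for \<sigma> b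
  proof (induction b rule: frag_induct)
    case (of x)
    then show ?case by (simp add: lin)
  qed (simp_all add: lin del: unit_gen_basis(1))
  have r: "frag_extend (\<lambda>(u, v). if v = [] then frag_of u else 0) (tens b (\<eta> (frag_of \<sigma>))) = (if fst \<sigma> = 0 then b else 0)" for \<sigma> b
  proof (induction b rule: frag_induct)
    case (of x)
    then show ?case by (simp add: lin)
  qed (simp_all add: lin del: unit_gen_basis(1))
  show "frag_extend (\<lambda>(u, v). if u = [] then frag_of v else 0) (tensor_map cdeg 0 \<eta> \<eta> z) =
     \<eta> (frag_extend (\<lambda>(\<sigma>, \<tau>). if fst \<sigma> = 0 then frag_of \<tau> else 0) z)"
    by (induction z rule: frag_induct) (auto simp: lin l simp del: unit_gen_basis(1))
  show "frag_extend (\<lambda>(u, v). if v = [] then frag_of u else 0) (tensor_map cdeg 0 \<eta> \<eta> z) =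
     \<eta> (frag_extend (\<lambda>(\<sigma>, \<tau>). if fst \<tau> = 0 then frag_of \<sigma> else 0) z)"
    by (induction z rule: frag_induct) (auto simp: lin r simp del: unit_gen_basis(1))
qed

text \<open>
  A generator is \<open>\<eta>\<close> of the reduced chain for which it stands, so each axiom on generators is the image
  under tensor powers of \<open>\<eta>\<close> of the same axiom for the chain coalgebra.
\<close>
theorem chains_word_hopf_data:
  "word_hopf_data (red_cells K) cdeg (chains_gen_diff K) (chains_gen_diag K)"
proof
  fix \<sigma> :: "'a cell"
  show "homogeneous (\<lambda>(u, v). wdeg u + wdeg v) (cdeg \<sigma>) (chains_gen_diag K \<sigma>)"
    unfolding chains_gen_diag_def
    by (intro homogeneous_tensor_map_0[where deg = cdeg] homogeneous_coprod homogeneous_red_incl homogeneous_unit_gen) simp_all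
  assume \<sigma>: "\<sigma> \<in> red_cells K"
  let ?r = "red_incl K \<sigma>"
  note r = red_incl_supp[OF \<sigma>]
  note b = bd_supp[OF r] and c = coprod_supp[OF r]
  have g: "chains_gen_diff K \<sigma> = \<eta> (bd K ?r)"
    by (simp add: chains_gen_diff_def unit_gen_bd)
  show "supp (chains_gen_diff K \<sigma>) \<subseteq> lists (red_cells K) - {[]}"
    unfolding chains_gen_diff_def by (rule red_gen_supp[OF b])
  show "supp (chains_gen_diag K \<sigma>) \<subseteq> lists (red_cells K) \<times> lists (red_cells K)"
    unfolding chains_gen_diag_def by (rule supp_tensor_map[OF c]) (rule unit_gen_supp, simp)+
  show "der (chains_gen_diff K \<sigma>) = 0"
    unfolding g der_unit_gen[OF b] by (simp add: bd_bd[OF r])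
  show "\<Delta>\<^sub>T (chains_gen_diff K \<sigma>) = tdiff (chains_gen_diag K \<sigma>)"
    unfolding g diag_unit_gen[OF b] chains_gen_diag_def diff_tensor_unit_gen[OF c] coprod_bd[OF r] ..
  show "reassoc (tensor_map wdeg 0 \<Delta>\<^sub>T id (chains_gen_diag K \<sigma>)) =
      tensor_map wdeg 0 id \<Delta>\<^sub>T (chains_gen_diag K \<sigma>)"
    unfolding chains_gen_diag_def[of K \<sigma>] coassoc_unit_gen[OF c] coprod_coassoc[OF r] ..
  show "frag_extend (\<lambda>(u, v). if u = [] then frag_of v else 0) (chains_gen_diag K \<sigma>) = frag_of [\<sigma>]"
    "frag_extend (\<lambda>(u, v). if v = [] then frag_of u else 0) (chains_gen_diag K \<sigma>) = frag_of [\<sigma>]"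
    unfolding chains_gen_diag_def counit_unit_gen coprod_counit[OF r] unit_gen_red_incl[OF \<sigma>] by (rule refl)+
qed

end

section \<open>The suspension as a simplicial set\<close>

lemma act_susp_None [simp]: "act (susp K) w n None = None"
proof -
  have "snd (foldr (act_letter (susp K)) w (n, None)) = None"
  proof (induction w)
    case (Cons l w)
    then show ?case by (cases l) (simp_all add: susp_def)
  qed simp
  then show ?thesis by (simp add: act_def)
qed

lemma susp_face_degen_None [simp]: "face (susp K) n i None = None" "degen (susp K) n i None = None"
  by (simp_all add: susp_def)

lemma None_in_susp [simp]: "None \<in> simplices (susp K) n"
  by (simp add: susp_def)

lemma basept_susp [simp]: "basept (susp K) = None"
  by (simp add: susp_def)

lemma susp_simplices_0 [simp]: "simplices (susp K) 0 = {None}"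
  by (auto simp: susp_def)

lemma degenerate_None: "degenerate (susp K) (Suc n) None"
  using degenerateI[of None "susp K" n 0] by simp

definition susp_cell :: "'a pointed_sset \<Rightarrow> 'a cell \<Rightarrow> (nat \<times> 'a) option cell" where
  "susp_cell K \<sigma> = (Suc (fst \<sigma>), susp_pt K (fst \<sigma>) (Suc 0) (snd \<sigma>))"

definition cobar_gen_diff ::
  "'a pointed_sset \<Rightarrow> (nat \<times> 'a) option cell \<Rightarrow> (nat \<times> 'a) option cell list \<Rightarrow>\<^sub>0 int" where
  "cobar_gen_diff K \<tau> = - red_gen (susp K) (bd (susp K) (red_incl (susp K) \<tau>))
     + concat_tensor (tensor_map cdeg (- 1) (red_gen (susp K)) (red_gen (susp K)) (red_coprod (susp K) (red_incl (susp K) \<tau>)))"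

context based_sset
begin

lemma susp_pt_in: "x \<in> simplices K m \<Longrightarrow> 1 \<le> i \<Longrightarrow> n = m + i \<Longrightarrow> susp_pt K m i x \<in> simplices (susp K) n"
  by (auto simp: susp_def intro!: exI[of _ i] exI[of _ x])

text \<open>
  The uniform description by \<open>susp_pt\<close>, which identifies the classes of \<open>(i, k\<^sub>m)\<close> with the base
  simplices, also covers these classes in the formulas for faces and degeneracies below.
\<close>
lemma susp_cases:
  assumes "z \<in> simplices (susp K) n"
  obtains "z = None" | m i x where "z = susp_pt K m i x" "1 \<le> i" "n = m + i" "x \<in> simplices K m"
proof -
  have "z = None \<or> (\<exists>i x. z = susp_pt K (n - i) i x \<and> 1 \<le> i \<and> i \<le> n \<and> x \<in> simplices K (n - i))"
    using assms by (auto simp: susp_def)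
  then show thesis
  proof
    assume "\<exists>i x. z = susp_pt K (n - i) i x \<and> 1 \<le> i \<and> i \<le> n \<and> x \<in> simplices K (n - i)"
    then obtain i x where "z = susp_pt K (n - i) i x" "1 \<le> i" "i \<le> n" "x \<in> simplices K (n - i)" by blast
    then show thesis using that(2)[of "n - i" i x] by simp
  qed (use that in auto)
qed

lemma face_susp_pt:
  assumes "n = m + i" "1 \<le> i" "j \<le> n"
  shows "face (susp K) n j (susp_pt K m i x) =
    (if j < i then (if i = Suc 0 then None else susp_pt K m (i - 1) x)
     else if m = 0 then None else susp_pt K (m - 1) i (face K m (j - i) x))"
proof (cases m)
  case (Suc m')
  then have "j - i \<le> Suc m'" using assms by simp
  then show ?thesis using assms Suc face_base_simplex[of "j - i" m']
    by (auto simp: susp_def susp_pt_def)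
qed (use assms in \<open>auto simp: susp_def susp_pt_def\<close>)

lemma degen_susp_pt:
  assumes "n = m + i" "1 \<le> i" "j \<le> n"
  shows "degen (susp K) n j (susp_pt K m i x) =
    (if j < i then susp_pt K m (Suc i) x else susp_pt K (Suc m) i (degen K m (j - i) x))"
proof -
  have "j - i \<le> m" using assms by simp
  then show ?thesis
    using assms degen_base_simplex[of "j - i" m] by (auto simp: susp_def susp_pt_def)
qed

text \<open>
  In \<open>(a, x)\<close> the vertices below \<open>a\<close> belong to the suspension coordinate and the others to \<open>x\<close>. Each
  identity splits accordingly: it is a statement about \<open>a\<close> alone, about commuting operations on \<open>a\<close>
  and \<open>x\<close>, or the same identity for \<open>x\<close> with indices lowered by \<open>a\<close>.
\<close>
lemma simplicial_set_susp: "simplicial_set (susp K)"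
proof
  fix n i z
  assume "z \<in> simplices (susp K) (Suc n)" "i \<le> Suc n"
  then show "face (susp K) (Suc n) i z \<in> simplices (susp K) n"
  proof (cases rule: susp_cases)
    case (2 m a x)
    show ?thesis
    proof (cases m)
      case 0
      then show ?thesis using 2 \<open>i \<le> Suc n\<close> by (auto simp: face_susp_pt intro!: susp_pt_in)
    next
      case (Suc k)
      then show ?thesis using 2 \<open>i \<le> Suc n\<close> by (auto simp: face_susp_pt face_closed intro!: susp_pt_in)
    qed
  qed simp
next
  fix n i z
  assume "z \<in> simplices (susp K) n" "i \<le> n"
  then show "degen (susp K) n i z \<in> simplices (susp K) (Suc n)"
    by (cases rule: susp_cases) (auto simp: degen_susp_pt degen_closed intro!: susp_pt_in)
next
  fix n i j z
  assume z: "z \<in> simplices (susp K) (Suc (Suc n))" and ij: "i < j" "j \<le> Suc (Suc n)"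
  from z show "face (susp K) (Suc n) i (face (susp K) (Suc (Suc n)) j z) =
     face (susp K) (Suc n) (j - 1) (face (susp K) (Suc (Suc n)) i z)"
  proof (cases rule: susp_cases)
    case (2 m a x)
    show ?thesis
    \<comment> \<open>Only here do both faces act on \<open>x\<close>; in smaller dimensions one of the results is a base simplex.\<close>
    proof (cases "m \<ge> 2 \<and> a \<le> i")
      case True
      then obtain k where m: "m = Suc (Suc k)" by (metis Suc_diff_Suc diff_zero less_2_cases_iff not_less numeral_2_eq_2 Suc_le_D)
      have "face K (Suc k) (i - a) (face K m (j - a) x) = face K (Suc k) (j - a - 1) (face K m (i - a) x)"
        using face_face[of x k "i - a" "j - a"] 2 ij True m by auto
      moreover have "\<not> j - 1 < a" using ij True by linarith
      ultimately show ?thesis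
        using 2 ij True m by (simp add: face_susp_pt)
    next
      case False
      then show ?thesis
        using 2 ij by (auto simp: face_susp_pt)
    qed
  qed simp
next
  fix n i j z
  assume z: "z \<in> simplices (susp K) n" and ij: "i \<le> j" "j \<le> n"
  from z show "degen (susp K) (Suc n) i (degen (susp K) n j z) =
     degen (susp K) (Suc n) (Suc j) (degen (susp K) n i z)"
  proof (cases rule: susp_cases)
    case (2 m a x)
    then show ?thesis
      using ij degen_degen[of x m "i - a" "j - a"] by (auto simp: degen_susp_pt Suc_diff_le)
  qed simp
next
  fix n i j z
  assume z: "z \<in> simplices (susp K) (Suc n)" and ij: "i < j" "j \<le> Suc n"
  from z show "face (susp K) (Suc (Suc n)) i (degen (susp K) (Suc n) j z) =
     degen (susp K) n (j - 1) (face (susp K) (Suc n) i z)"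
  proof (cases rule: susp_cases)
    case (2 m a x)
    show ?thesis
    proof (cases m)
      case 0
      then show ?thesis using 2 ij by (auto simp: degen_susp_pt face_susp_pt)
    next
      case (Suc k)
      then show ?thesis
        using 2 ij face_degen_less[of x k "i - a" "j - a"] by (auto simp: degen_susp_pt face_susp_pt)
    qed
  qed simp
next
  fix n i j z
  assume z: "z \<in> simplices (susp K) n" and ij: "j \<le> n" "i = j \<or> i = Suc j"
  from z show "face (susp K) (Suc n) i (degen (susp K) n j z) = z"
  proof (cases rule: susp_cases)
    case (2 m a x)
    then show ?thesis
      using ij face_degen_same[of x m "j - a" "i - a"] by (auto simp: degen_susp_pt face_susp_pt Suc_diff_le)
  qed simp
next
  fix n i j z
  assume z: "z \<in> simplices (susp K) (Suc n)" and ij: "Suc j < i" "i \<le> Suc (Suc n)"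
  from z show "face (susp K) (Suc (Suc n)) i (degen (susp K) (Suc n) j z) =
     degen (susp K) n j (face (susp K) (Suc n) (i - 1) z)"
  proof (cases rule: susp_cases)
    case (2 m a x)
    show ?thesis
    proof (cases m)
      case 0
      then show ?thesis using 2 ij by (auto simp: degen_susp_pt face_susp_pt)
    next
      case (Suc k)
      then show ?thesis
        using 2 ij face_degen_greater[of x k "j - a" "i - a"] by (auto simp: degen_susp_pt face_susp_pt)
    qed
  qed simp
qed

sublocale S: simplicial_set "susp K"
  by (rule simplicial_set_susp)

text \<open>
  \<open>(i, x)\<close> is \<open>s\<^sub>0\<^sup>i\<^sup>-\<^sup>1 (1, x)\<close>, and every degeneracy of \<open>(1, x)\<close> other than \<open>s\<^sub>0\<close> comes from \<open>x\<close>.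
\<close>
lemma degenerate_susp_pt:
  assumes x: "x \<in> simplices K m" and i: "1 \<le> i"
  shows "degenerate (susp K) (m + i) (susp_pt K m i x) \<longleftrightarrow> 2 \<le> i \<or> degenerate K m x \<or> x = base_simplex K m"
proof
  assume "2 \<le> i \<or> degenerate K m x \<or> x = base_simplex K m"
  then consider "2 \<le> i" | "degenerate K m x" | "x = base_simplex K m" by blast
  then show "degenerate (susp K) (m + i) (susp_pt K m i x)"
  proof cases
    case 1
    then obtain i' where i': "i = Suc i'" "1 \<le> i'" by (cases i) auto
    have "degen (susp K) (m + i') 0 (susp_pt K m i' x) = susp_pt K m i x"
      using i' by (simp add: degen_susp_pt)
    then show ?thesis using degenerateI[of "susp_pt K m i' x" "susp K" "m + i'" 0] x i' by (simp add: susp_pt_in)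
  next
    case 2
    then obtain k j y where m: "m = Suc k" "j \<le> k" "y \<in> simplices K k" "x = degen K k j y"
      by (auto simp: degenerate_def)
    have "degen (susp K) (k + i) (j + i) (susp_pt K k i y) = susp_pt K m i x"
      using m i by (simp add: degen_susp_pt)
    then show ?thesis using degenerateI[of "susp_pt K k i y" "susp K" "k + i" "j + i"] m i by (simp add: susp_pt_in)
  next
    case 3
    then have "susp_pt K m i x = None" by (simp add: susp_pt_def)
    then show ?thesis using i degenerate_None[of K "m + i - 1"] by simp
  qed
next
  assume "degenerate (susp K) (m + i) (susp_pt K m i x)"
  then obtain k j z where k: "m + i = Suc k" "j \<le> k" "z \<in> simplices (susp K) k" "susp_pt K m i x = degen (susp K) k j z"
    by (auto simp: degenerate_def)
  from k(3) show "2 \<le> i \<or> degenerate K m x \<or> x = base_simplex K m"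
  proof (cases rule: susp_cases)
    case 1
    then show ?thesis using k by (auto simp: susp_pt_def split: if_splits)
  next
    case (2 m' i' x')
    show ?thesis
    proof (rule ccontr)
      assume neg: "\<not> ?thesis"
      then have "i = Suc 0" using i by simp
      then have eq: "Some (Suc 0, x) = (if j < i' then susp_pt K m' (Suc i') x' else susp_pt K (Suc m') i' (degen K m' (j - i') x'))"
        using k 2 neg by (simp add: degen_susp_pt) (simp add: susp_pt_def split: if_splits)
      then have "\<not> j < i'" "i' = Suc 0" "x = degen K m' (j - i') x'"
        using 2 by (auto simp: susp_pt_def split: if_splits)
      then show False using neg degenerateI[of x' K m' "j - i'"] 2 k \<open>i = Suc 0\<close> by simp
    qed
  qed
qed

abbreviation suspend :: "nat \<Rightarrow> 'a \<Rightarrow> (nat \<times> 'a) option" where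
  "suspend n x \<equiv> susp_pt K n (Suc 0) x"

lemma nchain_susp_pt:
  "x \<in> simplices K m \<Longrightarrow> nchain (susp K) (Suc m) (suspend m x) =
    (if degenerate K m x \<or> x = base_simplex K m then 0 else frag_of (Suc m, Some (Suc 0, x)))"
  using degenerate_susp_pt[of x m "Suc 0"] by (simp add: nchain_def susp_pt_def)

lemma nchain_susp_None: "nchain (susp K) n None = (if n = 0 then frag_of (0, None) else 0)"
  by (cases n) (simp_all add: nchain_def degenerate_None)

lemma degenerate_base: "degenerate K (Suc n) (base_simplex K (Suc n))"
  using degenerateI[OF base_simplex_in, of 0 n] by simp

text \<open>
  The key to all comparisons: passing to \<open>(1, x)\<close> is compatible with normalization and with dividing out
  the basepoint, for arbitrary simplices \<open>x\<close>.
\<close>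
lemma red_gen_susp:
  assumes "x \<in> simplices K n"
  shows "relabel (map (susp_cell K)) (red_gen K (nchain K n x)) = red_gen (susp K) (nchain (susp K) (Suc n) (suspend n x))"
proof (cases "x = base_simplex K n")
  case True
  have "red_gen K (nchain K n x) = 0"
    unfolding True by (cases n) (simp_all add: nchain_def degenerate_base del: base_simplex.simps(2))
  moreover have "suspend n x = None" by (simp add: susp_pt_def True)
  ultimately show ?thesis by (simp add: nchain_susp_None)
next
  case False
  then show ?thesis
    using assms nchain_susp_pt[OF assms] by (auto simp: nchain_def susp_cell_def susp_pt_def)
qed

lemma red_cells_iff: "(n, x) \<in> red_cells K \<longleftrightarrow> x \<in> simplices K n \<and> \<not> degenerate K n x \<and> x \<noteq> base_simplex K n"
proof -
  have "(n, x) \<noteq> (0, basept K) \<longleftrightarrow> x \<noteq> base_simplex K n" if "\<not> degenerate K n x"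
    using that degenerate_base by (cases n) auto
  then show ?thesis by (auto simp: red_cells_def nondeg_cells_def)
qed

lemma inj_susp_cell: "inj_on (susp_cell K) (red_cells K)"
  by (rule inj_onI) (auto simp: susp_cell_def red_cells_iff susp_pt_def)

lemma red_cells_susp: "red_cells (susp K) = susp_cell K ` red_cells K"
proof
  show "susp_cell K ` red_cells K \<subseteq> red_cells (susp K)"
    using degenerate_susp_pt[of _ _ "Suc 0"] by (auto simp: susp_cell_def red_cells_iff red_cells_def[of "susp K"] nondeg_cells_def susp_pt_in)
  show "red_cells (susp K) \<subseteq> susp_cell K ` red_cells K"
  proof
    fix \<tau> assume \<tau>: "\<tau> \<in> red_cells (susp K)"
    obtain n z where nz: "\<tau> = (n, z)" by (cases \<tau>)
    then have z: "z \<in> simplices (susp K) n" "\<not> degenerate (susp K) n z" "(n, z) \<noteq> (0, None)"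
      using \<tau> by (auto simp: red_cells_def nondeg_cells_def)
    from z(1) show "\<tau> \<in> susp_cell K ` red_cells K"
    proof (cases rule: susp_cases)
      case 1
      then show ?thesis using z degenerate_None by (cases n) auto
    next
      case (2 m i x)
      then have "i = Suc 0" "(m, x) \<in> red_cells K" using z(2) degenerate_susp_pt[of x m i] by (auto simp: red_cells_iff)
      then show ?thesis using 2 nz by (auto simp: susp_cell_def intro!: image_eqI[of _ _ "(m, x)"])
    qed
  qed
qed

lemma red_incl_susp: "red_incl (susp K) (susp_cell K \<sigma>) = frag_of (susp_cell K \<sigma>)"
  by (simp add: red_incl_def susp_cell_def)

lemma susp_cell_nchain:
  assumes "(n, x) \<in> red_cells K"
  shows "frag_of (susp_cell K (n, x)) = nchain (susp K) (Suc n) (suspend n x)"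
  using assms nchain_susp_pt[of x n] by (simp add: susp_cell_def red_cells_iff susp_pt_def)

text \<open>
  Suspended simplices are primitive, because \<open>\<partial>\<^sub>0 (1, x)\<close> is a base simplex and these are degenerate in
  positive dimensions.
\<close>
lemma coprod_susp_pt:
  assumes x: "x \<in> simplices K n"
  shows "coprod (susp K) (nchain (susp K) (Suc n) (suspend n x)) =
    tens (frag_of (0, None)) (nchain (susp K) (Suc n) (suspend n x)) +
    tens (nchain (susp K) (Suc n) (suspend n x)) (frag_of (0, None))"
proof -
  let ?z = "suspend n x"
  have z: "?z \<in> simplices (susp K) (Suc n)" using x by (simp add: susp_pt_in)
  have back_None: "back_face (susp K) (Suc n) (Suc i) ?z = None" for i
    by (simp add: back_Suc face_susp_pt) (simp add: back_face_def)
  have vertex: "front_face (susp K) (Suc n) 0 ?z = None"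
    using S.front_closed[OF z, of 0] by simp
  have "(\<Sum>i\<le>n. tens (nchain (susp K) (Suc i) (front_face (susp K) (Suc n) (Suc i) ?z))
       (nchain (susp K) (Suc n - Suc i) (back_face (susp K) (Suc n) (Suc i) ?z))) =
    (\<Sum>i\<le>n. if i = n then tens (nchain (susp K) (Suc n) ?z) (frag_of (0, None)) else 0)"
    by (intro sum.cong) (auto simp: back_None nchain_susp_None)
  then show ?thesis
    using z by (simp add: S.coprod_nchain sum.atMost_Suc_shift vertex nchain_0 del: sum.atMost_Suc)
qed

text \<open>
  The sign comes from \<open>\<partial>\<^sub>i\<^sub>+\<^sub>1 (1, x) = (1, \<partial>\<^sub>i x)\<close>; it is absorbed by the sign of the linear part of the
  cobar differential.
\<close>
lemma red_gen_bd_susp: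
  assumes x: "x \<in> simplices K n"
  shows "red_gen (susp K) (bd (susp K) (nchain (susp K) (Suc n) (suspend n x))) =
    - relabel (map (susp_cell K)) (red_gen K (bd K (nchain K n x)))"
proof -
  have None: "red_gen (susp K) (nchain (susp K) k None) = 0" for k
    by (simp add: nchain_susp_None)
  have z: "suspend n x \<in> simplices (susp K) (Suc n)" using x by (simp add: susp_pt_in)
  show ?thesis
  proof (cases n)
    case 0
    then show ?thesis using z by (simp add: S.bd_nchain lin face_susp_pt None nchain_0)
  next
    case n: (Suc m)
    have "relabel (map (susp_cell K)) (red_gen K (nchain K m (face K n i x))) =
        red_gen (susp K) (nchain (susp K) n (face (susp K) (Suc n) (Suc i) (suspend n x)))" if "i \<le> n" for i
      using that x red_gen_susp[of "face K n i x" m] by (simp add: n face_susp_pt face_closed)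
    then have "relabel (map (susp_cell K)) (red_gen K (bd K (nchain K n x))) =
      (\<Sum>i\<le>n. frag_cmul ((- 1) ^ i) (red_gen (susp K) (nchain (susp K) n (face (susp K) (Suc n) (Suc i) (suspend n x)))))"
      using x by (simp add: n bd_nchain lin del: sum.atMost_Suc)
    moreover have "red_gen (susp K) (bd (susp K) (nchain (susp K) (Suc n) (suspend n x))) =
      (\<Sum>i\<le>n. frag_cmul (- ((- 1) ^ i)) (red_gen (susp K) (nchain (susp K) n (face (susp K) (Suc n) (Suc i) (suspend n x)))))"
      using z by (simp add: S.bd_nchain lin sum.atMost_Suc_shift face_susp_pt[of "Suc n" n "Suc 0" 0] None del: sum.atMost_Suc)
    ultimately show ?thesis by (simp add: sum_negf flip: minus_frag_cmul del: sum.atMost_Suc minus_frag_cmul)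
  qed
qed

lemma cobar_gen_diff_susp_cell:
  assumes "\<sigma> \<in> red_cells K"
  shows "cobar_gen_diff K (susp_cell K \<sigma>) = relabel (map (susp_cell K)) (chains_gen_diff K \<sigma>)"
proof -
  obtain n x where \<sigma>: "\<sigma> = (n, x)" by (cases \<sigma>)
  then have x: "x \<in> simplices K n" "frag_of \<sigma> = nchain K n x" using assms by (auto simp: red_cells_iff nchain_def)
  have "bd K (red_incl K \<sigma>) = bd K (frag_of \<sigma>)"
    by (cases \<sigma>) (simp add: red_incl_def lin)
  moreover have "red_coprod (susp K) (frag_of (susp_cell K \<sigma>)) = 0"
    using coprod_susp_pt[OF x(1)] susp_cell_nchain[of n x] assms by (simp add: red_coprod_def \<sigma>)
  moreover have "red_gen (susp K) (bd (susp K) (frag_of (susp_cell K \<sigma>))) = - relabel (map (susp_cell K)) (red_gen K (bd K (frag_of \<sigma>)))"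
    using red_gen_bd_susp[OF x(1)] susp_cell_nchain[of n x] assms x(2) by (simp add: \<sigma>)
  ultimately show ?thesis
    by (simp add: cobar_gen_diff_def chains_gen_diff_def red_incl_susp concat_tensor_def)
qed

end

section \<open>Words of simplicial operators\<close>

text \<open>
  \<open>valid_word n w m\<close>: all indices of the word \<open>w\<close> are in range when it is applied to \<open>n\<close>-simplices, and the
  result has dimension \<open>m\<close>. For valid words alone is \<open>act\<close> a composite of the operators of a simplicial set.
\<close>
inductive valid_word :: "nat \<Rightarrow> letter list \<Rightarrow> nat \<Rightarrow> bool" where
  Nil: "valid_word n [] n"
| Deg: "valid_word n w m \<Longrightarrow> i \<le> m \<Longrightarrow> valid_word n (Deg i # w) (Suc m)"
| Fac: "valid_word n w (Suc m) \<Longrightarrow> i \<le> Suc m \<Longrightarrow> valid_word n (Fac i # w) m"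

lemma valid_word_dim: "valid_word n w m \<Longrightarrow> fst (foldr (act_letter X) w (n, x)) = m"
  by (induction rule: valid_word.induct) simp_all

lemma valid_word_foldr: "valid_word n w m \<Longrightarrow> foldr (act_letter X) w (n, x) = (m, act X w n x)"
  using valid_word_dim[of n w m X x] by (simp add: act_def prod_eq_iff)

lemma act_Deg: "valid_word n w m \<Longrightarrow> act X (Deg i # w) n x = degen X m i (act X w n x)"
  by (simp add: act_def[of X "Deg i # w"] valid_word_foldr)

lemma act_Fac: "valid_word n w m \<Longrightarrow> act X (Fac i # w) n x = face X m i (act X w n x)"
  by (simp add: act_def[of X "Fac i # w"] valid_word_foldr)

lemma act_append: "valid_word n v m \<Longrightarrow> act X (w @ v) n x = act X w m (act X v n x)"
  by (simp add: act_def[of X "w @ v"] valid_word_foldr) (simp add: act_def[of X w])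

lemma valid_word_append: "valid_word m w k \<Longrightarrow> valid_word n v m \<Longrightarrow> valid_word n (w @ v) k"
  by (induction rule: valid_word.induct) (auto intro: valid_word.intros)

lemma valid_word_shift: "valid_word n w m \<Longrightarrow> valid_word (Suc n) (map shift_letter w) (Suc m)"
  by (induction rule: valid_word.induct) (auto intro: valid_word.intros)

lemma (in simplicial_set) act_closed: "valid_word n w m \<Longrightarrow> x \<in> simplices X n \<Longrightarrow> act X w n x \<in> simplices X m"
  by (induction rule: valid_word.induct) (auto simp: act_Deg act_Fac degen_closed face_closed)

lemma front_op_same [simp]: "front_op n n = []"
  by (simp add: front_op_def)

lemma front_op_Suc: "i \<le> n \<Longrightarrow> front_op (Suc n) i = front_op n i @ [Fac (Suc n)]"
  by (simp add: front_op_def)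

lemma back_op_0 [simp]: "back_op 0 = []"
  by (simp add: back_op_def)

lemma back_op_Suc: "back_op (Suc i) = back_op i @ [Fac 0]"
  by (simp add: back_op_def replicate_append_same)

lemma valid_front_op: "i \<le> n \<Longrightarrow> valid_word n (front_op n i) i"
proof (induction n)
  case (Suc n)
  then show ?case
    by (cases "i = Suc n") (auto simp: front_op_Suc intro!: valid_word_append[of n] valid_word.intros)
qed (auto intro: valid_word.intros)

lemma valid_back_op: "i \<le> n \<Longrightarrow> valid_word n (back_op i) (n - i)"
proof (induction i arbitrary: n)
  case (Suc i)
  from Suc.prems obtain k where "n = Suc k" by (cases n) auto
  with Suc show ?case
    by (auto simp: back_op_Suc intro!: valid_word_append[of k] valid_word.intros)
qed (auto intro: valid_word.intros)

lemma degen_op_empty [simp]: "degen_op {} = []"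
  by (simp add: degen_op_def)

lemma degen_op_insert:
  assumes "finite A" "\<forall>a\<in>A. a < b"
  shows "degen_op (insert b A) = Deg b # degen_op A"
proof -
  have "sorted_list_of_set (insert b A) = sorted_list_of_set A @ [b]"
  proof -
    have "A - {b} = A" using assms by auto
    then show ?thesis using assms by (simp add: sorted_insort_is_snoc less_imp_le)
  qed
  then show ?thesis by (simp add: degen_op_def)
qed

text \<open>
  The \<open>j\<close>-th smallest index of \<open>\<nu>\<close> acts in dimension \<open>m + j - 1\<close>. As the indices above it are distinct,
  it suffices to bound all of them by the final dimension.
\<close>
lemma valid_degen_op:
  assumes "finite \<nu>" "\<forall>i\<in>\<nu>. i < m + card \<nu>"
  shows "valid_word m (degen_op \<nu>) (m + card \<nu>)"
  using assms
proof (induction rule: finite_linorder_max_induct)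
  case empty
  then show ?case by (simp add: valid_word.intros)
next
  case (insert b A)
  then have "b \<notin> A" "b \<le> m + card A" by auto
  moreover have "\<forall>i\<in>A. i < m + card A" using insert \<open>b \<le> m + card A\<close> by fastforce
  ultimately show ?case
    using insert by (auto simp: degen_op_insert intro: valid_word.intros)
qed

lemma linear_derived_op: "linear_map (derived_op)"
  unfolding derived_op_def by (rule linear_map_frag_extend)

lemmas derived_op_lin [lin] = linear_map_simps[OF linear_derived_op]

lemma linear_comp_s0: "linear_map (comp_s0)"
  unfolding comp_s0_def by (rule linear_map_frag_extend)

lemmas comp_s0_lin [lin] = linear_map_simps[OF linear_comp_s0]

lemma derived_comp_basis [simp]:
  "derived_op (frag_of (u, v)) = frag_of (map shift_letter u, map shift_letter v)"
  "comp_s0 (frag_of (u, v)) = frag_of (u @ [Deg 0], v @ [Deg 0])" "derived_op 0 = 0" "comp_s0 0 = 0"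
  by (simp_all add: derived_op_def comp_s0_def)

definition shuffles :: "nat \<Rightarrow> nat \<Rightarrow> nat set set" where
  "shuffles n p = {\<mu>. \<mu> \<subseteq> {..<n} \<and> card \<mu> = p}"

lemma finite_shuffles [simp]: "finite (shuffles n p)"
  by (simp add: shuffles_def)

lemma shufflesD:
  assumes "\<mu> \<in> shuffles n p"
  shows "\<mu> \<subseteq> {..<n}" "card \<mu> = p" "finite \<mu>" "card ({..<n} - \<mu>) = n - p" "p \<le> n"
  using assms card_mono[of "{..<n}" \<mu>] finite_subset[of \<mu> "{..<n}"]
  by (auto simp: shuffles_def card_Diff_subset)

lemma valid_shuffle:
  assumes "\<mu> \<in> shuffles n p"
  shows "valid_word p (degen_op ({..<n} - \<mu>)) n" "valid_word (n - p) (degen_op \<mu>) n"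
  using valid_degen_op[of "{..<n} - \<mu>" p] valid_degen_op[of \<mu> "n - p"] shufflesD[OF assms] by auto

text \<open>
  A pair of words that both begin with a degeneracy turns every simplex of \<open>X \<times> Y\<close> with one component
  a base simplex into a degenerate one.
\<close>
definition degeneracy_words :: "nat \<Rightarrow> (letter list \<times> letter list) set" where
  "degeneracy_words n = {(u, v). valid_word n u (Suc n) \<and> valid_word n v (Suc n) \<and>
     (\<exists>i u'. u = Deg i # u') \<and> (\<exists>i v'. v = Deg i # v')}"

lemma degen_op_cases: "finite \<nu> \<Longrightarrow> \<nu> = {} \<or> (\<exists>i w. degen_op \<nu> = Deg i # w)"
  by (induction rule: finite_linorder_max_induct) (auto simp: degen_op_insert)

text \<open>
  The two components of the summand of \<open>(\<nabla> f)' s\<^sub>0\<close> indexed by \<open>p\<close> and the shuffle \<open>\<mu>\<close>.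
\<close>
abbreviation ez_left :: "nat \<Rightarrow> nat \<Rightarrow> nat set \<Rightarrow> letter list" where
  "ez_left n p \<mu> \<equiv> map shift_letter (degen_op ({..<n} - \<mu>) @ front_op n p) @ [Deg 0]"

abbreviation ez_right :: "nat \<Rightarrow> nat set \<Rightarrow> letter list" where
  "ez_right p \<mu> \<equiv> map shift_letter (degen_op \<mu> @ back_op p) @ [Deg 0]"

text \<open>
  If there is no degeneracy on one side then there is no face on that side either (\<open>\<mu>\<close> is full, or \<open>p = 0\<close>),
  and the word consists of the final \<open>s\<^sub>0\<close>.
\<close>
lemma ez_word:
  assumes \<mu>: "\<mu> \<in> shuffles n p"
  shows "(ez_left n p \<mu>,
          ez_right p \<mu>) \<in> degeneracy_words n"
proof -
  note s = shufflesD[OF \<mu>]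
  have s0: "valid_word n [Deg 0] (Suc n)" by (auto intro: valid_word.intros)
  have v: "valid_word n (ez_left n p \<mu>) (Suc n)"
    by (rule valid_word_append[OF valid_word_shift s0])
      (rule valid_word_append[OF valid_shuffle(1)[OF \<mu>] valid_front_op[OF s(5)]])
  have v': "valid_word n (ez_right p \<mu>) (Suc n)"
    by (rule valid_word_append[OF valid_word_shift s0])
      (rule valid_word_append[OF valid_shuffle(2)[OF \<mu>] valid_back_op[OF s(5)]])
  have start: "\<exists>i w'. map shift_letter w @ [Deg 0] = Deg i # w'" if "w = [] \<or> (\<exists>i w'. w = Deg i # w')" for w
    using that by auto
  have "degen_op ({..<n} - \<mu>) @ front_op n p = [] \<or> (\<exists>i w. degen_op ({..<n} - \<mu>) @ front_op n p = Deg i # w)"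
  proof (cases "{..<n} - \<mu> = {}")
    case True
    then have "n = p" using s(4,5) by (simp only: card.empty)
    then have "front_op n p = []" by simp
    then show ?thesis by (simp only: True degen_op_empty append_Nil simp_thms)
  next
    case False
    then obtain i w where "degen_op ({..<n} - \<mu>) = Deg i # w"
      using degen_op_cases[of "{..<n} - \<mu>"] by blast
    then show ?thesis by simp
  qed
  moreover have "degen_op \<mu> @ back_op p = [] \<or> (\<exists>i w. degen_op \<mu> @ back_op p = Deg i # w)"
  proof (cases "\<mu> = {}")
    case True
    then show ?thesis using s(2) by simp
  next
    case False
    then obtain i w where "degen_op \<mu> = Deg i # w"
      using degen_op_cases[OF s(3)] by blast
    then show ?thesis by simp
  qed
  ultimately show ?thesis
    using v v' start unfolding degeneracy_words_def by blast
qed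

lemma ez_op_eq: "ez_op n = (\<Sum>p\<le>n. \<Sum>\<mu>\<in>shuffles n p. frag_cmul ((- 1) ^ shuffle_exp \<mu>)
       (frag_of (degen_op ({..<n} - \<mu>) @ front_op n p, degen_op \<mu> @ back_op p)))"
  unfolding ez_op_def shuffles_def ..

lemma phi_op_supp: "supp (phi_op n) \<subseteq> degeneracy_words n"
proof (induction n)
  case (Suc n)
  have "supp (derived_op (phi_op n)) \<subseteq> degeneracy_words (Suc n)"
    unfolding derived_op_def
    by (rule keys_frag_extend_subset[OF Suc]) (auto simp: degeneracy_words_def dest: valid_word_shift)
  moreover have "supp (comp_s0 (derived_op (ez_op (Suc n)))) \<subseteq> degeneracy_words (Suc n)"
    unfolding ez_op_eq lin derived_comp_basis
    by (intro supp_sum order_trans[OF keys_cmul]) (use ez_word in simp)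
  ultimately show ?case
    using keys_diff[of "comp_s0 (derived_op (ez_op (Suc n)))" "derived_op (phi_op n)"] by simp blast
qed simp

lemma prod_sset_sel [simp]:
  "simplices (prod_sset X Y) n = simplices X n \<times> simplices Y n"
  "face (prod_sset X Y) n i (x, y) = (face X n i x, face Y n i y)"
  "degen (prod_sset X Y) n i (x, y) = (degen X n i x, degen Y n i y)"
  by (simp_all add: prod_sset_def)

lemma simplicial_set_prod:
  assumes "simplicial_set X" "simplicial_set Y"
  shows "simplicial_set (prod_sset X Y)"
proof -
  interpret X: simplicial_set X by fact
  interpret Y: simplicial_set Y by fact
  show ?thesis
    by unfold_locales
      (auto simp: X.face_closed Y.face_closed X.degen_closed Y.degen_closed X.face_face Y.face_face
        X.degen_degen Y.degen_degen X.face_degen_less Y.face_degen_less X.face_degen_same Y.face_degen_same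
        X.face_degen_greater Y.face_degen_greater)
qed

lemma act_prod: "valid_word n w m \<Longrightarrow> act (prod_sset X Y) w n (x, y) = (act X w n x, act Y w n y)"
  by (induction rule: valid_word.induct) (simp_all add: act_Deg act_Fac)

lemma front_face_prod: "i \<le> n \<Longrightarrow> front_face (prod_sset X Y) n i (x, y) = (front_face X n i x, front_face Y n i y)"
  unfolding front_face_def by (rule act_prod[OF valid_front_op])

lemma back_face_prod: "i \<le> n \<Longrightarrow> back_face (prod_sset X Y) n i (x, y) = (back_face X n i x, back_face Y n i y)"
  unfolding back_face_def by (rule act_prod[OF valid_back_op])

section \<open>The maps of the extended cobar diagonal\<close>

lemma linear_phi: "linear_map (phi X Y)"
  unfolding phi_def by (rule linear_map_frag_extend)

lemmas phi_lin [lin] = linear_map_simps[OF linear_phi]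

lemma linear_aw: "linear_map (aw X Y)"
  unfolding aw_def by (rule linear_map_frag_extend)

lemmas aw_lin [lin] = linear_map_simps[OF linear_aw]

lemma linear_concat_tensor: "linear_map (concat_tensor)"
  unfolding concat_tensor_def by (rule linear_map_frag_extend)

lemmas concat_tensor_lin [lin] = linear_map_simps[OF linear_concat_tensor]

lemma concat_tensor_basis [simp]: "concat_tensor (frag_of (u, v)) = frag_of (u @ v)" "concat_tensor 0 = 0"
  by (simp_all add: concat_tensor_def)

lemma aw_phi_0 [simp]: "aw X Y 0 = 0" "phi X Y 0 = 0"
  by (simp_all add: aw_def phi_def)

text \<open>
  The recursion for the maps \<open>F\<^sub>k\<close> without the sign and the homotopy: \<open>F\<^sub>k\<^sub>+\<^sub>2 = - szF_step k \<circ> \<phi>\<close>.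
\<close>
definition szF_step :: "'a pointed_sset \<Rightarrow> nat \<Rightarrow> (('a \<times> 'a) cell \<Rightarrow>\<^sub>0 int) \<Rightarrow> ('a cell \<times> 'a cell) list \<Rightarrow>\<^sub>0 int" where
  "szF_step X k c = (\<Sum>i\<in>{1..Suc k}. concat_tensor (tensor_map cdeg (- 1) (szF X i) (szF X (Suc (Suc k) - i))
       (coprod (prod_sset X X) c)))"

lemma szF_Suc_Suc: "szF X (Suc (Suc k)) c = - szF_step X k (phi X X c)"
  by (simp add: szF_step_def)

lemma linear_szF_step: "linear_map (szF_step X k)"
  by (rule linear_mapI) (simp add: szF_step_def lin sum_subtractf)

lemmas szF_step_lin [lin] = linear_map_simps[OF linear_szF_step]

lemma linear_szF: "linear_map (szF X k)"
  by (cases "(X, k)" rule: szF.cases) (auto simp: lin szF_Suc_Suc simp del: szF.simps(3))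

lemma szF_0_arg [simp]: "szF X k 0 = 0"
  by (rule linear_map_0[OF linear_szF])

abbreviation pair_deg :: "'a cell \<times> 'a cell \<Rightarrow> int" where
  "pair_deg p \<equiv> cdeg (fst p) + cdeg (snd p) - 1"

lemma homogeneous_concat_tensor:
  assumes "homogeneous (\<lambda>(u, v). word_deg deg u + word_deg deg v) n a"
  shows "homogeneous (word_deg deg) n (concat_tensor a)"
  unfolding concat_tensor_def by (rule homogeneous_frag_extend[OF assms]) auto

lemma homogeneous_phi:
  assumes "homogeneous cdeg n a"
  shows "homogeneous cdeg (n + 1) (phi X Y a)"
  unfolding phi_def
proof (rule homogeneous_frag_extend[OF assms])
  fix \<sigma> :: "('a \<times> 'b) cell" assume \<sigma>: "cdeg \<sigma> = n"
  obtain k x y where kxy: "\<sigma> = (k, x, y)" by (cases \<sigma>) auto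
  show "homogeneous cdeg (n + 1) (case \<sigma> of (n, x, y) \<Rightarrow> frag_extend (\<lambda>(u, v). nchain (prod_sset X Y) (Suc n) (act X u n x, act Y v n y)) (phi_op n))"
    using \<sigma> nchain_homogeneous[of "Suc k" "prod_sset X Y"]
    by (auto simp: kxy add.commute intro!: homogeneous_frag_extend[where deg = "\<lambda>_. 0" and n = 0] simp: homogeneous_def[of "\<lambda>_. 0"] split: prod.splits)
qed

lemma homogeneous_aw:
  assumes "homogeneous cdeg n a"
  shows "homogeneous (\<lambda>(\<sigma>, \<tau>). cdeg \<sigma> + cdeg \<tau>) n (aw X Y a)"
  unfolding aw_def
proof (rule homogeneous_frag_extend[OF assms])
  fix \<sigma> :: "('a \<times> 'b) cell" assume \<sigma>: "cdeg \<sigma> = n"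
  obtain k x y where kx: "\<sigma> = (k, x, y)" by (cases \<sigma>) auto
  have "homogeneous (\<lambda>(\<sigma>, \<tau>). cdeg \<sigma> + cdeg \<tau>) (int k) (tens (nchain X i u) (nchain Y (k - i) v))"
    if "i \<le> k" for i u v
    using homogeneous_tens[OF nchain_homogeneous[of i X u] nchain_homogeneous[of "k - i" Y v]] that
    by (simp add: of_nat_diff)
  then show "homogeneous (\<lambda>(\<sigma>, \<tau>). cdeg \<sigma> + cdeg \<tau>) n (case \<sigma> of (n, x, y) \<Rightarrow> \<Sum>i\<le>n.
     tens (nchain X i (act X (front_op n i) n x)) (nchain Y (n - i) (act Y (back_op i) n y)))"
    using \<sigma> by (auto simp: kx intro!: homogeneous_sum)
qed

lemma homogeneous_tensor_map:
  assumes "homogeneous (\<lambda>(u, v). deg u + deg v) n a"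
    "\<And>u. homogeneous deg' (deg u - 1) (f (frag_of u))" "\<And>u. homogeneous deg' (deg u - 1) (g (frag_of u))"
  shows "homogeneous (\<lambda>(u, v). deg' u + deg' v) (n - 2) (tensor_map d q f g a)"
  unfolding tensor_map_def
proof (rule homogeneous_frag_extend[OF assms(1)])
  fix p assume p: "(case p of (u, v) \<Rightarrow> deg u + deg v) = n"
  obtain x y where xy: "p = (x, y)" by (cases p)
  have "deg x - 1 + (deg y - 1) = n - 2" using p xy by simp
  then show "homogeneous (\<lambda>(u, v). deg' u + deg' v) (n - 2)
      (case p of (x, y) \<Rightarrow> frag_cmul (ksign (q * d x)) (tens (f (frag_of x)) (g (frag_of y))))"
    using homogeneous_tens[OF assms(2)[of x] assms(3)[of y]] by (simp add: xy homogeneous_lin)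
qed

text \<open>
  \<open>F\<^sub>k\<close> has degree \<open>-1\<close>: the homotopy raises the degree by one and the two factors lower it by one each.
\<close>
lemma homogeneous_szF: "homogeneous cdeg n c \<Longrightarrow> homogeneous (word_deg pair_deg) (n - 1) (szF X k c)"
proof (induction k arbitrary: c n rule: less_induct)
  case (less k)
  consider "k = 0" | "k = 1" | j where "k = Suc (Suc j)"
    by (metis One_nat_def not0_implies_Suc)
  then show ?case
  proof cases
    case 2
    have "homogeneous (word_deg pair_deg) (n - 1) (frag_extend (\<lambda>(\<sigma>, \<tau>). if fst \<sigma> + fst \<tau> = 0 then 0 else frag_of [(\<sigma>, \<tau>)]) (aw X X c))"
      by (rule homogeneous_frag_extend[OF homogeneous_aw[OF less.prems]]) auto
    then show ?thesis using 2 by simp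
  next
    case (3 j)
    have "homogeneous (word_deg pair_deg) (n - 1)
      (concat_tensor (tensor_map cdeg (- 1) (szF X i) (szF X (Suc (Suc j) - i)) (coprod (prod_sset X X) (phi X X c))))"
      if "i \<in> {1..Suc j}" for i
    proof -
      have "homogeneous (\<lambda>(u, v). word_deg pair_deg u + word_deg pair_deg v) (n + 1 - 2)
        (tensor_map cdeg (- 1) (szF X i) (szF X (Suc (Suc j) - i)) (coprod (prod_sset X X) (phi X X c)))"
        using that 3
        by (intro homogeneous_tensor_map[where deg = cdeg] homogeneous_coprod homogeneous_phi less) auto
      then show ?thesis by (intro homogeneous_concat_tensor) simp
    qed
    then show ?thesis
      unfolding 3 szF.simps by (intro homogeneous_lin homogeneous_sum)
  qed simp
qed

lemma homogeneous_chain_map: "homogeneous cdeg n c \<Longrightarrow> homogeneous cdeg n (chain_map Y g c)"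
  unfolding chain_map_def
  by (erule homogeneous_frag_extend) (auto simp: nchain_homogeneous)

lemma homogeneous_Sum_any:
  "(\<And>i. homogeneous deg n (h i)) \<Longrightarrow> homogeneous deg n (Sum_any h)"
  unfolding Sum_any.expand_set by (rule homogeneous_sum)

lemma milgram_hom:
  "graded_alg_hom (word_galg UNIV pair_deg) (tensor_galg (cobar_alg X) (cobar_alg X)) (milgram X)"
proof -
  interpret W: graded_alg "cobar_alg X" unfolding cobar_alg_def by (rule word_graded_alg)
  interpret P: graded_alg_pair "cobar_alg X" "cobar_alg X" ..
  show ?thesis
    unfolding milgram_def
    by (rule graded_alg_hom_alg_ext[OF P.graded_alg_tensor])
      (auto simp: tensor_galg_sel cobar_alg_def bar_deg_def split: prod.splits)
qed

text \<open>
  An argument by degrees alone. It covers every label, as \<open>hopf_relabelling\<close> demands.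
\<close>
lemma homogeneous_xi:
  "homogeneous (\<lambda>(u, v). word_deg bar_deg u + word_deg bar_deg v) (bar_deg \<tau>) (xi X (frag_of \<tau>))"
proof -
  interpret graded_alg_hom "word_galg UNIV pair_deg" "tensor_galg (cobar_alg X) (cobar_alg X)" "milgram X"
    by (rule milgram_hom)
  have "homogeneous (word_deg pair_deg) (cdeg \<tau> - 1)
    (Sum_any (\<lambda>k. szF X k (chain_map (prod_sset X X) (\<lambda>n x. (x, x)) (frag_of \<tau>))))"
    by (intro homogeneous_Sum_any homogeneous_szF homogeneous_chain_map) simp
  then have "homogeneous (hdeg (tensor_galg (cobar_alg X) (cobar_alg X))) (cdeg \<tau> - 1) (xi X (frag_of \<tau>))"
    unfolding xi_def by (intro hom_homogeneous) simp
  then show ?thesis by (simp add: tensor_galg_sel cobar_alg_def bar_deg_def)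
qed

lemma homogeneous_red_gen_bar: "homogeneous cdeg n a \<Longrightarrow> homogeneous (word_deg bar_deg) (n - 1) (red_gen K a)"
  unfolding red_gen_def by (rule homogeneous_frag_extend) (auto simp: bar_deg_def)

lemma word_derivation_susp: "word_derivation bar_deg (cobar_gen_diff K)"
proof
  fix \<tau> :: "(nat \<times> 'a) option cell"
  let ?X = "susp K"
  note r = homogeneous_red_incl[of \<tau> ?X]
  have b: "homogeneous cdeg 0 (frag_of (0, basept ?X))" by simp
  have "homogeneous (\<lambda>(\<sigma>, \<tau>). cdeg \<sigma> + cdeg \<tau>) (cdeg \<tau>) (red_coprod ?X (red_incl ?X \<tau>))"
    unfolding red_coprod_def
    using homogeneous_tens[OF r b] homogeneous_tens[OF b r] homogeneous_coprod[OF r]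
    by (intro homogeneous_lin(1,2)) simp_all
  then have "homogeneous (word_deg bar_deg) (cdeg \<tau> - 2)
     (concat_tensor (tensor_map cdeg (- 1) (red_gen ?X) (red_gen ?X) (red_coprod ?X (red_incl ?X \<tau>))))"
    by (intro homogeneous_concat_tensor homogeneous_tensor_map[where deg = cdeg] homogeneous_red_gen_bar) simp_all
  moreover have "homogeneous (word_deg bar_deg) (cdeg \<tau> - 1 - 1) (red_gen ?X (bd ?X (red_incl ?X \<tau>)))"
    by (intro homogeneous_red_gen_bar homogeneous_bd r)
  ultimately show "homogeneous (word_deg bar_deg) (bar_deg \<tau> - 1) (cobar_gen_diff K \<tau>)"
    unfolding cobar_gen_diff_def by (simp add: homogeneous_lin bar_deg_def)
qed

context based_sset
begin
abbreviation EK where "EK \<equiv> susp K"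
abbreviation EK2 where "EK2 \<equiv> prod_sset EK EK"

sublocale P: simplicial_set EK2
  by (rule simplicial_set_prod) (rule S.simplicial_set_axioms)+

lemma susp_front_back_None [simp]:
  "front_face EK n i None = None" "back_face EK n i None = None"
  by (simp_all add: front_face_def back_face_def)

text \<open>
  In both components the outermost operator is a degeneracy. Where the component is a base simplex
  the index can be chosen freely, so the pair is degenerate.
\<close>
lemma phi_None:
  assumes "x \<in> simplices EK n"
  shows "phi EK EK (frag_of (n, (x, None))) = 0" "phi EK EK (frag_of (n, (None, x))) = 0"
proof -
  have d: "nchain EK2 (Suc n) (act EK u n x, None) = 0 \<and> nchain EK2 (Suc n) (None, act EK u n x) = 0"
    if u: "u = Deg i # u'" "valid_word n u (Suc n)" for u i u'
  proof -
    have u': "valid_word n u' n" "i \<le> n" using u by (auto elim: valid_word.cases)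
    have "act EK u' n x \<in> simplices EK n" by (rule S.act_closed[OF u'(1) assms])
    then show ?thesis
      using nchain_degen[of "(act EK u' n x, None)" EK2 n i] nchain_degen[of "(None, act EK u' n x)" EK2 n i] u' u(1)
      by (simp add: act_Deg)
  qed
  have "nchain EK2 (Suc n) (act EK u n x, act EK v n None) = 0" "nchain EK2 (Suc n) (act EK u n None, act EK v n x) = 0"
    if "(u, v) \<in> degeneracy_words n" for u v
    using that d by (auto simp: degeneracy_words_def)
  then show "phi EK EK (frag_of (n, (x, None))) = 0" "phi EK EK (frag_of (n, (None, x))) = 0"
    using phi_op_supp[of n] by (auto simp: phi_def intro!: frag_extend_eq_0)
qed

lemma phi_nchain_None:
  assumes "x \<in> simplices EK n"
  shows "phi EK EK (nchain EK2 n (x, None)) = 0" "phi EK EK (nchain EK2 n (None, x)) = 0"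
  using phi_None[OF assms] by (simp_all add: nchain_def)

lemma szF_None:
  assumes "x \<in> simplices EK n" "2 \<le> k"
  shows "szF EK k (nchain EK2 n (x, None)) = 0" "szF EK k (nchain EK2 n (None, x)) = 0"
proof -
  obtain j where "k = Suc (Suc j)" using assms(2) by (metis Suc_le_D numeral_2_eq_2 Suc_le_mono)
  then show "szF EK k (nchain EK2 n (x, None)) = 0" "szF EK k (nchain EK2 n (None, x)) = 0"
    by (simp_all add: szF_Suc_Suc phi_nchain_None[OF assms(1)] lin del: szF.simps(3))
qed

lemma degenerate_pair_None:
  assumes "x \<in> simplices EK n"
  shows "degenerate EK2 n (x, None) \<longleftrightarrow> degenerate EK n x" "degenerate EK2 n (None, x) \<longleftrightarrow> degenerate EK n x"
proof -
  have "degenerate EK n x" if "degenerate EK2 n (x, None) \<or> degenerate EK2 n (None, x)"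
    using that by (auto simp: degenerate_def)
  moreover have "degenerate EK2 n (x, None) \<and> degenerate EK2 n (None, x)" if d: "degenerate EK n x"
  proof -
    obtain m i y where y: "n = Suc m" "i \<le> m" "y \<in> simplices EK m" "x = degen EK m i y"
      using d unfolding degenerate_def by blast
    then show ?thesis
      using degenerateI[of "(y, None)" EK2 m i] degenerateI[of "(None, y)" EK2 m i] by simp
  qed
  ultimately show "degenerate EK2 n (x, None) \<longleftrightarrow> degenerate EK n x" "degenerate EK2 n (None, x) \<longleftrightarrow> degenerate EK n x"
    by blast+
qed

lemma szF_vertex [simp]: "szF EK k (frag_of (0, (None, None))) = 0"
proof -
  have ph: "phi EK EK (frag_of (0, (None, None))) = 0" by (simp add: phi_def)
  consider "k = 0" | "k = 1" | j where "k = Suc (Suc j)"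
    by (metis One_nat_def not0_implies_Suc)
  then show ?thesis
  proof cases
    case 2
    then show ?thesis by (simp add: aw_def nchain_0)
  next
    case (3 j)
    then show ?thesis by (simp add: szF_Suc_Suc ph lin del: szF.simps(3))
  qed simp
qed

lemma nchain_None_None: "nchain EK2 n (None, None) = (if n = 0 then frag_of (0, (None, None)) else 0)"
proof (cases n)
  case (Suc m)
  then show ?thesis using nchain_degen[of "(None, None)" EK2 m 0] by simp
qed (simp add: nchain_0)

lemma szF_1_None:
  assumes x: "x \<in> simplices EK n" and "n > 0"
  shows "szF EK 1 (nchain EK2 n (x, None)) = relabel (\<lambda>\<sigma>. [(\<sigma>, (0, None))]) (nchain EK n x)"
    "szF EK 1 (nchain EK2 n (None, x)) = relabel (\<lambda>\<sigma>. [((0, None), \<sigma>)]) (nchain EK n x)"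
proof -
  have n: "nchain EK m None = (if m = 0 then frag_of (0, None) else 0)" for m
    by (rule nchain_susp_None)
  have "aw EK EK (frag_of (n, (x, None))) = tens (nchain EK n x) (frag_of (0, None))"
  proof -
    have "aw EK EK (frag_of (n, (x, None))) = (\<Sum>i\<le>n. if i = n then tens (nchain EK n x) (frag_of (0, None)) else 0)"
      unfolding aw_def frag_extend_of prod.case front_face_def[symmetric] back_face_def[symmetric]
      by (intro sum.cong) (auto simp: n)
    then show ?thesis by simp
  qed
  then show "szF EK 1 (nchain EK2 n (x, None)) = relabel (\<lambda>\<sigma>. [(\<sigma>, (0, None))]) (nchain EK n x)"
    using \<open>n > 0\<close> by (simp add: nchain_def degenerate_pair_None[OF x])
  have "aw EK EK (frag_of (n, (None, x))) = tens (frag_of (0, None)) (nchain EK n x)"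
  proof -
    have "aw EK EK (frag_of (n, (None, x))) = (\<Sum>i\<le>n. if i = 0 then tens (frag_of (0, None)) (nchain EK n x) else 0)"
      unfolding aw_def frag_extend_of prod.case front_face_def[symmetric] back_face_def[symmetric]
      by (intro sum.cong) (auto simp: n)
    then show ?thesis by simp
  qed
  then show "szF EK 1 (nchain EK2 n (None, x)) = relabel (\<lambda>\<sigma>. [((0, None), \<sigma>)]) (nchain EK n x)"
    using \<open>n > 0\<close> by (simp add: nchain_def degenerate_pair_None[OF x])
qed

lemma front_susp_pt: "i \<le> n \<Longrightarrow> front_face EK (Suc n) (Suc i) (suspend n b) = suspend i (front_face K n i b)"
proof (induction n arbitrary: b)
  case (Suc n)
  then show ?case by (cases "i = Suc n") (simp_all add: front_Suc face_susp_pt)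
qed simp

lemma front_susp_pt_None: "1 \<le> a \<Longrightarrow> i < a \<Longrightarrow> front_face EK (m + a) i (susp_pt K m a u) = None"
proof (induction m arbitrary: u)
  case 0
  then obtain a' where "a = Suc a'" by (cases a) auto
  with 0 show ?case by (simp add: front_Suc face_susp_pt)
next
  case (Suc m)
  then show ?case by (simp add: front_Suc face_susp_pt)
qed

lemma back_susp_pt: "1 \<le> a \<Longrightarrow> i \<le> m + a \<Longrightarrow>
    back_face EK (m + a) i (susp_pt K m a u) = (if i < a then susp_pt K m (a - i) u else None)"
proof (induction i arbitrary: a)
  case (Suc i)
  then obtain a' where a: "a = Suc a'" by (cases a) auto
  have "back_face EK (m + a) (Suc i) (susp_pt K m a u) = back_face EK (m + a') i (if a' = 0 then None else susp_pt K m a' u)"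
    by (simp add: a back_Suc face_susp_pt)
  then show ?case using Suc a by (cases "a' = 0") simp_all
qed simp

text \<open>
  The coproduct of \<open>(A, (1, b))\<close>: cuts at the ends leave a vertex of \<open>EK \<times> EK\<close>, on which every \<open>F\<^sub>i\<close>
  vanishes, and in the other cuts the right component of the back face is a base simplex.
\<close>
lemma szF_step_cut:
  assumes A: "A \<in> simplices EK (Suc N)" and b: "b \<in> simplices K N"
  shows "szF_step EK k (nchain EK2 (Suc N) (A, suspend N b)) =
    (\<Sum>i\<in>{1..Suc k}. \<Sum>j<N. frag_cmul (ksign (int (Suc j))) (concat_tensor (tens
      (szF EK i (nchain EK2 (Suc j) (front_face EK (Suc N) (Suc j) A, suspend j (front_face K N j b))))
      (szF EK (Suc (Suc k) - i) (nchain EK2 (N - j) (back_face EK (Suc N) (Suc j) A, None))))))"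
proof -
  let ?B = "suspend N b"
  have B: "?B \<in> simplices EK (Suc N)" using b by (simp add: susp_pt_in)
  have vertex: "front_face EK (Suc N) 0 A = None" "front_face EK (Suc N) 0 ?B = None" "back_face EK (Suc N) (Suc N) A = None"
    using S.front_closed[OF A, of 0] S.front_closed[OF B, of 0] S.back_closed[OF A, of "Suc N"] by simp_all
  have back_B: "back_face EK (Suc N) (Suc j) ?B = None" if "j \<le> N" for j
    using back_susp_pt[of "Suc 0" "Suc j" N b] that by simp
  let ?t = "\<lambda>j. tens (nchain EK2 (Suc j) (front_face EK (Suc N) (Suc j) A, suspend j (front_face K N j b)))
      (nchain EK2 (N - j) (back_face EK (Suc N) (Suc j) A, None))"
  have "coprod EK2 (nchain EK2 (Suc N) (A, ?B)) =
    (\<Sum>i\<le>Suc N. tens (nchain EK2 i (front_face EK (Suc N) i A, front_face EK (Suc N) i ?B))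
       (nchain EK2 (Suc N - i) (back_face EK (Suc N) i A, back_face EK (Suc N) i ?B)))"
    using A B by (subst P.coprod_nchain) (auto simp: front_face_prod back_face_prod intro!: sum.cong)
  also have "\<dots> = tens (frag_of (0, (None, None))) (nchain EK2 (Suc N) (A, ?B)) + (\<Sum>j\<le>N. ?t j)"
    by (simp add: sum.atMost_Suc_shift vertex nchain_0 back_B front_susp_pt del: sum.atMost_Suc)
  also have "(\<Sum>j\<le>N. ?t j) = (\<Sum>j<N. ?t j) + tens (nchain EK2 (Suc N) (A, ?B)) (frag_of (0, (None, None)))"
    by (simp add: vertex nchain_0 flip: lessThan_Suc_atMost)
  finally have c: "coprod EK2 (nchain EK2 (Suc N) (A, ?B)) = tens (frag_of (0, (None, None))) (nchain EK2 (Suc N) (A, ?B))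
    + ((\<Sum>j<N. ?t j) + tens (nchain EK2 (Suc N) (A, ?B)) (frag_of (0, (None, None))))" .
  show ?thesis
    unfolding szF_step_def c
    by (rule sum.cong[OF refl]) (simp add: tensor_map_lin concat_tensor_lin tensor_map_tens[OF linear_szF linear_szF nchain_homogeneous]
       tensor_map_tens[OF linear_szF linear_szF, of cdeg 0 "frag_of (0, (None, None))"] ksign_diff ksign_add del: szF.simps)
qed

end

section \<open>The extended cobar diagonal of a suspension\<close>

lemma shuffle_exp_interval: "shuffle_exp {q..<q + p} = p * q"
  by (simp add: shuffle_exp_def)

lemma linear_milgram: "linear_map (milgram X)"
  unfolding milgram_def by (rule linear_alg_ext)

lemmas milgram_lin [lin] = linear_map_simps[OF linear_milgram]

lemma milgram_0 [simp]: "milgram X 0 = 0"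
  by (simp add: milgram_def)

lemma milgram_generators:
  assumes "fst \<sigma> > 0"
  shows "milgram X (frag_of [((0, basept X), \<sigma>)]) = frag_of ([], [\<sigma>])"
    "milgram X (frag_of [(\<sigma>, (0, basept X))]) = frag_of ([\<sigma>], [])"
  using assms by (auto simp: milgram_def tensor_galg_sel cobar_alg_def)

text \<open>
  The Milgram map interchanges the two words, which produces the sign and the order of the factors.
\<close>
lemma milgram_product:
  assumes "homogeneous cdeg (int (Suc q)) c" "homogeneous cdeg (int (Suc p)) c'"
  shows "milgram X (concat_tensor (tens (relabel (\<lambda>\<tau>. [((0, basept X), \<tau>)]) c) (relabel (\<lambda>\<sigma>. [(\<sigma>, (0, basept X))]) c'))) =
    frag_cmul (ksign (int (q * p))) (tens (red_gen X c') (red_gen X c))"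
  using assms(1)
proof (induction rule: homogeneous_induct)
  case (of \<tau>)
  from assms(2) show ?case
  proof (induction rule: homogeneous_induct)
    case (of \<sigma>)
    have \<sigma>\<tau>: "\<tau> \<noteq> (0, basept X)" "\<sigma> \<noteq> (0, basept X)" using of \<open>cdeg \<tau> = int (Suc q)\<close> by auto
    have "cdeg \<tau> - 1 = int q" "cdeg \<sigma> - 1 = int p" using of \<open>cdeg \<tau> = int (Suc q)\<close> by auto
    then show ?case
      using \<sigma>\<tau> by (simp add: milgram_def tensor_galg_sel cobar_alg_def bar_deg_def)
  qed (simp_all add: lin)
qed (simp_all add: lin)

text \<open>
  The contribution of the shuffle \<open>\<mu> = {n - p, \<dots>, n}\<close>, up to sign. The factor from the back face
  of \<open>x\<close> comes first.
\<close>
definition shuffle_term :: "'a pointed_sset \<Rightarrow> nat \<Rightarrow> 'a \<Rightarrow> nat \<Rightarrow> ((nat \<times> 'a) option cell \<times> (nat \<times> 'a) option cell) list \<Rightarrow>\<^sub>0 int" where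
  "shuffle_term K n x p = concat_tensor (tens
      (relabel (\<lambda>\<tau>. [((0, None), \<tau>)]) (nchain (susp K) (Suc (n - p)) (susp_pt K (n - p) (Suc 0) (back_face K n p x))))
      (relabel (\<lambda>\<sigma>. [(\<sigma>, (0, None))]) (nchain (susp K) (Suc p) (susp_pt K p (Suc 0) (front_face K n p x)))))"

context based_sset
begin
lemma nchain_None_None': "0 < n \<Longrightarrow> nchain EK2 n (None, None) = 0"
  by (simp add: nchain_None_None)

text \<open>
  The derived summands of the homotopy contribute nothing, because the back faces of \<open>((1, a), (1, b))\<close>
  are base simplices in both components.
\<close>
lemma szF_step_susp_pair:
  assumes "a \<in> simplices K N" "b \<in> simplices K N"
  shows "szF_step EK k (nchain EK2 (Suc N) (suspend N a, suspend N b)) = 0"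
proof -
  have "back_face EK (Suc N) (Suc j) (suspend N a) = None" if "j < N" for j
    using back_susp_pt[of "Suc 0" "Suc j" N a] that by simp
  then show ?thesis
    by (subst szF_step_cut) (use assms in \<open>auto simp: susp_pt_in nchain_None_None' szF_0_arg intro!: sum.neutral\<close>)
qed

lemma nchain_pair_zero:
  assumes "u \<in> simplices K m" "1 \<le> a" "2 \<le> a \<or> degenerate K m u" "n = m + a"
  shows "nchain EK2 n (susp_pt K m a u, None) = 0"
  using assms degenerate_susp_pt[OF assms(1,2)] degenerate_pair_None[OF susp_pt_in[OF assms(1,2,4)]]
  by (auto simp: nchain_def)

text \<open>
  A back face of \<open>(a, u)\<close> is a base simplex or some \<open>(i, u)\<close>, hence degenerate as soon as \<open>u\<close> is.
\<close>
lemma szF_step_degenerate: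
  assumes "u \<in> simplices K m" "1 \<le> a" "degenerate K m u" "Suc N = m + a" "b \<in> simplices K N"
  shows "szF_step EK k (nchain EK2 (Suc N) (susp_pt K m a u, suspend N b)) = 0"
proof -
  have "nchain EK2 (N - j) (back_face EK (Suc N) (Suc j) (susp_pt K m a u), None) = 0" if "j < N" for j
  proof (cases "Suc j < a")
    case True
    then have "back_face EK (Suc N) (Suc j) (susp_pt K m a u) = susp_pt K m (a - Suc j) u"
      using back_susp_pt[of a "Suc j" m u] assms that by simp
    moreover have "nchain EK2 (N - j) (susp_pt K m (a - Suc j) u, None) = 0"
      using assms True by (intro nchain_pair_zero) auto
    ultimately show ?thesis by simp
  next
    case False
    then have "back_face EK (Suc N) (Suc j) (susp_pt K m a u) = None"
      using back_susp_pt[of a "Suc j" m u] assms that by simp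
    then show ?thesis using that by (simp add: nchain_None_None')
  qed
  then show ?thesis
    by (subst szF_step_cut) (use assms in \<open>auto simp: susp_pt_in szF_0_arg intro!: sum.neutral\<close>)
qed

text \<open>
  The only cut that survives is the one at \<open>q + 1\<close>, which shortens \<open>(q + 2, u)\<close> to \<open>(1, u)\<close> in the back
  factor; in the front factor it leaves a base simplex on the left. Both factors then have a component that is
  a base simplex, which leaves only \<open>F\<^sub>1\<close> on either side, that is \<open>k = 0\<close>.
\<close>
lemma szF_step_shuffle:
  assumes "u \<in> simplices K m" "N = m + Suc q" "b \<in> simplices K N"
  shows "szF_step EK k (nchain EK2 (Suc N) (susp_pt K m (q + 2) u, suspend N b)) =
    (if k = 0 then frag_cmul (ksign (int (Suc q))) (concat_tensor (tens
      (relabel (\<lambda>\<tau>. [((0, None), \<tau>)]) (nchain EK (Suc q) (suspend q (front_face K N q b))))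
      (relabel (\<lambda>\<sigma>. [(\<sigma>, (0, None))]) (nchain EK (Suc m) (suspend m u))))) else 0)"
proof -
  let ?A = "susp_pt K m (q + 2) u"
  have N: "Suc N = m + (q + 2)" using assms by simp
  have A: "?A \<in> simplices EK (Suc N)" using assms N by (simp add: susp_pt_in)
  have b': "front_face K N q b \<in> simplices K q" using assms by (intro front_closed) simp_all
  have zero: "nchain EK2 (N - j) (back_face EK (Suc N) (Suc j) ?A, None) = 0" if "j < N" "j \<noteq> q" for j
  proof (cases "j < q")
    case True
    then have "back_face EK (Suc N) (Suc j) ?A = susp_pt K m (q + 2 - Suc j) u"
      using back_susp_pt[of "q + 2" "Suc j" m u] N by simp
    moreover have "nchain EK2 (N - j) (susp_pt K m (q + 2 - Suc j) u, None) = 0"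
      using assms True by (intro nchain_pair_zero) auto
    ultimately show ?thesis by simp
  next
    case False
    then have "back_face EK (Suc N) (Suc j) ?A = None"
      using back_susp_pt[of "q + 2" "Suc j" m u] N that by simp
    then show ?thesis using that by (simp add: nchain_None_None')
  qed
  have back_q: "back_face EK (Suc N) (Suc q) ?A = suspend m u"
    using back_susp_pt[of "q + 2" "Suc q" m u] N by simp
  have Nq: "N - q = Suc m" using assms by simp
  have front_q: "front_face EK (Suc N) (Suc q) ?A = None"
    using front_susp_pt_None[of "q + 2" "Suc q" m u] N by simp
  let ?s = "\<lambda>i j. frag_cmul (ksign (int (Suc j))) (concat_tensor (tens
      (szF EK i (nchain EK2 (Suc j) (front_face EK (Suc N) (Suc j) ?A, suspend j (front_face K N j b))))
      (szF EK (Suc (Suc k) - i) (nchain EK2 (N - j) (back_face EK (Suc N) (Suc j) ?A, None)))))"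
  have s: "(\<Sum>j<N. ?s i j) = frag_cmul (ksign (int (Suc q))) (concat_tensor (tens
      (szF EK i (nchain EK2 (Suc q) (None, suspend q (front_face K N q b))))
      (szF EK (Suc (Suc k) - i) (nchain EK2 (Suc m) (suspend m u, None)))))" for i
  proof -
    have "(\<Sum>j<N. ?s i j) = (\<Sum>j\<in>{q}. ?s i j)"
      using assms zero by (intro sum.mono_neutral_right) (auto simp: szF_0_arg)
    also have "\<dots> = ?s i q" by simp
    finally show ?thesis unfolding back_q front_q Nq .
  qed
  have s0: "(\<Sum>j<N. ?s i j) = 0" if "i \<in> {1..Suc k}" "k \<noteq> 0" for i
  proof (cases "i = 1")
    case True
    then have "2 \<le> Suc (Suc k) - i" using that by auto
    then show ?thesis unfolding s using szF_None(1)[OF susp_pt_in[OF assms(1), of "Suc 0" "Suc m"]] by simp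
  next
    case False
    then have "2 \<le> i" using that by auto
    then show ?thesis unfolding s using szF_None(2)[OF susp_pt_in[OF b', of "Suc 0" "Suc q"]] by simp
  qed
  have eq: "szF_step EK k (nchain EK2 (Suc N) (?A, suspend N b)) = (\<Sum>i\<in>{1..Suc k}. \<Sum>j<N. ?s i j)"
    by (rule szF_step_cut[OF A assms(3)])
  show ?thesis
  proof (cases "k = 0")
    case False
    then show ?thesis unfolding if_not_P[OF False] eq using s0 by (intro sum.neutral) blast
  next
    case True
    have "(\<Sum>i\<in>{1..Suc k}. \<Sum>j<N. ?s i j) = (\<Sum>j<N. ?s 1 j)" by (simp add: True)
    also have "\<dots> = frag_cmul (ksign (int (Suc q))) (concat_tensor (tens
      (relabel (\<lambda>\<tau>. [((0, None), \<tau>)]) (nchain EK (Suc q) (suspend q (front_face K N q b))))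
      (relabel (\<lambda>\<sigma>. [(\<sigma>, (0, None))]) (nchain EK (Suc m) (suspend m u)))))"
      unfolding s using szF_1_None[OF susp_pt_in[OF assms(1), of "Suc 0" "Suc m"]]
        szF_1_None[OF susp_pt_in[OF b', of "Suc 0" "Suc q"]] by (simp add: True)
    finally show ?thesis unfolding if_P[OF True] eq .
  qed
qed

text \<open>
  On \<open>(1, x)\<close> derived operators act as the original operators act on \<open>x\<close>.
\<close>
lemma act_shift:
  assumes "valid_word n w m" "x \<in> simplices K n"
  shows "act EK (map shift_letter w) (Suc n) (suspend n x) = suspend m (act K w n x)"
  using assms
proof (induction rule: valid_word.induct)
  case (Deg n w m i)
  then show ?case using act_Deg[OF valid_word_shift[OF Deg(1)], of "susp K" "Suc i"] act_Deg[OF Deg(1), of K i]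
    by (simp add: degen_susp_pt)
next
  case (Fac n w m i)
  then show ?case using act_Fac[OF valid_word_shift[OF Fac(1)], of "susp K" "Suc i"] act_Fac[OF Fac(1), of K i]
    by (simp add: face_susp_pt)
qed simp

text \<open>
  The vertex 0 of \<open>(2, x) = s\<^sub>0 (1, x)\<close> is not touched by derived operators, so a derived front face
  operator keeps one vertex less of \<open>x\<close> than its index says, and none at all for \<open>p = 0\<close>.
\<close>
lemma act_front_shift:
  "p \<le> Suc n \<Longrightarrow> act EK (map shift_letter (front_op (Suc n) p)) (Suc (Suc n)) (susp_pt K n 2 x) =
    (if p = 0 then None else susp_pt K (p - 1) 2 (front_face K n (p - 1) x))"
proof (induction n arbitrary: x)
  case 0
  show ?case
  proof (cases p)
    case 0
    then show ?thesis by (simp add: front_op_Suc act_snoc[of "susp K" "[]", simplified] act_def face_susp_pt)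
  next
    case (Suc p')
    then show ?thesis using 0 by simp
  qed
next
  case (Suc n)
  show ?case
  proof (cases "p = Suc (Suc n)")
    case False
    have "face EK (Suc (Suc (Suc n))) (Suc (Suc (Suc n))) (susp_pt K (Suc n) 2 x) = susp_pt K n 2 (face K (Suc n) (Suc n) x)"
      by (simp add: face_susp_pt)
    then have "act EK (map shift_letter (front_op (Suc (Suc n)) p)) (Suc (Suc (Suc n))) (susp_pt K (Suc n) 2 x) =
       act EK (map shift_letter (front_op (Suc n) p)) (Suc (Suc n)) (susp_pt K n 2 (face K (Suc n) (Suc n) x))"
      using Suc.prems False by (simp add: front_op_Suc act_snoc)
    then show ?thesis using Suc False by (simp add: front_Suc)
  qed simp
qed

text \<open>
  Degeneracies are applied in increasing order. As long as the derived index lies in the suspension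
  coordinate, whose length starts at 2 and grows with each step, it repeats a vertex there; this goes on
  exactly for the indices \<open>0, 1, 2, \<dots>\<close>. The first index that jumps makes the other component degenerate,
  and it remains so.
\<close>
lemma act_degen_shift:
  assumes "finite \<nu>" "\<forall>i\<in>\<nu>. i < m + 1 + card \<nu>" "u \<in> simplices K m"
  shows "if \<nu> = {..<card \<nu>} then act EK (map shift_letter (degen_op \<nu>)) (m + 2) (susp_pt K m 2 u) = susp_pt K m (card \<nu> + 2) u
    else \<exists>m' a' u'. act EK (map shift_letter (degen_op \<nu>)) (m + 2) (susp_pt K m 2 u) = susp_pt K m' a' u' \<and>
      u' \<in> simplices K m' \<and> degenerate K m' u' \<and> 1 \<le> a' \<and> m' + a' = m + 2 + card \<nu>"
  using assms(1,2)
proof (induction rule: finite_linorder_max_induct)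
  case (insert b A)
  have b: "b \<notin> A" "b \<le> m + 1 + card A" "card (insert b A) = Suc (card A)" using insert by auto
  have A: "\<forall>i\<in>A. i < m + 1 + card A" using insert(2) b by fastforce
  have "valid_word (m + 1) (degen_op A) (m + 1 + card A)"
    by (rule valid_degen_op) (use insert A in auto)
  then have v: "valid_word (m + 2) (map shift_letter (degen_op A)) (m + 2 + card A)"
    using valid_word_shift by fastforce
  have step: "act EK (map shift_letter (degen_op (insert b A))) (m + 2) (susp_pt K m 2 u) =
    degen EK (m + 2 + card A) (Suc b) (act EK (map shift_letter (degen_op A)) (m + 2) (susp_pt K m 2 u))"
    using insert act_Deg[OF v] by (simp add: degen_op_insert)
  show ?case
  proof (cases "A = {..<card A}")
    case True
    then have act: "act EK (map shift_letter (degen_op A)) (m + 2) (susp_pt K m 2 u) = susp_pt K m (card A + 2) u"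
      using insert A by simp
    have "card A \<le> b" using b(1) True by (metis lessThan_iff not_le)
    then consider "b = card A" | "card A < b" by linarith
    then show ?thesis
    proof cases
      case 1
      then have "insert b A = {..<card (insert b A)}" using True b(3) by (metis lessThan_Suc)
      moreover have "act EK (map shift_letter (degen_op (insert b A))) (m + 2) (susp_pt K m 2 u) = susp_pt K m (card (insert b A) + 2) u"
        unfolding step act using 1 b(3) by (simp add: degen_susp_pt)
      ultimately show ?thesis by simp
    next
      case 2
      then have "insert b A \<noteq> {..<card (insert b A)}" using b(3) by (metis insertI1 lessThan_iff not_less_eq)
      moreover have "act EK (map shift_letter (degen_op (insert b A))) (m + 2) (susp_pt K m 2 u) =
         susp_pt K (Suc m) (card A + 2) (degen K m (Suc b - (card A + 2)) u)"
        unfolding step act using 2 b by (simp add: degen_susp_pt)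
      moreover have "degen K m (Suc b - (card A + 2)) u \<in> simplices K (Suc m)"
        "degenerate K (Suc m) (degen K m (Suc b - (card A + 2)) u)"
        using b assms(3) by (auto intro!: degen_closed degenerateI)
      moreover have "1 \<le> card A + 2" "Suc m + (card A + 2) = m + 2 + card (insert b A)" using b(3) by simp_all
      ultimately show ?thesis by (simp only: if_False) blast
    qed
  next
    case False
    then obtain m' a' u' where u': "act EK (map shift_letter (degen_op A)) (m + 2) (susp_pt K m 2 u) = susp_pt K m' a' u'"
      "u' \<in> simplices K m'" "degenerate K m' u'" "1 \<le> a'" "m' + a' = m + 2 + card A"
      using insert A by auto
    have "insert b A \<noteq> {..<card (insert b A)}"
    proof
      assume eq: "insert b A = {..<card (insert b A)}"
      have "A = {..<card A}"
      proof -
        have "b = card A"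
        proof (rule antisym)
          show "b \<le> card A" using eq b(3) by (metis insertI1 lessThan_iff less_Suc_eq_le)
          show "card A \<le> b"
          proof (rule ccontr)
            assume "\<not> card A \<le> b"
            then have "card A \<in> insert b A" "card A \<noteq> b" using eq b(3) by auto
            then show False using insert(2) \<open>\<not> card A \<le> b\<close> by auto
          qed
        qed
        then show ?thesis using eq b by (metis Diff_insert_absorb lessThan_Suc lessThan_iff less_irrefl)
      qed
      then show False using False by simp
    qed
    moreover have "act EK (map shift_letter (degen_op (insert b A))) (m + 2) (susp_pt K m 2 u) =
      (if Suc b < a' then susp_pt K m' (Suc a') u' else susp_pt K (Suc m') a' (degen K m' (Suc b - a') u'))"
      unfolding step u'(1) using u' b by (simp add: degen_susp_pt)
    moreover have "\<not> Suc b < a' \<Longrightarrow> degen K m' (Suc b - a') u' \<in> simplices K (Suc m') \<and> degenerate K (Suc m') (degen K m' (Suc b - a') u')"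
      using u' b by (auto intro!: degen_closed degenerateI)
    moreover have "m' + Suc a' = m + 2 + card (insert b A)" "Suc m' + a' = m + 2 + card (insert b A)" "1 \<le> Suc a'"
      using u' b(3) by simp_all
    ultimately show ?thesis
      using u'(2-4) by (cases "Suc b < a'"; simp only: if_False if_True; blast)
  qed
qed (simp add: numeral_2_eq_2)

text \<open>
  Degeneracies that repeat vertices from \<open>q\<close> on do not affect the front \<open>q\<close>-face.
\<close>
lemma front_degen_word:
  assumes "finite \<mu>" "\<forall>i\<in>\<mu>. q \<le> i \<and> i < q + card \<mu>" "y \<in> simplices K q"
  shows "front_face K (q + card \<mu>) q (act K (degen_op \<mu>) q y) = y"
  using assms(1,2)
proof (induction rule: finite_linorder_max_induct)
  case (insert b A)
  have b: "b \<notin> A" "q \<le> b" "b \<le> q + card A" "card (insert b A) = Suc (card A)" using insert by auto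
  have A: "\<forall>i\<in>A. q \<le> i \<and> i < q + card A" using insert(2,4) b by fastforce
  have v: "valid_word q (degen_op A) (q + card A)"
    by (rule valid_degen_op) (use insert A in auto)
  have "act K (degen_op A) q y \<in> simplices K (q + card A)" by (rule act_closed[OF v assms(3)])
  then show ?case
    using insert A b front_degen_ge[of "act K (degen_op A) q y" "q + card A" q b]
    by (simp add: degen_op_insert act_Deg[OF v])
qed simp

text \<open>
  For \<open>p = 0\<close> the left component is a base simplex and the right one is \<open>s\<^sub>0 (1, x)\<close>.
\<close>
lemma szF_step_ez_0:
  assumes x: "x \<in> simplices K n" and \<mu>: "\<mu> \<in> shuffles (Suc n) 0"
  shows "nchain EK2 (Suc (Suc n))
    (act EK (ez_left (Suc n) 0 \<mu>) (Suc n) (suspend n x),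
     act EK (ez_right 0 \<mu>) (Suc n) (suspend n x)) = 0"
proof -
  let ?z = "suspend n x"
  have z: "?z \<in> simplices EK (Suc n)" using x by (simp add: susp_pt_in)
  have s: "degen EK (Suc n) 0 ?z = susp_pt K n 2 x" by (simp add: degen_susp_pt numeral_2_eq_2)
  have \<mu>0: "\<mu> = {}" using shufflesD[OF \<mu>] by simp
  have "valid_word (Suc (Suc n)) (map shift_letter (front_op (Suc n) 0)) (Suc 0)"
    by (intro valid_word_shift valid_front_op) simp
  then have A: "act EK (ez_left (Suc n) 0 \<mu>) (Suc n) ?z = None"
    using act_front_shift[of 0 n x] by (subst act_snoc) (simp add: s act_append)
  have B: "act EK (ez_right 0 \<mu>) (Suc n) ?z = degen EK (Suc n) 0 ?z"
    using act_snoc[of "susp K" "[]" "Deg 0" "Suc n" ?z] by (simp add: \<mu>0)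
  show ?thesis
    unfolding A B using nchain_degen[of "(None, ?z)" EK2 "Suc n" 0] z by simp
qed

text \<open>
  Here the index of \<open>front_op\<close> and \<open>back_op\<close> is \<open>p + 1\<close>, since \<open>(1, x)\<close> has one vertex more than \<open>x\<close>.
  On the left \<open>\<nu>\<close>, the complement of \<open>\<mu>\<close>, acts on \<open>(2, u)\<close> with \<open>u\<close> the front face of \<open>x\<close>. On the right one
  of the \<open>p + 1\<close> faces cancels the final \<open>s\<^sub>0\<close>, which leaves \<open>(1, b)\<close>, where \<open>b\<close> arises from the
  back face of \<open>x\<close>.
\<close>
lemma szF_step_ez:
  assumes x: "x \<in> simplices K n" and p: "p \<le> n" and \<mu>: "\<mu> \<in> shuffles (Suc n) (Suc p)"
  shows "szF_step EK k (nchain EK2 (Suc (Suc n))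
    (act EK (ez_left (Suc n) (Suc p) \<mu>) (Suc n) (suspend n x),
     act EK (ez_right (Suc p) \<mu>) (Suc n) (suspend n x))) =
   (if \<mu> = {n - p..<Suc n} \<and> k = 0 then frag_cmul (ksign (int (Suc (n - p)))) (shuffle_term K n x p) else 0)"
proof -
  let ?z = "suspend n x"
  define q where "q = n - p"
  define \<nu> where "\<nu> = {..<Suc n} - \<mu>"
  define u where "u = front_face K n p x"
  define y where "y = back_face K n p x"
  note sD = shufflesD[OF \<mu>]
  have z: "?z \<in> simplices EK (Suc n)" using x by (simp add: susp_pt_in)
  have u: "u \<in> simplices K p" and y: "y \<in> simplices K q"
    using x p by (simp_all add: u_def y_def q_def front_closed back_closed)
  have s: "degen EK (Suc n) 0 ?z = susp_pt K n 2 x" by (simp add: degen_susp_pt numeral_2_eq_2)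
  have \<nu>: "finite \<nu>" "card \<nu> = q" "\<forall>i\<in>\<nu>. i < p + 1 + card \<nu>"
    using sD p by (auto simp: \<nu>_def q_def)
  have "valid_word (Suc (Suc n)) (map shift_letter (front_op (Suc n) (Suc p))) (p + 2)"
    using valid_word_shift[OF valid_front_op[of "Suc p" "Suc n"]] p by simp
  then have A: "act EK (map shift_letter (degen_op \<nu> @ front_op (Suc n) (Suc p)) @ [Deg 0]) (Suc n) ?z =
      act EK (map shift_letter (degen_op \<nu>)) (p + 2) (susp_pt K p 2 u)"
    using act_front_shift[of "Suc p" n x] p by (subst act_snoc) (simp add: s act_append u_def)
  define b where "b = act K (degen_op \<mu>) q y"
  have vd: "valid_word q (degen_op \<mu>) (Suc n)" using valid_shuffle(2)[OF \<mu>] by (simp add: q_def)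
  have vb: "valid_word n (back_op p) q" unfolding q_def by (rule valid_back_op[OF p])
  have b: "b \<in> simplices K (Suc n)" unfolding b_def by (rule act_closed[OF vd y])
  have face1: "face EK (Suc (Suc n)) (Suc 0) (degen EK (Suc n) 0 ?z) = ?z"
    by (rule S.face_degen_same[OF z]) simp_all
  have "act EK (ez_right (Suc p) \<mu>) (Suc n) ?z =
      act EK (map shift_letter (degen_op \<mu> @ back_op p) @ [Fac (Suc 0)]) (Suc (Suc n)) (degen EK (Suc n) 0 ?z)"
    by (subst act_snoc) (simp add: back_op_Suc)
  also have "\<dots> = act EK (map shift_letter (degen_op \<mu> @ back_op p)) (Suc n) ?z"
    by (subst act_snoc) (simp add: face1)
  also have "\<dots> = suspend (Suc n) (act K (degen_op \<mu> @ back_op p) n x)"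
    by (rule act_shift[OF valid_word_append[OF vd vb] x])
  also have "act K (degen_op \<mu> @ back_op p) n x = b"
    by (simp add: act_append[OF vb] b_def y_def back_face_def)
  finally have B: "act EK (ez_right (Suc p) \<mu>) (Suc n) ?z = suspend (Suc n) b" .
  have \<mu>\<nu>: "\<mu> = {n - p..<Suc n} \<longleftrightarrow> \<nu> = {..<card \<nu>}"
  proof -
    have "\<mu> = {..<Suc n} - \<nu>" using sD(1) by (auto simp: \<nu>_def)
    moreover have "{..<Suc n} - {..<q} = {q..<Suc n}" "{..<Suc n} - {q..<Suc n} = {..<q}" by (auto simp: q_def)
    ultimately show ?thesis unfolding \<nu>(2) q_def[symmetric] by (metis \<nu>_def)
  qed
  show ?thesis
  proof (cases "\<mu> = {n - p..<Suc n}")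
    case False
    then have "\<nu> \<noteq> {..<card \<nu>}" using \<mu>\<nu> by simp
    then obtain m' a' u' where u': "act EK (map shift_letter (degen_op \<nu>)) (p + 2) (susp_pt K p 2 u) = susp_pt K m' a' u'"
      "u' \<in> simplices K m'" "degenerate K m' u'" "1 \<le> a'" "m' + a' = p + 2 + card \<nu>"
      using act_degen_shift[OF \<nu>(1,3) u] unfolding if_not_P[OF \<open>\<nu> \<noteq> {..<card \<nu>}\<close>] by blast
    have "Suc (Suc n) = m' + a'" using u'(5) \<nu>(2) p by (simp add: q_def)
    then have "szF_step EK k (nchain EK2 (Suc (Suc n)) (susp_pt K m' a' u', suspend (Suc n) b)) = 0"
      by (rule szF_step_degenerate[OF u'(2,4,3) _ b])
    then show ?thesis unfolding B \<nu>_def[symmetric] A u'(1) using False by simp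
  next
    case True
    then have "\<nu> = {..<card \<nu>}" using \<mu>\<nu> by simp
    then have A': "act EK (map shift_letter (degen_op \<nu>)) (p + 2) (susp_pt K p 2 u) = susp_pt K p (q + 2) u"
      using act_degen_shift[OF \<nu>(1,3) u] \<nu>(2) by (simp only: if_True)
    have "front_face K (q + card \<mu>) q b = y"
      unfolding b_def using sD p by (intro front_degen_word y) (auto simp: True q_def)
    moreover have "q + card \<mu> = Suc n" using sD p by (simp add: q_def)
    ultimately have fy: "front_face K (Suc n) q b = y" by simp
    have "Suc n = p + Suc q" using p by (simp add: q_def)
    from szF_step_shuffle[OF u this b, of k] show ?thesis
      unfolding B \<nu>_def[symmetric] A A' fy shuffle_term_def using True by (simp add: u_def y_def q_def)
  qed
qed

text \<open>
  The homotopy on \<open>\<Lambda> (1, x)\<close>, unrolled once. The exponent \<open>(p + 1) (n - p)\<close> is the one of the shuffle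
  \<open>{n - p, \<dots>, n}\<close>, all of whose \<open>p + 1\<close> elements are moved by \<open>n - p\<close> places.
\<close>
lemma szF_step_phi_diagonal:
  assumes x: "x \<in> simplices K n"
  shows "szF_step EK k (phi EK EK (frag_of (Suc n, (suspend n x, suspend n x)))) =
    (if k = 0 then \<Sum>p\<le>n. frag_cmul ((- 1) ^ (Suc p * (n - p)) * ksign (int (Suc (n - p)))) (shuffle_term K n x p) else 0)"
proof -
  let ?z = "suspend n x"
  \<comment> \<open>\<open>E\<close> evaluates a formal sum of operators on \<open>\<Lambda> (1, x)\<close>.\<close>
  define E where "E = frag_extend (\<lambda>(u, v). nchain EK2 (Suc (Suc n)) (act EK u (Suc n) ?z, act EK v (Suc n) ?z))"
  have E_lin: "E (a + b) = E a + E b" "E (- a) = - E a" "E (frag_cmul m a) = frag_cmul m (E a)" "E (sum h I) = (\<Sum>i\<in>I. E (h i))"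
     "E (a - b) = E a - E b" "E 0 = 0" "E (frag_of (u, v)) = nchain EK2 (Suc (Suc n)) (act EK u (Suc n) ?z, act EK v (Suc n) ?z)"
    for a b m u v and h :: "'i \<Rightarrow> _" and I
    by (simp_all add: E_def lin)
  have E_sum: "E (sum h I) = (\<Sum>i\<in>I. E (h i))" for h :: "'j \<Rightarrow> _" and I
    by (simp add: E_def lin)
  have phi: "phi EK EK (frag_of (Suc n, (?z, ?z))) = E (phi_op (Suc n))"
    by (simp add: phi_def E_def)
  have derived: "szF_step EK k (E (derived_op (phi_op n))) = 0"
  proof -
    have "szF_step EK k (E (derived_op c)) = 0" if "supp c \<subseteq> degeneracy_words n" for c
      using that
    proof (induction rule: frag_induction)
      case (one w)
      then obtain u v where w: "w = (u, v)" "valid_word n u (Suc n)" "valid_word n v (Suc n)"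
        by (auto simp: degeneracy_words_def)
      show ?case
        using szF_step_susp_pair[OF act_closed[OF w(2) x] act_closed[OF w(3) x]]
        by (simp add: w(1) E_lin act_shift[OF w(2) x] act_shift[OF w(3) x])
    qed (simp_all add: lin E_lin)
    then show ?thesis using phi_op_supp by blast
  qed
  let ?N = "\<lambda>p \<mu>. nchain EK2 (Suc (Suc n))
    (act EK (ez_left (Suc n) p \<mu>) (Suc n) ?z,
     act EK (ez_right p \<mu>) (Suc n) ?z)"
  have "E (comp_s0 (derived_op (ez_op (Suc n)))) = (\<Sum>p\<le>Suc n. \<Sum>\<mu>\<in>shuffles (Suc n) p. frag_cmul ((- 1) ^ shuffle_exp \<mu>) (?N p \<mu>))"
    unfolding ez_op_eq lin derived_comp_basis E_sum E_lin(3,7) ..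
  also have "\<dots> = (\<Sum>p\<le>n. \<Sum>\<mu>\<in>shuffles (Suc n) (Suc p). frag_cmul ((- 1) ^ shuffle_exp \<mu>) (?N (Suc p) \<mu>))"
  proof -
    have "(\<Sum>\<mu>\<in>shuffles (Suc n) 0. frag_cmul ((- 1) ^ shuffle_exp \<mu>) (?N 0 \<mu>)) = 0"
      using szF_step_ez_0[OF x] by (intro sum.neutral ballI) (simp only: frag_cmul_zero2)
    then show ?thesis by (subst sum.atMost_Suc_shift) (simp only: add_0_left)
  qed
  finally have ez: "E (comp_s0 (derived_op (ez_op (Suc n)))) =
     (\<Sum>p\<le>n. \<Sum>\<mu>\<in>shuffles (Suc n) (Suc p). frag_cmul ((- 1) ^ shuffle_exp \<mu>) (?N (Suc p) \<mu>))" .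
  have step: "szF_step EK k (\<Sum>\<mu>\<in>shuffles (Suc n) (Suc p). frag_cmul ((- 1) ^ shuffle_exp \<mu>) (?N (Suc p) \<mu>)) =
     (if k = 0 then frag_cmul ((- 1) ^ (Suc p * (n - p)) * ksign (int (Suc (n - p)))) (shuffle_term K n x p) else 0)"
    if p: "p \<le> n" for p
  proof -
    let ?\<mu> = "{n - p..<Suc n}"
    have mem: "?\<mu> \<in> shuffles (Suc n) (Suc p)" using p by (auto simp: shuffles_def)
    have ex: "shuffle_exp ?\<mu> = Suc p * (n - p)"
      using shuffle_exp_interval[of "n - p" "Suc p"] p by simp
    have "szF_step EK k (\<Sum>\<mu>\<in>shuffles (Suc n) (Suc p). frag_cmul ((- 1) ^ shuffle_exp \<mu>) (?N (Suc p) \<mu>)) =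
      (\<Sum>\<mu>\<in>shuffles (Suc n) (Suc p). frag_cmul ((- 1) ^ shuffle_exp \<mu>)
        (if \<mu> = ?\<mu> \<and> k = 0 then frag_cmul (ksign (int (Suc (n - p)))) (shuffle_term K n x p) else 0))"
      unfolding szF_step_lin by (intro sum.cong refl) (simp only: szF_step_ez[OF x p])
    also have "\<dots> = (\<Sum>\<mu>\<in>shuffles (Suc n) (Suc p). if \<mu> = ?\<mu> then (if k = 0 then frag_cmul ((- 1) ^ shuffle_exp ?\<mu>)
         (frag_cmul (ksign (int (Suc (n - p)))) (shuffle_term K n x p)) else 0) else 0)"
      by (intro sum.cong refl) auto
    also have "\<dots> = (if k = 0 then frag_cmul ((- 1) ^ shuffle_exp ?\<mu>)
         (frag_cmul (ksign (int (Suc (n - p)))) (shuffle_term K n x p)) else 0)"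
      using mem by (subst sum.delta) simp_all
    finally show ?thesis unfolding ex by simp
  qed
  have "szF_step EK k (phi EK EK (frag_of (Suc n, (?z, ?z)))) =
    (\<Sum>p\<le>n. szF_step EK k (\<Sum>\<mu>\<in>shuffles (Suc n) (Suc p). frag_cmul ((- 1) ^ shuffle_exp \<mu>) (?N (Suc p) \<mu>)))"
    unfolding phi phi_op.simps E_lin(1,2) szF_step_lin(4,3) derived ez szF_step_lin(6) by simp
  also have "\<dots> = (\<Sum>p\<le>n. (if k = 0 then frag_cmul ((- 1) ^ (Suc p * (n - p)) * ksign (int (Suc (n - p)))) (shuffle_term K n x p) else 0))"
    by (intro sum.cong refl step) simp
  finally show ?thesis by simp
qed

end

section \<open>The comparison isomorphism\<close>

lemma cobar_susp_eq:
  "cobar_susp K = word_hopf (red_cells (susp K)) bar_deg (cobar_gen_diff K) (\<lambda>\<sigma>. xi (susp K) (frag_of \<sigma>))"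
  unfolding cobar_susp_def cobar_alg_def word_hopf_def cobar_diff_def
  by (simp add: cobar_gen_diff_def[abs_def])

context based_sset
begin

text \<open>
  The summands of the coproduct of \<open>x\<close> in which every vertex \<open>y\<close> is replaced by \<open>y - k\<^sub>0\<close>, in the tensor
  algebra and, renamed, in the cobar construction.
\<close>
abbreviation gen_cut where
  "gen_cut n x p \<equiv> tens (red_gen K (nchain K p (front_face K n p x))) (red_gen K (nchain K (n - p) (back_face K n p x)))"

abbreviation susp_cut where
  "susp_cut n x p \<equiv> tens (relabel (map (susp_cell K)) (red_gen K (nchain K p (front_face K n p x))))
     (relabel (map (susp_cell K)) (red_gen K (nchain K (n - p) (back_face K n p x))))"

lemma unit_gen_nchain: "unit_gen K (nchain K n x) = red_gen K (nchain K n x) + (if n = 0 then frag_of [] else 0)"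
  by (auto simp: nchain_def)

text \<open>
  A vertex is sent to \<open>(y - k\<^sub>0) + 1\<close>. The summands 1 matter only in the first and in the last cut,
  where the other factor is \<open>x\<close>. For a vertex \<open>x\<close> these two cuts coincide, and \<open>1 \<otimes> 1\<close> is cancelled by the
  coproduct of \<open>k\<^sub>0\<close>.
\<close>
lemma chains_gen_diag_expand:
  assumes \<sigma>: "(n, x) \<in> red_cells K"
  shows "chains_gen_diag K (n, x) = frag_of ([], [(n, x)]) + frag_of ([(n, x)], []) +
    (\<Sum>p\<le>n. gen_cut n x p)"
proof -
  have x: "x \<in> simplices K n" "nchain K n x = frag_of (n, x)" "(n, x) \<noteq> (0, basept K)"
    using \<sigma> red_cells_iff[of n x] by (simp_all add: nchain_def) (simp add: red_cells_def)
  have L: "linear_map (unit_gen K)" by (rule linear_unit_gen)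
  have cop: "tensor_map cdeg 0 (unit_gen K) (unit_gen K) (coprod K (frag_of (n, x))) =
    (\<Sum>p\<le>n. tens (unit_gen K (nchain K p (front_face K n p x))) (unit_gen K (nchain K (n - p) (back_face K n p x))))"
    using x by (simp add: coprod_nchain tensor_map_lin tensor_map_tens_0[OF L L] flip: x(2))
  show ?thesis
  proof (cases n)
    case 0
    have "coprod K (frag_of (0, basept K)) = frag_of ((0, basept K), (0, basept K))"
      using coprod_nchain[OF basept_in] by (simp add: nchain_0)
    then show ?thesis
      using cop x by (simp add: chains_gen_diag_def red_incl_def 0 lin nchain_0)
  next
    case (Suc m)
    have "(\<Sum>p\<le>n. tens (unit_gen K (nchain K p (front_face K n p x))) (unit_gen K (nchain K (n - p) (back_face K n p x)))) =
      (\<Sum>p\<le>n. gen_cut n x p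
        + (if p = 0 then tens (frag_of []) (red_gen K (nchain K n x)) else 0)
        + (if p = n then tens (red_gen K (nchain K n x)) (frag_of []) else 0))"
      using Suc by (intro sum.cong refl) (auto simp: unit_gen_nchain tens_lin)
    also have "\<dots> = (\<Sum>p\<le>n. gen_cut n x p)
       + tens (frag_of []) (red_gen K (nchain K n x)) + tens (red_gen K (nchain K n x)) (frag_of [])"
      by (simp add: sum.distrib)
    finally show ?thesis
      using cop x Suc by (simp add: chains_gen_diag_def red_incl_def algebra_simps)
  qed
qed

lemma milgram_shuffle_term:
  assumes "x \<in> simplices K n" "p \<le> n"
  shows "milgram EK (shuffle_term K n x p) = frag_cmul (ksign (int ((n - p) * p)))
    (susp_cut n x p)"
proof -
  have "front_face K n p x \<in> simplices K p" "back_face K n p x \<in> simplices K (n - p)"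
    using assms by (simp_all add: front_closed back_closed)
  then show ?thesis
    using milgram_product[OF nchain_homogeneous nchain_homogeneous, of "susp K"]
    by (simp add: shuffle_term_def red_gen_susp)
qed

text \<open>
  The primitive terms come from \<open>F\<^sub>1\<close>, the remaining ones from \<open>F\<^sub>2\<close>, and the higher \<open>F\<^sub>k\<close> vanish.
\<close>
lemma xi_susp_cell:
  assumes \<sigma>: "(n, x) \<in> red_cells K"
  shows "xi EK (frag_of (susp_cell K (n, x))) = frag_of ([], [susp_cell K (n, x)]) + frag_of ([susp_cell K (n, x)], []) +
    (\<Sum>p\<le>n. susp_cut n x p)"
proof -
  let ?z = "suspend n x" and ?\<tau> = "susp_cell K (n, x)"
  let ?c = "frag_of (Suc n, (?z, ?z))"
  have x: "x \<in> simplices K n" using \<sigma> by (simp add: red_cells_iff)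
  have \<tau>: "?\<tau> = (Suc n, ?z)" by (simp add: susp_cell_def)
  have nd: "\<not> degenerate EK (Suc n) ?z" "nchain EK (Suc n) ?z = frag_of ?\<tau>"
    using degenerate_susp_pt[OF x, of "Suc 0"] \<sigma> by (simp_all add: red_cells_iff susp_cell_nchain[OF \<sigma>])
  have "\<not> degenerate EK2 (Suc n) (?z, ?z)"
    using nd(1) by (auto simp: degenerate_def)
  then have diagonal: "chain_map EK2 (\<lambda>n x. (x, x)) (frag_of ?\<tau>) = ?c"
    by (simp add: chain_map_def \<tau> nchain_def)
  have "aw EK EK ?c = coprod EK (frag_of ?\<tau>)"
    by (simp add: aw_def coprod_def \<tau>)
  then have "aw EK EK ?c = frag_of ((0, None), ?\<tau>) + frag_of (?\<tau>, (0, None))"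
    using coprod_susp_pt[OF x] by (simp add: nd(2))
  then have F1: "szF EK 1 ?c = frag_of [((0, None), ?\<tau>)] + frag_of [(?\<tau>, (0, None))]"
    by (simp add: lin \<tau>)
  have F: "szF EK (Suc (Suc k)) ?c = - (if k = 0 then \<Sum>p\<le>n. frag_cmul ((- 1) ^ (Suc p * (n - p)) * ksign (int (Suc (n - p)))) (shuffle_term K n x p) else 0)" for k
    unfolding szF_Suc_Suc szF_step_phi_diagonal[OF x] ..
  have "Sum_any (\<lambda>k. szF EK k ?c) = (\<Sum>k\<in>{1, 2}. szF EK k ?c)"
  proof (rule Sum_any.expand_superset)
    show "{k. szF EK k ?c \<noteq> 0} \<subseteq> {1, 2}"
    proof
      fix k assume k: "k \<in> {k. szF EK k ?c \<noteq> 0}"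
      consider "k = 0" | "k = 1" | "k = 2" | j where "k = Suc (Suc (Suc j))"
        by (metis One_nat_def not0_implies_Suc numeral_2_eq_2)
      then show "k \<in> {1, 2}"
        using k F[of "Suc _"] by cases (simp_all del: szF.simps(3))
    qed
  qed simp
  then have "xi EK (frag_of ?\<tau>) = milgram EK (szF EK 1 ?c) + milgram EK (szF EK 2 ?c)"
    by (simp add: xi_def diagonal milgram_lin del: szF.simps)
  also have "milgram EK (szF EK 1 ?c) = frag_of ([], [?\<tau>]) + frag_of ([?\<tau>], [])"
    using milgram_generators[of ?\<tau> "susp K"] unfolding F1 by (simp add: milgram_lin \<tau>)
  also have "milgram EK (szF EK 2 ?c) =
    (\<Sum>p\<le>n. susp_cut n x p)"
  proof -
    \<comment> \<open>The signs of the shuffle, of moving \<open>F\<^sub>1\<close> past the front factor and of the Milgram map; the minus sign in the recursion cancels their product.\<close>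
    have sign: "(- 1) ^ (Suc p * q) * ksign (int (Suc q)) * ksign (int (q * p)) = - 1" for p q :: nat
      by (simp add: ksign_def minus_one_power_iff)
    have "milgram EK (szF EK 2 ?c) = - (\<Sum>p\<le>n. frag_cmul ((- 1) ^ (Suc p * (n - p)) * ksign (int (Suc (n - p)))) (milgram EK (shuffle_term K n x p)))"
      unfolding numeral_2_eq_2 F by (simp add: milgram_lin)
    also have "\<dots> = - (\<Sum>p\<le>n. - susp_cut n x p)"
      using x by (intro arg_cong[where f = uminus] sum.cong refl) (simp only: milgram_shuffle_term atMost_iff frag_cmul_cmul sign frag_cmul_minus_one)
    finally show ?thesis by (simp add: sum_negf)
  qed
  finally show ?thesis .
qed

lemma xi_eq_relabel:
  assumes "\<sigma> \<in> red_cells K"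
  shows "xi EK (frag_of (susp_cell K \<sigma>)) = relabel (map_prod (map (susp_cell K)) (map (susp_cell K))) (chains_gen_diag K \<sigma>)"
  using assms by (cases \<sigma>) (simp add: xi_susp_cell chains_gen_diag_expand lin relabel_tens)

lemma alpha_hat_eq:
  assumes "supp a \<subseteq> lists (red_cells K)"
  shows "alpha_hat K a = relabel (map (susp_cell K)) a"
proof -
  interpret W: graded_alg "cobar_alg EK" unfolding cobar_alg_def by (rule word_graded_alg)
  have gen: "alpha K (red_incl K \<sigma>) = frag_of [susp_cell K \<sigma>]" if "\<sigma> \<in> red_cells K" for \<sigma>
    using that by (cases \<sigma>) (auto simp: alpha_def red_incl_def lin susp_cell_def red_cells_def)
  from assms show ?thesis
  proof (induction rule: frag_induction)
    case (one w)
    then show ?case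
      by (induction w) (simp_all add: alpha_hat_def gen cobar_alg_def)
  qed (simp_all add: lin alpha_hat_def)
qed

lemma hopf_relabelling_susp:
  "hopf_relabelling (red_cells K) cdeg (chains_gen_diff K) (chains_gen_diag K) bar_deg (cobar_gen_diff K)
     (\<lambda>\<sigma>. xi EK (frag_of \<sigma>)) (susp_cell K)"
proof -
  interpret word_hopf_data "red_cells K" cdeg "chains_gen_diff K" "chains_gen_diag K"
    by (rule chains_word_hopf_data)
  interpret target: word_derivation bar_deg "cobar_gen_diff K" by (rule word_derivation_susp)
  have "bar_deg (susp_cell K \<sigma>) = cdeg \<sigma>" for \<sigma>
    by (simp add: susp_cell_def bar_deg_def)
  then show ?thesis
    by unfold_locales (simp_all add: homogeneous_xi cobar_gen_diff_susp_cell xi_eq_relabel)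
qed

theorem alpha_hat_chain_hopf_iso: "chain_hopf_iso (tensor_chains K) (cobar_susp K) (alpha_hat K)"
proof -
  interpret hopf_relabelling "red_cells K" cdeg "chains_gen_diff K" "chains_gen_diag K" bar_deg "cobar_gen_diff K"
     "\<lambda>\<sigma>. xi EK (frag_of \<sigma>)" "susp_cell K"
    by (rule hopf_relabelling_susp)
  show ?thesis
    unfolding tensor_chains_eq cobar_susp_eq red_cells_susp
    by (rule chain_hopf_iso_relabel[OF inj_susp_cell alpha_hat_eq])
qed

end

text \<open>
  Both composites are algebra maps; on a generator \<open>x\<close> both give the generator of \<open>(1, g x)\<close>, or 0 if
  \<open>g x\<close> is degenerate or the basepoint.
\<close>
lemma alpha_hat_natural:
  fixes K :: "'a pointed_sset" and L :: "'b pointed_sset"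
  assumes K: "pointed_simplicial_set K" and L: "pointed_simplicial_set L" and g: "pointed_simplicial_map K L g"
    and a: "supp a \<subseteq> lists (red_cells K)"
  shows "alpha_hat L (tensor_chains_map K L g a) = cobar_map (susp K) (susp L) (susp_map L g) (alpha_hat K a)"
proof -
  let ?r = "relabel (map (susp_cell L))"
  let ?f = "\<lambda>\<sigma>. red_gen L (chain_map L g (red_incl K \<sigma>))"
  let ?F = "\<lambda>\<tau>. red_gen (susp L) (chain_map (susp L) (susp_map L g) (red_incl (susp K) \<tau>))"
  interpret K: based_sset K using K by (rule based_sset.intro)
  interpret L: based_sset L using L by (rule based_sset.intro)
  interpret WL: graded_alg "cobar_alg (susp L)" unfolding cobar_alg_def by (rule word_graded_alg)
  have basept_cell: "(0, basept L) \<in> nondeg_cells L" by (rule L.basept_cell)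
  have chain_map: "chain_map L g (red_incl K (n, x)) = nchain L n (g n x) - (if n = 0 then frag_of (0, basept L) else 0)" for n x
    using g by (auto simp: red_incl_def chain_map_def lin nchain_0 pointed_simplicial_map_def)
  have gen: "supp (?f \<sigma>) \<subseteq> lists (red_cells L) - {[]}" "?F (susp_cell K \<sigma>) = ?r (?f \<sigma>)" if "\<sigma> \<in> red_cells K" for \<sigma>
  proof -
    obtain n x where \<sigma>: "\<sigma> = (n, x)" by (cases \<sigma>)
    then have x: "x \<in> simplices K n" "x \<noteq> base_simplex K n" using that by (simp_all add: K.red_cells_iff)
    then have gx: "g n x \<in> simplices L n" using g by (auto simp: pointed_simplicial_map_def)
    have f: "?f \<sigma> = red_gen L (nchain L n (g n x))"
      unfolding \<sigma> chain_map by (simp add: lin)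
    show "supp (?f \<sigma>) \<subseteq> lists (red_cells L) - {[]}"
      unfolding f by (rule L.red_gen_supp[OF nchain_supp[OF gx]])
    have "?F (susp_cell K \<sigma>) = red_gen (susp L) (nchain (susp L) (Suc n) (susp_pt L n (Suc 0) (g n x)))"
      using x(2) by (simp add: red_incl_def[of "susp K"] chain_map_def \<sigma> susp_cell_def susp_map_def susp_pt_def[of K])
    then show "?F (susp_cell K \<sigma>) = ?r (?f \<sigma>)"
      unfolding f using L.red_gen_susp[OF gx] by simp
  qed
  have word: "supp (tensor_chains_map K L g (frag_of w)) \<subseteq> lists (red_cells L) \<and>
      ?r (tensor_chains_map K L g (frag_of w)) = cobar_map (susp K) (susp L) (susp_map L g) (frag_of (map (susp_cell K) w))"
    if "w \<in> lists (red_cells K)" for w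
    using that
  proof (induction w)
    case Nil
    then show ?case by (simp add: tensor_chains_map_def cobar_map_def tensor_chains_alg_def cobar_alg_def)
  next
    case (Cons \<sigma> w)
    let ?t = "tensor_chains_map K L g (frag_of w)"
    have t: "tensor_chains_map K L g (frag_of (\<sigma> # w)) = bilin (\<lambda>u v. frag_of (u @ v)) (?f \<sigma>) ?t"
      by (simp add: tensor_chains_map_def tensor_chains_alg_def)
    have c: "cobar_map (susp K) (susp L) (susp_map L g) (frag_of (map (susp_cell K) (\<sigma> # w))) =
      bilin (\<lambda>u v. frag_of (u @ v)) (?F (susp_cell K \<sigma>)) (cobar_map (susp K) (susp L) (susp_map L g) (frag_of (map (susp_cell K) w)))"
      by (simp add: cobar_map_def cobar_alg_def)
    have "supp (bilin (\<lambda>u v. frag_of (u @ v)) (?f \<sigma>) ?t) \<subseteq> lists (red_cells L)"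
      by (rule keys_bilin_subset[of _ "lists (red_cells L)" _ "lists (red_cells L)"])
        (use gen(1)[OF Cons.hyps(1)] Cons.IH in auto)
    then show ?case
      unfolding t c relabel_concat gen(2)[OF Cons.hyps(1)] using Cons.IH by simp
  qed
  have "supp (tensor_chains_map K L g a) \<subseteq> lists (red_cells L) \<and>
      ?r (tensor_chains_map K L g a) = cobar_map (susp K) (susp L) (susp_map L g) (relabel (map (susp_cell K)) a)"
    using a
  proof (induction rule: frag_induction)
    case (diff b c)
    then show ?case
      using keys_diff[of "tensor_chains_map K L g b" "tensor_chains_map K L g c"]
      by (auto simp: tensor_chains_map_def cobar_map_def lin)
  qed (use word in \<open>simp_all add: tensor_chains_map_def cobar_map_def\<close>)
  then show ?thesis
    using L.alpha_hat_eq K.alpha_hat_eq[OF a] by simp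
qed

theorem theorem4p9:
  fixes K :: "'a pointed_sset"
  assumes "pointed_simplicial_set K"
  shows "chain_hopf_iso (tensor_chains K) (cobar_susp K) (alpha_hat K) \<and>
    (\<forall>(L :: 'b pointed_sset) g.
       pointed_simplicial_set L \<and> pointed_simplicial_map K L g \<longrightarrow>
       (\<forall>a \<in> carrier (tensor_chains K).
          alpha_hat L (tensor_chains_map K L g a) =
          cobar_map (susp K) (susp L) (susp_map L g) (alpha_hat K a)))"
  using based_sset.alpha_hat_chain_hopf_iso[OF based_sset.intro[OF assms]] alpha_hat_natural[OF assms]
  by (auto simp: tensor_chains_eq)

end
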